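(* Let $T$ be a string of length $n$ and let $\tau$ be a parameter with $1 \leq \tau \leq n$. Then the palindrome problem on $T$ can be solved (i) in $O(n/\sqrt{\tau})$ space and $O(n^2/\sqrt{\tau} + n\tau)$ time, or (ii) in $O(n/\tau)$ space and $O(n\cdot\tau\log n)$ time with high probability.
   Context: For a string $S$, $S^R$ denotes its reverse. A substring $T[i\ldots j]$ of $T$ is a maximal palindrome iff $T[i\ldots j] = T[i\ldots j]^R$ and $T[i-1\ldots j+1] \neq T[i-1\ldots j+1]^R$. The palindrome problem is to report the set of all maximal palindromes in $T$. The input string is in read-only memory and is not counted in the space; space is measured in machine words. "With high probability" means with probability at least $1-1/n^c$ for any constant $c$. *)

theory Defs
  imports "HOL-Probability.Probability"
begin

text \<open>Positions are counted from 1. A character is a machine word, represented by a natural number.\<close>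

definition substring :: "nat list \<Rightarrow> nat \<Rightarrow> nat \<Rightarrow> nat list" where
  "substring T i j = take (Suc j - i) (drop (i - 1) T)"

definition palindrome_at :: "nat list \<Rightarrow> nat \<Rightarrow> nat \<Rightarrow> bool" where
  "palindrome_at T i j \<longleftrightarrow>
     1 \<le> i \<and> i \<le> j \<and> j \<le> length T \<and> substring T i j = rev (substring T i j)"

text \<open>If \<open>i = 1\<close> or \<open>j = length T\<close>, then the extension by one position on both sides is not a
  substring of \<open>T\<close>; the range conditions in \<^const>\<open>palindrome_at\<close> make such a palindrome maximal.\<close>

definition maximal_palindromes :: "nat list \<Rightarrow> (nat \<times> nat) set" where
  "maximal_palindromes T =
     {(i, j). palindrome_at T i j \<and> \<not> palindrome_at T (i - 1) (j + 1)}"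

datatype binop = Add | Sub | Mul | Div | Mod | And | Or | Xor | Shl | Shr | Lt | Eq

text \<open>Programs of a randomized word RAM with read-only input and write-only output. \<open>Read\<close> accesses
  the input, \<open>Load\<close> and \<open>Store\<close> the working memory; a test succeeds iff its value is nonzero.\<close>

datatype exp = Lit nat | Reg nat | Bin binop exp exp

datatype com =
    Skip
  | Assign nat exp
  | Load nat exp
  | Store exp exp
  | Read nat exp
  | Rand nat
  | Report exp exp
  | Seq com com
  | If exp com com
  | While exp com

text \<open>\<open>used\<close> is the least \<open>m\<close> such that all memory addresses accessed so far are below \<open>m\<close>.\<close>

record state =
  regs :: "nat \<Rightarrow> nat"
  mem :: "nat \<Rightarrow> nat"
  used :: nat
  out :: "(nat \<times> nat) list"

text \<open>All arithmetic is on words of \<open>w\<close> bits, that is, modulo \<open>2 ^ w\<close>.\<close>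

fun binop_val :: "nat \<Rightarrow> binop \<Rightarrow> nat \<Rightarrow> nat \<Rightarrow> nat" where
  "binop_val w Add a b = (a + b) mod 2 ^ w"
| "binop_val w Sub a b = (a + 2 ^ w - b) mod 2 ^ w"
| "binop_val w Mul a b = (a * b) mod 2 ^ w"
| "binop_val w Div a b = a div b"
| "binop_val w Mod a b = a mod b"
| "binop_val w And a b = Bit_Operations.and a b"
| "binop_val w Or a b = Bit_Operations.or a b"
| "binop_val w Xor a b = Bit_Operations.xor a b"
| "binop_val w Shl a b = push_bit b a mod 2 ^ w"
| "binop_val w Shr a b = drop_bit b a"
| "binop_val w Lt a b = of_bool (a < b) mod 2 ^ w"
| "binop_val w Eq a b = of_bool (a = b) mod 2 ^ w"

primrec exp_val :: "nat \<Rightarrow> (nat \<Rightarrow> nat) \<Rightarrow> exp \<Rightarrow> nat" where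
  "exp_val w \<rho> (Lit k) = k mod 2 ^ w"
| "exp_val w \<rho> (Reg r) = \<rho> r"
| "exp_val w \<rho> (Bin f e1 e2) = binop_val w f (exp_val w \<rho> e1) (exp_val w \<rho> e2)"

text \<open>One unit of time. Expressions range over registers only and are part of the program text,
  so a unit of time comprises a number of word operations bounded by a constant of the program.
  Reading the input outside positions \<open>1, \<dots>, length T\<close> yields \<open>0\<close>.\<close>

primrec step :: "nat \<Rightarrow> nat list \<Rightarrow> com \<Rightarrow> state \<Rightarrow> (com \<times> state) pmf" where
  "step w T Skip s = return_pmf (Skip, s)"
| "step w T (Assign r e) s =
     return_pmf (Skip, s\<lparr>regs := (regs s)(r := exp_val w (regs s) e)\<rparr>)"
| "step w T (Load r e) s =
     (let a = exp_val w (regs s) e in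
      return_pmf (Skip, s\<lparr>regs := (regs s)(r := mem s a), used := max (used s) (Suc a)\<rparr>))"
| "step w T (Store e1 e2) s =
     (let a = exp_val w (regs s) e1 in
      return_pmf (Skip, s\<lparr>mem := (mem s)(a := exp_val w (regs s) e2),
                          used := max (used s) (Suc a)\<rparr>))"
| "step w T (Read r e) s =
     (let i = exp_val w (regs s) e in
      return_pmf (Skip, s\<lparr>regs := (regs s)
        (r := (if 1 \<le> i \<and> i \<le> length T then T ! (i - 1) else 0))\<rparr>))"
| "step w T (Rand r) s =
     map_pmf (\<lambda>x. (Skip, s\<lparr>regs := (regs s)(r := x)\<rparr>)) (pmf_of_set {..<2 ^ w})"
| "step w T (Report e1 e2) s =
     return_pmf (Skip, s\<lparr>out := out s @ [(exp_val w (regs s) e1, exp_val w (regs s) e2)]\<rparr>)"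
| "step w T (Seq c1 c2) s =
     (if c1 = Skip then return_pmf (c2, s)
      else map_pmf (\<lambda>(c1', s'). (Seq c1' c2, s')) (step w T c1 s))"
| "step w T (If e c1 c2) s = return_pmf (if exp_val w (regs s) e \<noteq> 0 then c1 else c2, s)"
| "step w T (While e c) s =
     return_pmf (if exp_val w (regs s) e \<noteq> 0 then Seq c (While e c) else Skip, s)"

text \<open>Initially register 0 holds the length of the input, register 1 holds the parameter, and
  everything else is 0.\<close>

definition init_state :: "nat list \<Rightarrow> nat \<Rightarrow> state" where
  "init_state T \<tau> =
     \<lparr>regs = (\<lambda>_. 0)(0 := length T, 1 := \<tau>), mem = (\<lambda>_. 0), used = 0, out = []\<rparr>"

primrec run :: "com \<Rightarrow> nat \<Rightarrow> nat list \<Rightarrow> nat \<Rightarrow> nat \<Rightarrow> (com \<times> state) pmf" where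
  "run P w T \<tau> 0 = return_pmf (P, init_state T \<tau>)"
| "run P w T \<tau> (Suc t) = bind_pmf (run P w T \<tau> t) (\<lambda>(c, s). step w T c s)"

primrec exp_regs :: "exp \<Rightarrow> nat set" where
  "exp_regs (Lit k) = {}"
| "exp_regs (Reg r) = {r}"
| "exp_regs (Bin f e1 e2) = exp_regs e1 \<union> exp_regs e2"

primrec com_regs :: "com \<Rightarrow> nat set" where
  "com_regs Skip = {}"
| "com_regs (Assign r e) = insert r (exp_regs e)"
| "com_regs (Load r e) = insert r (exp_regs e)"
| "com_regs (Store e1 e2) = exp_regs e1 \<union> exp_regs e2"
| "com_regs (Read r e) = insert r (exp_regs e)"
| "com_regs (Rand r) = {r}"
| "com_regs (Report e1 e2) = exp_regs e1 \<union> exp_regs e2"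
| "com_regs (Seq c1 c2) = com_regs c1 \<union> com_regs c2"
| "com_regs (If e c1 c2) = exp_regs e \<union> com_regs c1 \<union> com_regs c2"
| "com_regs (While e c) = exp_regs e \<union> com_regs c"

primrec deterministic :: "com \<Rightarrow> bool" where
  "deterministic Skip \<longleftrightarrow> True"
| "deterministic (Assign r e) \<longleftrightarrow> True"
| "deterministic (Load r e) \<longleftrightarrow> True"
| "deterministic (Store e1 e2) \<longleftrightarrow> True"
| "deterministic (Read r e) \<longleftrightarrow> True"
| "deterministic (Rand r) \<longleftrightarrow> False"
| "deterministic (Report e1 e2) \<longleftrightarrow> True"
| "deterministic (Seq c1 c2) \<longleftrightarrow> deterministic c1 \<and> deterministic c2"
| "deterministic (If e c1 c2) \<longleftrightarrow> deterministic c1 \<and> deterministic c2"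
| "deterministic (While e c) \<longleftrightarrow> deterministic c"

definition halt_prob :: "com \<Rightarrow> nat \<Rightarrow> nat list \<Rightarrow> nat \<Rightarrow> real \<Rightarrow> real" where
  "halt_prob P w T \<tau> b = measure_pmf.prob (run P w T \<tau> (nat \<lfloor>b\<rfloor>)) {(c, s). c = Skip}"

text \<open>Las Vegas: the output is correct in every halting run, and the program halts almost surely.\<close>

definition solves_palindromes :: "com \<Rightarrow> nat \<Rightarrow> nat list \<Rightarrow> nat \<Rightarrow> bool" where
  "solves_palindromes P w T \<tau> \<longleftrightarrow>
     (\<forall>t. \<forall>(c, s) \<in> set_pmf (run P w T \<tau> t).
        c = Skip \<longrightarrow> set (out s) = maximal_palindromes T) \<and>
     (\<lambda>t. halt_prob P w T \<tau> (real t)) \<longlonglongrightarrow> 1"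

text \<open>Space in words: the registers of the program and the memory up to the largest address
  accessed. Input and output are not counted.\<close>

definition space_within :: "com \<Rightarrow> nat \<Rightarrow> nat list \<Rightarrow> nat \<Rightarrow> real \<Rightarrow> bool" where
  "space_within P w T \<tau> b \<longleftrightarrow>
     (\<forall>t. \<forall>(c, s) \<in> set_pmf (run P w T \<tau> t). real (card (com_regs P) + used s) \<le> b)"

text \<open>Machine words have \<open>\<Omega>(log n)\<close> bits, where \<open>K\<close> is the implied constant, and they can hold the
  input length and every input character.\<close>

definition valid_instance :: "nat \<Rightarrow> nat \<Rightarrow> nat list \<Rightarrow> nat \<Rightarrow> bool" where
  "valid_instance K w T \<tau> \<longleftrightarrow>
     1 \<le> \<tau> \<and> \<tau> \<le> length T \<and>
     real K * log 2 (real (length T) + 1) \<le> real w \<and>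
     length T < 2 ^ w \<and> (\<forall>x \<in> set T. x < 2 ^ w)"

end

theory Submission
  imports Defs
begin

text \<open>Both parts are achieved by deterministic programs. Scanning the text from left to right, keep
  the set of start positions of the palindromic suffixes of the current prefix. Its sequence of gaps
  is monotone, and whenever the gap changes the length of the palindrome at least halves within two
  elements, so the set is a union of \<open>O(log n)\<close> arithmetic progressions. By periodicity, all members
  of a progression are preceded by the same letter; hence a progression either extends to the next
  prefix as a whole, or all its members are maximal palindromes and are reported. This takes
  \<open>O(n log n)\<close> time and \<open>O(log n)\<close> space, which is within the bounds of part (i). The space is
  also within those of part (ii) if \<open>\<tau> log n \<le> n\<close>; otherwise expanding all centres naively takes
  constant space and \<open>O(n\<^sup>2)\<close> time, which is \<open>O(n \<tau> log n)\<close>.\<close>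

subsection \<open>Palindromic suffixes as arithmetic progressions\<close>

text \<open>A group can be accepted or rejected as a whole only if the period also covers the letter
  in front of its first member. The gap \<open>d\<close> is therefore measured from the predecessor:
  a position opens a new group as soon as its distance to the previous one differs from the gap
  before. The price is that the first member of an accepted group may get another gap, since
  positions in front of it may have been dropped; it is re-encoded on its own, and the rest in one
  piece. Reporting is paid for per stored position, not per group: each round adds two positions,
  and a reported one is gone. The factor \<open>log n\<close> is thus only the number of groups. In
  part (i) the bounds have room to spare: \<tau> \<le> n gives n / sqrt \<tau> \<ge> sqrt n, which
  dominates log n. In part (ii) the choice between the two programs is made at run time, with the
  bit length of \<open>n\<close> in the place of the logarithm.\<close>

definition pal :: "(nat \<Rightarrow> 'a) \<Rightarrow> nat \<Rightarrow> nat \<Rightarrow> bool" where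
  "pal f i j \<longleftrightarrow> (\<forall>q. i \<le> q \<and> q \<le> j \<longrightarrow> f q = f (i + j - q))"

text \<open>The range ends at \<open>j + 1\<close>, the start of the empty suffix: palindromes of
  even length grow out of it.\<close>

definition pals :: "(nat \<Rightarrow> 'a) \<Rightarrow> nat \<Rightarrow> nat list" where
  "pals f j = filter (\<lambda>i. pal f i j) [1..<j + 2]"

lemma palD: "pal f i j \<Longrightarrow> i \<le> q \<Longrightarrow> q \<le> j \<Longrightarrow> i + j - q = r \<Longrightarrow> f q = f r"
  unfolding pal_def by blast

text \<open>The composition of two reflections is a translation: mirroring in the suffix at
  \<open>x\<close> and then in the one at \<open>x + d\<close> shifts by \<open>d\<close>.\<close>

lemma pal_period:
  assumes "pal f x j" "pal f (x + d) j" "x \<le> q" "q + d \<le> j"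
  shows "f (q + d) = f q"
proof -
  have "f q = f (x + j - q)" using assms by (intro palD[OF assms(1)]) auto
  also have "\<dots> = f (q + d)" using assms by (intro palD[OF assms(2)]) auto
  finally show ?thesis by simp
qed

lemma pal_period_mult:
  assumes "pal f x j" "pal f (x + d) j" "x \<le> q" "q + m * d \<le> j"
  shows "f (q + m * d) = f q"
  using assms(4)
proof (induction m)
  case (Suc m)
  have "f (q + m * d + d) = f (q + m * d)"
    using Suc.prems assms by (intro pal_period[of f x j]) auto
  with Suc show ?case by (simp add: algebra_simps)
qed simp

text \<open>The period \<open>u\<close> carries the reflection of the suffix at \<open>x + u\<close>
  one gap further. Consequently, gaps between consecutive starts never grow.\<close>

lemma pal_next:
  assumes "pal f x j" "pal f (x + u) j"
  shows "pal f (x + u + u) j"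
  unfolding pal_def
proof (intro allI impI)
  fix q assume q: "x + u + u \<le> q \<and> q \<le> j"
  have "f (q - u + u) = f (q - u)" using q assms by (intro pal_period[of f x j]) auto
  moreover have "f (q - u) = f (x + u + u + j - q)"
    using q by (intro palD[OF assms(2)]) auto
  ultimately show "f q = f (x + u + u + j - q)" using q by simp
qed

text \<open>On the right part, from \<open>x + u + v\<close> on, the reflection is that of the third
  suffix followed by a shift by the period \<open>u\<close>. Any other position has its mirror image
  in that right part, because by the last hypothesis the third suffix has length at least
  \<open>u\<close>.\<close>

lemma pal_between:
  assumes "pal f x j" "pal f (x + u) j" "pal f (x + u + v) j" "x + u + v + u \<le> Suc j"
  shows "pal f (x + v) j"
proof -
  have A: "f q = f (x + v + j - q)" if q: "x + u + v \<le> q" "q \<le> j" for q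
  proof -
    have "f q = f (x + u + v + j - q)" using q by (intro palD[OF assms(3)]) auto
    also have "x + u + v + j - q = x + v + j - q + u" using q by simp
    also have "f \<dots> = f (x + v + j - q)" using q assms by (intro pal_period[of f x j]) auto
    finally show ?thesis .
  qed
  show ?thesis unfolding pal_def
  proof (intro allI impI)
    fix q assume q: "x + v \<le> q \<and> q \<le> j"
    show "f q = f (x + v + j - q)"
    proof (cases "x + u + v \<le> q")
      case True then show ?thesis using A q by blast
    next
      case False
      then have "f (x + v + j - q) = f (x + v + j - (x + v + j - q))"
        using q assms(4) by (intro A) auto
      then show ?thesis using q by simp
    qed
  qed
qed

text \<open>Let \<open>u\<close> and \<open>v\<close> be the two gaps. By \<open>pal_next\<close>,
  \<open>u < v\<close> would put a start strictly between \<open>y\<close> and \<open>z\<close>. If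
  \<open>v < u\<close>, then \<open>pal_between\<close> would put one strictly between
  \<open>x\<close> and \<open>y\<close>, unless the suffix at \<open>z\<close> is shorter than
  \<open>u\<close>. The quantity \<open>j + 2 - z\<close> is its length plus one, which is positive
  even for the empty suffix.\<close>

lemma pal_gap_growth:
  assumes "pal f x j" "pal f y j" "pal f z j" "x < y" "y < z" "z \<le> Suc j"
    and no1: "\<And>q. x < q \<Longrightarrow> q < y \<Longrightarrow> \<not> pal f q j"
    and no2: "\<And>q. y < q \<Longrightarrow> q < z \<Longrightarrow> \<not> pal f q j"
    and ne: "y - x \<noteq> z - y"
  shows "2 * (j + 2 - z) \<le> j + 2 - x"
proof -
  define u v where "u = y - x" and "v = z - y"
  have yz: "y = x + u" "z = x + u + v" "u > 0" "v > 0" using assms by (auto simp: u_def v_def)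
  have "v < u"
  proof (rule ccontr)
    assume "\<not> v < u"
    then have "u < v" using ne u_def v_def by simp
    moreover have "pal f (x + u + u) j" using assms yz by (intro pal_next) auto
    ultimately show False using no2[of "x + u + u"] yz by simp
  qed
  have "\<not> x + u + v + u \<le> Suc j"
  proof
    assume "x + u + v + u \<le> Suc j"
    then have "pal f (x + v) j" using assms yz by (intro pal_between[of f x j u v]) auto
    then show False using no1[of "x + v"] \<open>v < u\<close> yz by simp
  qed
  then show ?thesis using yz assms(6) by simp
qed

lemma set_pals: "set (pals f j) = {i. 1 \<le> i \<and> i \<le> Suc j \<and> pal f i j}"
  unfolding pals_def set_filter set_upt by auto

lemma sorted_pals: "sorted_wrt (<) (pals f j)"
  unfolding pals_def by (rule sorted_wrt_filter[OF sorted_wrt_upt])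

lemma pal_extend:
  assumes "2 \<le> i" "i \<le> Suc j"
  shows "pal f (i - 1) (Suc j) \<longleftrightarrow> f (i - 1) = f (Suc j) \<and> pal f i j"
proof
  assume L: "pal f (i - 1) (Suc j)"
  have "f (i - 1) = f (Suc j)" using assms by (intro palD[OF L]) auto
  moreover have "pal f i j"
    unfolding pal_def using assms by (auto intro!: palD[OF L])
  ultimately show "f (i - 1) = f (Suc j) \<and> pal f i j" by blast
next
  assume R: "f (i - 1) = f (Suc j) \<and> pal f i j"
  show "pal f (i - 1) (Suc j)" unfolding pal_def
  proof (intro allI impI)
    fix q assume q: "i - 1 \<le> q \<and> q \<le> Suc j"
    consider "q = i - 1" | "q = Suc j" | "i \<le> q" "q \<le> j" using q by linarith
    then show "f q = f (i - 1 + Suc j - q)"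
    proof cases
      case 3
      have "f q = f (i + j - q)" using R 3 palD by blast
      then show ?thesis using assms by simp
    qed (use R assms in auto)
  qed
qed

text \<open>The hypothesis makes position \<open>0\<close> a sentinel, so that a palindrome starting
  at \<open>1\<close> never survives. The two new members are the one-letter and the empty suffix,
  the seeds of the odd and the even palindromes.\<close>

lemma pals_Suc:
  assumes "\<And>q. 1 \<le> q \<Longrightarrow> f q \<noteq> f 0"
  shows "pals f (Suc j) =
    map (\<lambda>i. i - 1) (filter (\<lambda>i. f (i - 1) = f (Suc j)) (pals f j)) @ [Suc j, Suc (Suc j)]"
proof -
  have up: "[1..<Suc j + 2] = [1..<Suc j] @ [Suc j, Suc (Suc j)]"
    using upt_Suc[of 1 "Suc (Suc j)"] upt_Suc[of 1 "Suc j"] by simp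
  have sh: "[1..<Suc j] = map (\<lambda>i. i - 1) [2..<j + 2]"
    by (rule nth_equalityI) (auto simp del: upt_Suc)
  have one: "[1..<j + 2] = 1 # [2..<j + 2]"
    by (subst upt_conv_Cons) (auto simp: numeral_2_eq_2)
  have "filter (\<lambda>i. pal f i (Suc j)) [1..<Suc j] =
      map (\<lambda>i. i - 1) (filter (\<lambda>i. pal f (i - 1) (Suc j)) [2..<j + 2])"
    unfolding sh filter_map by (simp add: comp_def)
  also have "filter (\<lambda>i. pal f (i - 1) (Suc j)) [2..<j + 2] =
      filter (\<lambda>i. f (i - 1) = f (Suc j) \<and> pal f i j) [2..<j + 2]"
    by (intro filter_cong refl pal_extend) (auto simp del: upt_Suc)
  also have "\<dots> = filter (\<lambda>i. f (i - 1) = f (Suc j)) (pals f j)"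
    unfolding pals_def one using assms[of "Suc j"] by (simp add: conj_commute del: upt_Suc)
  finally have *: "filter (\<lambda>i. pal f i (Suc j)) [1..<Suc j] =
     map (\<lambda>i. i - 1) (filter (\<lambda>i. f (i - 1) = f (Suc j)) (pals f j))" .
  have "pal f (Suc j) (Suc j)" "pal f (Suc (Suc j)) (Suc j)" by (auto simp: pal_def)
  then show ?thesis unfolding pals_def up using * by (simp add: pals_def)
qed

lemma pals_0: "pals f 0 = [1]"
  by (simp add: pals_def pal_def)

section \<open>Run-length encoding of the gap sequence\<close>

text \<open>The group \<open>(i, d, k)\<close> stands for the positions \<open>i, i + d, \<dots>, i + (k - 1) d\<close>, where \<open>d\<close> is
  also the distance of \<open>i\<close> to its predecessor in the list.\<close>

type_synonym group = "nat \<times> nat \<times> nat"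

definition expand :: "group \<Rightarrow> nat list" where
  "expand g = (case g of (i, d, k) \<Rightarrow> map (\<lambda>m. i + m * d) [0..<k])"

definition lst :: "nat list \<Rightarrow> nat" where
  "lst xs = (if xs = [] then 0 else last xs)"

text \<open>The first element has gap \<open>0\<close>, so that it never shares a group with its successor. Positions
  are positive, hence \<open>0\<close> stands for a missing predecessor.\<close>

definition gap :: "nat \<Rightarrow> nat \<Rightarrow> nat" where
  "gap p x = (if p = 0 then 0 else x - p)"

definition emit :: "group list \<Rightarrow> nat \<Rightarrow> nat \<Rightarrow> nat \<Rightarrow> group list" where
  "emit gs a g c = (if gs \<noteq> [] \<and> fst (snd (last gs)) = g
     then butlast gs @ [(fst (last gs), g, snd (snd (last gs)) + c)] else gs @ [(a, g, c)])"

text \<open>The recursion is on the reversed list, so that adding a position at the right end, as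
  the scan does, is one unfolding.\<close>

primrec enc_rev :: "nat list \<Rightarrow> group list" where
  "enc_rev [] = []"
| "enc_rev (x # xs) = emit (enc_rev xs) x (gap (lst (rev xs)) x) 1"

definition enc :: "nat list \<Rightarrow> group list" where
  "enc xs = enc_rev (rev xs)"

lemma enc_Nil [simp]: "enc [] = []" by (simp add: enc_def)

lemma enc_snoc: "enc (xs @ [x]) = emit (enc xs) x (gap (lst xs) x) 1"
  by (simp add: enc_def)

lemma emit_not_Nil [simp]: "emit gs a g c \<noteq> []" by (simp add: emit_def)

lemma enc_eq_Nil_iff [simp]: "enc xs = [] \<longleftrightarrow> xs = []"
  by (cases xs rule: rev_cases) (auto simp: enc_snoc)

lemma last_gap_emit [simp]: "fst (snd (last (emit gs a g c))) = g"
  by (simp add: emit_def)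

lemma last_gap_enc_snoc: "fst (snd (last (enc (xs @ [x])))) = gap (lst xs) x"
  by (simp add: enc_snoc)

lemma emit_emit: "emit (emit gs a g c) b g c' = emit gs a g (c + c')"
  by (auto simp: emit_def)

lemma lst_snoc [simp]: "lst (xs @ [x]) = x" by (simp add: lst_def)

text \<open>Consecutive emissions with the same gap merge by \<open>emit_emit\<close>. This is what
  allows all members of a surviving group but the first to be written in constant time.\<close>

lemma enc_append_progression:
  assumes "xs \<noteq> []" "g > 0" "lst xs > 0" "c > 0"
  shows "enc (xs @ map (\<lambda>m. lst xs + g + m * g) [0..<c]) = emit (enc xs) (lst xs + g) g c"
  using assms(4)
proof (induction c rule: nat_induct_non_zero)
  case 1
  then show ?case using assms by (simp add: enc_snoc gap_def)
next
  case (Suc c)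
  let ?ys = "xs @ map (\<lambda>m. lst xs + g + m * g) [0..<c]"
  have l: "lst ?ys = lst xs + c * g" using Suc.hyps by (cases c) (auto simp: lst_def)
  have "enc (?ys @ [lst xs + g + c * g]) = emit (enc ?ys) (lst xs + g + c * g) g 1"
    using assms enc_snoc[of ?ys] by (simp add: l gap_def)
  then show ?case using Suc by (simp add: emit_emit)
qed

text \<open>The condition on \<open>i - d\<close> says that the progression also continues one step
  to the left of the group; \<open>group_extends_uniformly\<close> rests on it.\<close>

definition good :: "nat list \<Rightarrow> group list \<Rightarrow> bool" where
  "good xs gs \<longleftrightarrow> concat (map expand gs) = xs \<and>
     (\<forall>(i, d, k) \<in> set gs. 1 \<le> k \<and> (d = 0 \<longrightarrow> k = 1) \<and> (0 < d \<longrightarrow> d < i \<and> i - d \<in> set xs))"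

lemma good_enc:
  assumes "sorted_wrt (<) xs" "\<forall>x \<in> set xs. 0 < x"
  shows "good xs (enc xs)"
  using assms
proof (induction xs rule: rev_induct)
  case Nil
  then show ?case by (simp add: good_def)
next
  case (snoc x xs)
  have IH: "good xs (enc xs)" using snoc by (simp add: sorted_wrt_append)
  show ?case
  proof (cases "xs = []")
    case True
    then show ?thesis
      using enc_snoc[of "[]" x] by (simp add: good_def emit_def lst_def gap_def expand_def)
  next
    case False
    define gs where "gs = enc xs"
    have ne: "gs \<noteq> []" using False gs_def by simp
    then obtain hs i d k where gs: "gs = hs @ [(i, d, k)]"
      by (cases gs rule: rev_cases) auto
    have pr: "0 < lst xs" "lst xs < x" "lst xs \<in> set xs"
      using False snoc.prems by (auto simp: lst_def sorted_wrt_append)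
    have g: "gap (lst xs) x = x - lst xs" "0 < x - lst xs" using pr by (auto simp: gap_def)
    have k: "1 \<le> k" using IH gs gs_def unfolding good_def by auto
    have cc: "concat (map expand hs) @ expand (i, d, k) = xs"
      using IH gs gs_def unfolding good_def by simp
    have lx: "lst xs = i + (k - 1) * d"
    proof -
      obtain k' where k': "k = Suc k'" using k by (cases k) auto
      show ?thesis unfolding lst_def using False cc[symmetric]
        by (simp add: expand_def k')
    qed
    show ?thesis
    proof (cases "d = x - lst xs")
      case True
      have "enc (xs @ [x]) = hs @ [(i, d, k + 1)]"
        using gs gs_def True g by (simp add: enc_snoc emit_def)
      moreover have "i + k * d = x"
      proof -
        have "i + k * d = i + (k - 1) * d + d" using k by (cases k) simp_all
        then show ?thesis using lx True pr by linarith
      qed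
      then have "expand (i, d, k + 1) = expand (i, d, k) @ [x]" by (simp add: expand_def)
      moreover have "0 < d" using True g by simp
      ultimately show ?thesis
        using IH cc unfolding good_def gs_def[symmetric] gs by auto
    next
      case False
      then have "enc (xs @ [x]) = gs @ [(x, x - lst xs, 1)]"
        using gs gs_def g by (simp add: enc_snoc emit_def)
      moreover have "expand (x, x - lst xs, 1) = [x]" by (simp add: expand_def)
      ultimately show ?thesis using IH pr unfolding good_def gs_def[symmetric] by auto
    qed
  qed
qed

section \<open>The number of groups is logarithmic\<close>

lemma length_emit_le: "length gs \<le> length (emit gs a g c)"
  by (simp add: emit_def)

lemma length_emit_le_Suc: "length (emit gs a g c) \<le> Suc (length gs)"
  by (simp add: emit_def)

text \<open>Since \<open>emit\<close> never drops a group, the memory for a partially written list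
  is bounded by that for the finished one.\<close>

lemma length_enc_mono: "length (enc xs) \<le> length (enc (xs @ ys))"
proof (induction ys rule: rev_induct)
  case (snoc y ys)
  have "enc (xs @ ys @ [y]) = enc ((xs @ ys) @ [y])" by simp
  also have "length \<dots> \<ge> length (enc (xs @ ys))" unfolding enc_snoc by (rule length_emit_le)
  finally show ?case using snoc by linarith
qed simp

lemma length_enc_le: "length (enc xs) \<le> length xs"
proof (induction xs rule: rev_induct)
  case (snoc x xs)
  then show ?case
    using length_emit_le_Suc[of "enc xs" x "gap (lst xs) x" 1] by (simp add: enc_snoc)
qed simp

text \<open>Whenever a new progression is opened, the gap has changed, so the length of the palindrome has
  more than halved within two elements: the left-hand side of the bound does not grow.\<close>

lemma enc_potential:
  assumes "pals f j = xs @ [y, z] @ ys"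
  shows "2 ^ length (enc (xs @ [y, z])) * ((j + 2 - y) * (j + 2 - z)) \<le> 4 * (j + 2) ^ 2"
  using assms
proof (induction xs arbitrary: y z ys rule: rev_induct)
  case Nil
  have "length (enc [y, z]) \<le> 2" using length_enc_le[of "[y, z]"] by simp
  then have "(2::nat) ^ length (enc [y, z]) \<le> 2 ^ 2" by (intro power_increasing) auto
  moreover have "(j + 2 - y) * (j + 2 - z) \<le> (j + 2) ^ 2"
    unfolding power2_eq_square by (intro mult_mono) auto
  ultimately show ?case using mult_mono[of "2 ^ length (enc [y, z])" 4 "(j + 2 - y) * (j + 2 - z)" "(j+2)^2"] by simp
next
  case (snoc x xs)
  have IH: "2 ^ length (enc (xs @ [x, y])) * ((j + 2 - x) * (j + 2 - y)) \<le> 4 * (j + 2) ^ 2"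
    using snoc.IH[of x y "z # ys"] snoc.prems by simp
  have so: "sorted_wrt (<) (xs @ [x, y, z] @ ys)" using sorted_pals[of f j] snoc.prems by simp
  then have lt: "x < y" "y < z" by (auto simp: sorted_wrt_append)
  have mem: "q \<in> set (xs @ [x, y, z] @ ys) \<longleftrightarrow> 1 \<le> q \<and> q \<le> Suc j \<and> pal f q j" for q
    using set_pals[of f j] snoc.prems by auto
  have in3: "pal f x j" "pal f y j" "pal f z j" "z \<le> Suc j" "1 \<le> x"
    using mem[of x] mem[of y] mem[of z] by auto
  have no: "\<not> pal f q j" if "x < q" "q < y \<or> y < q" "q < z" for q
  proof
    assume "pal f q j"
    then have "q \<in> set (xs @ [x, y, z] @ ys)" using mem[of q] that in3 by linarith
    then show False using that lt so by (auto simp: sorted_wrt_append)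
  qed
  have e: "enc ((xs @ [x]) @ [y, z]) = emit (enc (xs @ [x, y])) z (z - y) 1"
    using enc_snoc[of "xs @ [x, y]" z] lt in3 by (simp add: lst_def gap_def)
  have lg: "fst (snd (last (enc (xs @ [x, y])))) = y - x"
    using last_gap_enc_snoc[of "xs @ [x]" y] in3 by (simp add: gap_def)
  show ?case
  proof (cases "y - x = z - y")
    case True
    then have len: "length (enc ((xs @ [x]) @ [y, z])) = length (enc (xs @ [x, y]))"
      unfolding e using lg by (simp add: emit_def)
    have "(j + 2 - y) * (j + 2 - z) \<le> (j + 2 - x) * (j + 2 - y)"
      unfolding mult.commute[of "j + 2 - y"] using lt by (intro mult_mono) auto
    then show ?thesis unfolding len by (rule order.trans[OF mult_le_mono2 IH])
  next
    case False
    then have len: "length (enc ((xs @ [x]) @ [y, z])) = Suc (length (enc (xs @ [x, y])))"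
      unfolding e using lg by (simp add: emit_def)
    have "2 * (j + 2 - z) \<le> j + 2 - x"
      using in3 lt no False by (intro pal_gap_growth[of f x j y z]) auto
    \<comment> \<open>The factor \<open>j + 2 - y\<close> is common to the old and the new product,
      so that only \<open>z\<close> is compared with \<open>x\<close>, two elements earlier; the
      halving cancels the new factor \<open>2\<close>.\<close>
    then have "(2 * (j + 2 - z)) * (j + 2 - y) \<le> (j + 2 - x) * (j + 2 - y)" by (rule mult_le_mono1)
    then have "2 ^ length (enc (xs @ [x, y])) * ((2 * (j + 2 - z)) * (j + 2 - y)) \<le> 4 * (j + 2) ^ 2"
      by (rule order.trans[OF mult_le_mono2 IH])
    then show ?thesis unfolding len by (simp add: mult_ac)
  qed
qed

text \<open>The potential is taken at the last two starts. Both factors are at least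
  \<open>1\<close>, as every start is at most \<open>j + 1\<close>, so the power of two alone obeys
  the bound.\<close>

lemma length_enc_pals: "2 ^ length (enc (pals f j)) \<le> 4 * (j + 2) ^ 2"
proof (cases "length (pals f j) \<le> 2")
  case True
  then have "(2::nat) ^ length (enc (pals f j)) \<le> 2 ^ 2"
    using length_enc_le[of "pals f j"] by (intro power_increasing) auto
  also have "\<dots> \<le> 4 * (j + 2) ^ 2" by simp
  finally show ?thesis .
next
  case False
  then obtain xs y z where p: "pals f j = xs @ [y, z]"
    by (cases "pals f j" rule: rev_cases; cases "butlast (pals f j)" rule: rev_cases) (auto simp: not_le)
  have "y \<le> Suc j" "z \<le> Suc j" using set_pals[of f j] p by auto
  then have "1 \<le> (j + 2 - y) * (j + 2 - z)" by (simp add: Suc_le_eq)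
  then have "2 ^ length (enc (pals f j)) \<le> 2 ^ length (enc (xs @ [y, z])) * ((j + 2 - y) * (j + 2 - z))"
    unfolding p by simp
  also have "\<dots> \<le> 4 * (j + 2) ^ 2" using enc_potential[of f j xs y z "[]"] p by simp
  finally show ?thesis .
qed

text \<open>Both \<open>i - d\<close> and \<open>i\<close> start palindromic suffixes, so
  \<open>d\<close> is a period from \<open>i - d\<close> on. For \<open>d > 0\<close> this range
  contains \<open>i - 1\<close>, and the letters in front of the members are shifts of that one. For
  \<open>d = 0\<close> the group is a single position.\<close>

lemma group_extends_uniformly:
  assumes "(i, d, k) \<in> set (enc (pals f j))" "m < k"
  shows "f (i + m * d - 1) = f (i - 1)"
proof -
  have "good (pals f j) (enc (pals f j))"
    by (intro good_enc sorted_pals) (auto simp: set_pals)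
  then have g: "d = 0 \<longrightarrow> k = 1" "0 < d \<longrightarrow> d < i \<and> i - d \<in> set (pals f j)"
    and cc: "concat (map expand (enc (pals f j))) = pals f j"
    using assms(1) unfolding good_def by auto
  have sub: "set (expand (i, d, k)) \<subseteq> set (pals f j)"
    using arg_cong[OF cc, of set] assms(1) by auto
  show ?thesis
  proof (cases "d = 0")
    case False
    have "i + m * d \<in> set (expand (i, d, k))" "i + 0 * d \<in> set (expand (i, d, k))"
      using assms(2) unfolding expand_def by (auto simp del: mult_0)
    then have *: "i + m * d \<le> Suc j" "pal f i j" using sub by (auto simp: set_pals)
    have "f (i - 1 + m * d) = f (i - 1)"
      using g False * by (intro pal_period_mult[of f "i - d" j d]) (auto simp: set_pals)
    moreover have "i + m * d - 1 = i - 1 + m * d" using g False by linarith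
    ultimately show ?thesis by metis
  qed simp
qed

subsection \<open>Deterministic executions with running time\<close>

primrec det :: "nat \<Rightarrow> nat list \<Rightarrow> com \<Rightarrow> state \<Rightarrow> com \<times> state" where
  "det w T Skip s = (Skip, s)"
| "det w T (Assign r e) s = (Skip, s\<lparr>regs := (regs s)(r := exp_val w (regs s) e)\<rparr>)"
| "det w T (Load r e) s =
     (let a = exp_val w (regs s) e in
      (Skip, s\<lparr>regs := (regs s)(r := mem s a), used := max (used s) (Suc a)\<rparr>))"
| "det w T (Store e1 e2) s =
     (let a = exp_val w (regs s) e1 in
      (Skip, s\<lparr>mem := (mem s)(a := exp_val w (regs s) e2), used := max (used s) (Suc a)\<rparr>))"
| "det w T (Read r e) s =
     (let i = exp_val w (regs s) e in
      (Skip, s\<lparr>regs := (regs s)(r := (if 1 \<le> i \<and> i \<le> length T then T ! (i - 1) else 0))\<rparr>))"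
| "det w T (Rand r) s = (Skip, s)"
| "det w T (Report e1 e2) s =
     (Skip, s\<lparr>out := out s @ [(exp_val w (regs s) e1, exp_val w (regs s) e2)]\<rparr>)"
| "det w T (Seq c1 c2) s =
     (if c1 = Skip then (c2, s) else (\<lambda>(c1', s'). (Seq c1' c2, s')) (det w T c1 s))"
| "det w T (If e c1 c2) s = (if exp_val w (regs s) e \<noteq> 0 then c1 else c2, s)"
| "det w T (While e c) s = (if exp_val w (regs s) e \<noteq> 0 then Seq c (While e c) else Skip, s)"

abbreviation iter_det :: "nat \<Rightarrow> nat list \<Rightarrow> nat \<Rightarrow> com \<times> state \<Rightarrow> com \<times> state" where
  "iter_det w T t \<equiv> (\<lambda>(c, s). det w T c s) ^^ t"

lemma step_det: "deterministic c \<Longrightarrow> step w T c s = return_pmf (det w T c s)"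
  by (induction c arbitrary: s) (auto simp: Let_def)

lemma deterministic_det: "deterministic c \<Longrightarrow> deterministic (fst (det w T c s))"
  by (induction c arbitrary: s) (auto simp: Let_def case_prod_unfold)

lemma used_det: "used s \<le> used (snd (det w T c s))"
  by (induction c arbitrary: s) (auto simp: Let_def case_prod_unfold)

lemma run_det:
  assumes "deterministic P"
  shows "run P w T \<tau> t = return_pmf (iter_det w T t (P, init_state T \<tau>)) \<and>
    deterministic (fst (iter_det w T t (P, init_state T \<tau>)))"
proof (induction t)
  case (Suc t)
  then show ?case
    by (simp add: bind_return_pmf step_det deterministic_det case_prod_unfold)
qed (use assms in simp)

lemma iter_det_Skip: "iter_det w T t (Skip, s) = (Skip, s)"
  by (induction t) auto

lemma used_iter_det: "used (snd x) \<le> used (snd (iter_det w T t x))"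
proof (induction t)
  case (Suc t)
  then show ?case
    using used_det order.trans by (fastforce simp: case_prod_unfold)
qed simp

text \<open>The guard \<open>c \<noteq> Skip\<close> keeps the idle steps of a halted program out of
  the count.\<close>

inductive steps :: "nat \<Rightarrow> nat list \<Rightarrow> com \<Rightarrow> state \<Rightarrow> nat \<Rightarrow> com \<Rightarrow> state \<Rightarrow> bool"
  for w T where
  steps_refl: "steps w T c s 0 c s"
| steps_Suc: "c \<noteq> Skip \<Longrightarrow> det w T c s = (c1, s1) \<Longrightarrow> steps w T c1 s1 k c' s' \<Longrightarrow> steps w T c s (Suc k) c' s'"

lemma steps_iter: "steps w T c s k c' s' \<Longrightarrow> iter_det w T k (c, s) = (c', s')"
  by (induction rule: steps.induct) (auto simp: funpow_Suc_right simp del: funpow.simps)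

lemma steps_trans:
  "steps w T c s k c1 s1 \<Longrightarrow> steps w T c1 s1 k' c' s' \<Longrightarrow> steps w T c s (k + k') c' s'"
  by (induction rule: steps.induct) (auto intro: steps.intros)

lemma steps_Seq: "steps w T c s k c' s' \<Longrightarrow> steps w T (Seq c d) s k (Seq c' d) s'"
  by (induction rule: steps.induct) (auto intro: steps.intros)

text \<open>Total correctness in weakest-precondition form. The postcondition also receives the
  exact number of steps, so the rules account for costs by shifting the first argument of
  \<open>Q\<close>.\<close>

definition trm :: "nat \<Rightarrow> nat list \<Rightarrow> com \<Rightarrow> state \<Rightarrow> (nat \<Rightarrow> state \<Rightarrow> bool) \<Rightarrow> bool" where
  "trm w T c s Q \<longleftrightarrow> (\<exists>k s'. steps w T c s k Skip s' \<and> Q k s')"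

lemma trm_mono: "trm w T c s Q \<Longrightarrow> (\<And>k s'. Q k s' \<Longrightarrow> Q' k s') \<Longrightarrow> trm w T c s Q'"
  unfolding trm_def by blast

lemma trm_step:
  "c \<noteq> Skip \<Longrightarrow> det w T c s = (c1, s1) \<Longrightarrow> trm w T c1 s1 (\<lambda>k. Q (Suc k)) \<Longrightarrow> trm w T c s Q"
  unfolding trm_def by (blast intro: steps_Suc)

lemma trm_Skip: "Q 0 s \<Longrightarrow> trm w T Skip s Q"
  unfolding trm_def by (blast intro: steps_refl)

lemma trm_Assign:
  "Q 1 (s\<lparr>regs := (regs s)(r := exp_val w (regs s) e)\<rparr>) \<Longrightarrow> trm w T (Assign r e) s Q"
  by (rule trm_step) (auto intro: trm_Skip)

lemma trm_Load:
  "exp_val w (regs s) e = a \<Longrightarrow>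
   Q 1 (s\<lparr>regs := (regs s)(r := mem s a), used := max (used s) (Suc a)\<rparr>) \<Longrightarrow> trm w T (Load r e) s Q"
  by (rule trm_step) (auto simp: Let_def intro: trm_Skip)

lemma trm_Store:
  "exp_val w (regs s) e1 = a \<Longrightarrow>
   Q 1 (s\<lparr>mem := (mem s)(a := exp_val w (regs s) e2), used := max (used s) (Suc a)\<rparr>) \<Longrightarrow>
   trm w T (Store e1 e2) s Q"
  by (rule trm_step) (auto simp: Let_def intro: trm_Skip)

lemma trm_Read:
  "exp_val w (regs s) e = i \<Longrightarrow>
   Q 1 (s\<lparr>regs := (regs s)(r := (if 1 \<le> i \<and> i \<le> length T then T ! (i - 1) else 0))\<rparr>) \<Longrightarrow>
   trm w T (Read r e) s Q"
  by (rule trm_step) (auto simp: Let_def intro: trm_Skip)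

lemma trm_Report:
  "Q 1 (s\<lparr>out := out s @ [(exp_val w (regs s) e1, exp_val w (regs s) e2)]\<rparr>) \<Longrightarrow>
   trm w T (Report e1 e2) s Q"
  by (rule trm_step) (auto intro: trm_Skip)

text \<open>The additional \<open>Suc\<close> is the step that discards the finished first
  component.\<close>

lemma trm_Seq:
  assumes "trm w T c1 s (\<lambda>k1 s1. trm w T c2 s1 (\<lambda>k2. Q (Suc (k1 + k2))))"
  shows "trm w T (Seq c1 c2) s Q"
proof -
  obtain k1 s1 k2 s2 where a: "steps w T c1 s k1 Skip s1" "steps w T c2 s1 k2 Skip s2"
    "Q (Suc (k1 + k2)) s2"
    using assms unfolding trm_def by blast
  have "steps w T (Seq c1 c2) s (k1 + Suc k2) Skip s2"
    using a by (intro steps_trans[OF steps_Seq[OF a(1)]] steps_Suc) auto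
  then show ?thesis unfolding trm_def using a(3) by auto
qed

lemma trm_If:
  assumes "exp_val w (regs s) e \<noteq> 0 \<Longrightarrow> trm w T c1 s (\<lambda>k. Q (Suc k))"
    and "exp_val w (regs s) e = 0 \<Longrightarrow> trm w T c2 s (\<lambda>k. Q (Suc k))"
  shows "trm w T (If e c1 c2) s Q"
  by (rule trm_step) (use assms in auto)

text \<open>The time spent so far is an argument of the invariant, which permits amortized bounds.
  Each iteration costs two steps in addition to the body.\<close>

lemma trm_While:
  fixes \<mu> :: "state \<Rightarrow> nat"
  assumes "I k0 s0"
    and "\<And>k s. I k s \<Longrightarrow> exp_val w (regs s) e \<noteq> 0 \<Longrightarrow>
      trm w T c s (\<lambda>k' s'. I (k + k' + 2) s' \<and> \<mu> s' < \<mu> s)"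
    and "\<And>k s. I (k0 + k) s \<Longrightarrow> exp_val w (regs s) e = 0 \<Longrightarrow> Q (Suc k) s"
  shows "trm w T (While e c) s0 Q"
proof -
  have "trm w T (While e c) s (\<lambda>k'. Q (k + k'))" if "I (k0 + k) s" for k s
    using that
  proof (induction "\<mu> s" arbitrary: k s rule: less_induct)
    case less
    show ?case
    proof (cases "exp_val w (regs s) e = 0")
      case True
      show ?thesis
      proof (rule trm_step)
        show "det w T (While e c) s = (Skip, s)" using True by simp
        show "trm w T Skip s (\<lambda>k'. Q (k + Suc k'))"
          by (rule trm_Skip) (use assms(3)[OF less.prems True] in simp)
      qed simp
    next
      case False
      show ?thesis
      proof (rule trm_step)
        show "det w T (While e c) s = (Seq c (While e c), s)" using False by simp
        show "trm w T (Seq c (While e c)) s (\<lambda>k'. Q (k + Suc k'))"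
        proof (rule trm_Seq, rule trm_mono[OF assms(2)[OF less.prems False]])
          fix k' s' assume *: "I (k0 + k + k' + 2) s' \<and> \<mu> s' < \<mu> s"
          then have "trm w T (While e c) s' (\<lambda>k''. Q ((k + k' + 2) + k''))"
            by (intro less.hyps) (auto simp: add.assoc)
          then show "trm w T (While e c) s' (\<lambda>k2. Q (k + Suc (Suc (k' + k2))))"
            by (simp add: add_ac)
        qed
      qed simp
    qed
  qed
  from this[of 0 s0] show ?thesis using assms(1) by simp
qed

text \<open>For a deterministic program every \<open>run\<close> is a point mass, and a halted
  configuration is a fixed point. One halting execution therefore determines all later
  distributions, and the output of every halted configuration is the final one.\<close>

lemma trm_solves:
  assumes P: "deterministic P"
    and t: "trm w T P (init_state T \<tau>)
      (\<lambda>k s. set (out s) = maximal_palindromes T \<and> used s \<le> U \<and> k \<le> N)"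
  shows "solves_palindromes P w T \<tau>"
    and "real (card (com_regs P) + U) \<le> b \<Longrightarrow> space_within P w T \<tau> b"
    and "real N \<le> b \<Longrightarrow> halt_prob P w T \<tau> b = 1"
proof -
  let ?x = "(P, init_state T \<tau>)"
  obtain k s where st: "steps w T P (init_state T \<tau>) k Skip s"
    and s: "set (out s) = maximal_palindromes T" "used s \<le> U" "k \<le> N"
    using t unfolding trm_def by blast
  have late: "iter_det w T t ?x = (Skip, s)" if "k \<le> t" for t
  proof -
    have "iter_det w T (t - k + k) ?x = iter_det w T (t - k) (iter_det w T k ?x)"
      by (simp add: funpow_add)
    then show ?thesis using that steps_iter[OF st] by (simp add: iter_det_Skip)
  qed
  have any: "iter_det w T (k + t) ?x = iter_det w T k (iter_det w T t ?x)" for t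
    by (simp add: funpow_add)
  have halted: "iter_det w T t ?x = (Skip, s)" if "fst (iter_det w T t ?x) = Skip" for t
    using any[of t] late[of "k + t"] that iter_det_Skip
    by (metis le_add1 prod.collapse)
  \<comment> \<open>\<open>used\<close> never decreases, so its value at the end bounds it at all
    times.\<close>
  have us: "used (snd (iter_det w T t ?x)) \<le> U" for t
  proof -
    have "iter_det w T k (iter_det w T t ?x) = (Skip, s)" using any[of t] late[of "k + t"] by simp
    then show ?thesis using used_iter_det[of "iter_det w T t ?x" k w T] s(2) by simp
  qed
  have halt: "halt_prob P w T \<tau> b = 1" if "real k \<le> b" for b
  proof -
    have "k \<le> nat \<lfloor>b\<rfloor>" using that by (simp add: le_nat_floor)
    then show ?thesis
      unfolding halt_prob_def run_det[OF P, THEN conjunct1] late[OF \<open>k \<le> nat \<lfloor>b\<rfloor>\<close>]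
      by (simp add: measure_return_pmf)
  qed
  have "(\<lambda>t. halt_prob P w T \<tau> (real t)) \<longlonglongrightarrow> 1"
    by (rule tendsto_eventually) (auto simp: eventually_sequentially intro!: exI[of _ k] halt)
  moreover have "set (out (snd x)) = maximal_palindromes T"
    if "x \<in> set_pmf (run P w T \<tau> t)" "fst x = Skip" for x t
    using that halted[of t] s(1) unfolding run_det[OF P, THEN conjunct1] by auto
  ultimately show "solves_palindromes P w T \<tau>"
    unfolding solves_palindromes_def by fastforce
  show "space_within P w T \<tau> b" if "real (card (com_regs P) + U) \<le> b"
    unfolding space_within_def
  proof (intro allI ballI)
    fix t x assume "x \<in> set_pmf (run P w T \<tau> t)"
    then have "used (snd x) \<le> U"
      using us[of t] unfolding run_det[OF P, THEN conjunct1] by auto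
    then show "case x of (c, s) \<Rightarrow> real (card (com_regs P) + used s) \<le> b"
      using that by (auto split: prod.splits)
  qed
  show "halt_prob P w T \<tau> b = 1" if "real N \<le> b"
    by (rule halt) (use that s(3) in linarith)
qed

section \<open>Evaluating expressions without overflow\<close>

lemma exp_Lit: "k < 2 ^ w \<Longrightarrow> exp_val w \<rho> (Lit k) = k"
  by simp

lemma exp_Reg: "exp_val w \<rho> (Reg r) = \<rho> r"
  by simp

lemma exp_Add:
  "exp_val w \<rho> e1 + exp_val w \<rho> e2 < 2 ^ w \<Longrightarrow>
   exp_val w \<rho> (Bin Add e1 e2) = exp_val w \<rho> e1 + exp_val w \<rho> e2"
  by simp

lemma exp_Mul:
  "exp_val w \<rho> e1 * exp_val w \<rho> e2 < 2 ^ w \<Longrightarrow>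
   exp_val w \<rho> (Bin Mul e1 e2) = exp_val w \<rho> e1 * exp_val w \<rho> e2"
  by simp

lemma exp_Sub:
  assumes "exp_val w \<rho> e2 \<le> exp_val w \<rho> e1" "exp_val w \<rho> e1 < 2 ^ w"
  shows "exp_val w \<rho> (Bin Sub e1 e2) = exp_val w \<rho> e1 - exp_val w \<rho> e2"
proof -
  have "exp_val w \<rho> e1 + 2 ^ w - exp_val w \<rho> e2 = exp_val w \<rho> e1 - exp_val w \<rho> e2 + 2 ^ w"
    using assms by simp
  then have "binop_val w Sub (exp_val w \<rho> e1) (exp_val w \<rho> e2) =
      (exp_val w \<rho> e1 - exp_val w \<rho> e2 + 2 ^ w) mod 2 ^ w"
    by (simp only: binop_val.simps)
  also have "\<dots> = exp_val w \<rho> e1 - exp_val w \<rho> e2" using assms(2) by simp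
  finally show ?thesis by simp
qed

lemma exp_Div: "exp_val w \<rho> (Bin Div e1 e2) = exp_val w \<rho> e1 div exp_val w \<rho> e2"
  by simp

lemma exp_Lt: "1 < (2::nat) ^ w \<Longrightarrow> exp_val w \<rho> (Bin Lt e1 e2) = of_bool (exp_val w \<rho> e1 < exp_val w \<rho> e2)"
  by simp

lemma exp_Eq: "1 < (2::nat) ^ w \<Longrightarrow> exp_val w \<rho> (Bin Eq e1 e2) = of_bool (exp_val w \<rho> e1 = exp_val w \<rho> e2)"
  by simp

lemmas exp_eval = exp_Lit exp_Reg exp_Add exp_Mul exp_Sub exp_Div exp_Lt exp_Eq

subsection \<open>Emitting groups\<close>

text \<open>Registers: input length, current prefix length (or the sum of the two ends of a palindrome),
  offset of the source buffer, its number of groups, read index; write index, last written gap and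
  last written position of the target buffer; the current group; the group to be emitted; scratch.\<close>

abbreviation (input) rN :: nat where "rN \<equiv> 0"
abbreviation (input) rJ :: nat where "rJ \<equiv> 2"
abbreviation (input) rP :: nat where "rP \<equiv> 3"
abbreviation (input) rM :: nat where "rM \<equiv> 4"
abbreviation (input) rR :: nat where "rR \<equiv> 5"
abbreviation (input) rW :: nat where "rW \<equiv> 6"
abbreviation (input) rG :: nat where "rG \<equiv> 7"
abbreviation (input) rL :: nat where "rL \<equiv> 8"
abbreviation (input) rI :: nat where "rI \<equiv> 9"
abbreviation (input) rD :: nat where "rD \<equiv> 10"
abbreviation (input) rK :: nat where "rK \<equiv> 11"
abbreviation (input) eA :: nat where "eA \<equiv> 12"
abbreviation (input) eG :: nat where "eG \<equiv> 13"
abbreviation (input) eC :: nat where "eC \<equiv> 14"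
abbreviation (input) rX :: nat where "rX \<equiv> 15"
abbreviation (input) rY :: nat where "rY \<equiv> 16"

abbreviation Seq_infix :: "com \<Rightarrow> com \<Rightarrow> com" (infixr ";;" 60) where "c ;; d \<equiv> Seq c d"

text \<open>The two buffers, of offsets \<open>p \<in> {0, 3}\<close>, are interleaved with period 6, so that neither
  needs a bound on the size of the other.\<close>

definition holds :: "(nat \<Rightarrow> nat) \<Rightarrow> nat \<Rightarrow> group list \<Rightarrow> bool" where
  "holds M p gs \<longleftrightarrow> (\<forall>t < length gs. (M (6 * t + p), M (6 * t + p + 1), M (6 * t + p + 2)) = gs ! t)"

lemma holds_snoc:
  assumes "holds M p gs" "a0 = 6 * length gs + p" "a1 = a0 + 1" "a2 = a0 + 2"
  shows "holds (M(a0 := x, a1 := y, a2 := z)) p (gs @ [(x, y, z)])"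
  using assms unfolding holds_def by (auto simp: nth_append less_Suc_eq)

lemma holds_update_last:
  assumes "holds M p (gs @ [(x, y, z)])" "a = 6 * length gs + p + 2"
  shows "holds (M(a := z')) p (gs @ [(x, y, z')])"
  using assms unfolding holds_def by (auto simp: nth_append less_Suc_eq)

lemma holds_lastD:
  assumes "holds M p (gs @ [(x, y, z)])" "a = 6 * length gs + p + 2"
  shows "M a = z"
  using assms unfolding holds_def by (auto simp: nth_append)

text \<open>The address lies in the three residues modulo 6 of the other buffer.\<close>

lemma holds_update_other:
  assumes "holds M p gs" "a = 6 * u + (3 - p) + e" "e < 3" "p = 0 \<or> p = 3"
  shows "holds (M(a := z)) p gs"
proof -
  have "a \<noteq> 6 * t + p" "a \<noteq> 6 * t + p + 1" "a \<noteq> 6 * t + p + 2" for t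
    using assms(2-) by presburger+
  then show ?thesis using assms(1) unfolding holds_def by auto
qed

text \<open>The target buffer has offset \<open>3 - p\<close>. Adding \<open>3 + e\<close> before
  \<open>p\<close> is subtracted keeps the word subtraction from wrapping around.\<close>

definition write_addr :: "nat \<Rightarrow> exp" where
  "write_addr e = Bin Sub (Bin Add (Bin Mul (Lit 6) (Reg rW)) (Lit (3 + e))) (Reg rP)"

text \<open>\<open>6 * W - (1 + p)\<close> equals \<open>6 * (W - 1) + (3 - p) + 2\<close>, the
  count field of the last group written.\<close>

definition last_count_addr :: exp where
  "last_count_addr = Bin Sub (Bin Mul (Lit 6) (Reg rW)) (Bin Add (Lit 1) (Reg rP))"

definition emit_com :: com where
  "emit_com = If (Bin Eq (Reg rG) (Reg eG))
     (Load rX last_count_addr ;; Store last_count_addr (Bin Add (Reg rX) (Reg eC)))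
     (Store (write_addr 0) (Reg eA) ;; Store (write_addr 1) (Reg eG) ;;
      Store (write_addr 2) (Reg eC) ;; Assign rW (Bin Add (Reg rW) (Lit 1)) ;; Assign rG (Reg eG))"

text \<open>For an empty target the last gap is set to \<open>1\<close>, which differs from the gap \<open>0\<close> of a first
  element.\<close>

definition writer :: "state \<Rightarrow> nat \<Rightarrow> group list \<Rightarrow> bool" where
  "writer s p gs \<longleftrightarrow> (p = 0 \<or> p = 3) \<and> regs s rP = p \<and> regs s rW = length gs \<and>
     regs s rG = (if gs = [] then 1 else fst (snd (last gs))) \<and> holds (mem s) (3 - p) gs"

lemma write_addr_val:
  assumes "writer s p gs" "6 * length gs + 20 < 2 ^ w" "e < 3"
  shows "exp_val w (regs s) (write_addr e) = 6 * length gs + (3 - p) + e"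
  using assms unfolding writer_def write_addr_def by (auto simp del: exp_val.simps simp: exp_eval)

lemma last_count_addr_val:
  assumes "writer s p (hs @ [g])" "6 * length hs + 20 < 2 ^ w"
  shows "exp_val w (regs s) last_count_addr = 6 * length hs + (3 - p) + 2"
  using assms unfolding writer_def last_count_addr_def
  by (auto simp del: exp_val.simps simp: exp_eval)

text \<open>The memory bound \<open>U\<close> refers to the number of groups after the emission, so
  that merging into the last group is free. The source list \<open>A\<close> is carried along
  because reading and writing alternate.\<close>

lemma trm_emit:
  assumes wr: "writer s p gs" and A: "holds (mem s) p A"
    and first: "gs = [] \<Longrightarrow> regs s eG \<noteq> 1"
    and word: "6 * length gs + 20 < 2 ^ w"
    and cnt: "gs \<noteq> [] \<Longrightarrow> snd (snd (last gs)) + regs s eC < 2 ^ w"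
    and U: "used s \<le> U" "6 * length (emit gs (regs s eA) (regs s eG) (regs s eC)) \<le> U"
  shows "trm w T emit_com s (\<lambda>k s'. k \<le> 12 \<and>
    writer s' p (emit gs (regs s eA) (regs s eG) (regs s eC)) \<and> holds (mem s') p A \<and>
    used s' \<le> U \<and> out s' = out s \<and> (\<forall>r. r \<notin> {rW, rG, rX} \<longrightarrow> regs s' r = regs s r))"
proof -
  have p: "p = 0 \<or> p = 3" using wr by (simp add: writer_def)
  have g: "exp_val w (regs s) (Bin Eq (Reg rG) (Reg eG)) = of_bool (regs s rG = regs s eG)"
    by (subst exp_Eq) (use word in auto)
  show ?thesis unfolding emit_com_def
  proof (rule trm_If; unfold g of_bool_eq_0_iff not_not)
    assume eq: "regs s rG = regs s eG"
    then have "gs \<noteq> []" using first wr by (auto simp: writer_def)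
    then obtain hs x d c where gs: "gs = hs @ [(x, d, c)]" by (cases gs rule: rev_cases) auto
    define a where "a = 6 * length hs + (3 - p) + 2"
    have d: "d = regs s eG" using eq wr by (simp add: writer_def gs)
    have ga: "emit gs (regs s eA) (regs s eG) (regs s eC) = hs @ [(x, d, c + regs s eC)]"
      by (simp add: emit_def gs d)
    have ad: "exp_val w (regs s) last_count_addr = a" unfolding a_def
      by (rule last_count_addr_val) (use wr word gs in auto)
    have M: "mem s a = c" 
      by (rule holds_lastD[of _ "3 - p" hs x d]) (use wr in \<open>auto simp: a_def writer_def gs\<close>)
    let ?s1 = "s\<lparr>regs := (regs s)(rX := c), used := max (used s) (Suc a)\<rparr>"
    have ad': "exp_val w (regs ?s1) last_count_addr = a" unfolding a_def
      by (rule last_count_addr_val) (use wr word gs in \<open>auto simp: writer_def\<close>)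
    have v: "exp_val w (regs ?s1) (Bin Add (Reg rX) (Reg eC)) = c + regs s eC"
      by (subst exp_Add) (use cnt gs in auto)
    show "trm w T (Load rX last_count_addr ;; Store last_count_addr (Bin Add (Reg rX) (Reg eC))) s
      (\<lambda>k s'. Suc k \<le> 12 \<and>
    writer s' p (emit gs (regs s eA) (regs s eG) (regs s eC)) \<and> holds (mem s') p A \<and>
    used s' \<le> U \<and> out s' = out s \<and> (\<forall>r. r \<notin> {rW, rG, rX} \<longrightarrow> regs s' r = regs s r))"
    proof (rule trm_Seq, rule trm_Load[OF ad], unfold M, rule trm_Store[OF ad'], unfold v)
      have "holds ((mem s)(a := c + regs s eC)) p A"
        using A p by (intro holds_update_other[of _ _ _ _ "length hs" 2]) (auto simp: a_def)
      moreover have "holds ((mem s)(a := c + regs s eC)) (3 - p) (hs @ [(x, d, c + regs s eC)])"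
        by (rule holds_update_last[of _ _ _ _ _ c]) (use wr in \<open>auto simp: writer_def gs a_def\<close>)
      moreover have "Suc a \<le> U" using U p unfolding ga a_def by auto
      ultimately show "Suc (Suc (1 + 1)) \<le> 12 \<and>
        writer (?s1\<lparr>mem := (mem ?s1)(a := c + regs s eC), used := max (used ?s1) (Suc a)\<rparr>) p
          (emit gs (regs s eA) (regs s eG) (regs s eC)) \<and>
        holds (mem (?s1\<lparr>mem := (mem ?s1)(a := c + regs s eC), used := max (used ?s1) (Suc a)\<rparr>)) p A \<and>
        used (?s1\<lparr>mem := (mem ?s1)(a := c + regs s eC), used := max (used ?s1) (Suc a)\<rparr>) \<le> U \<and>
        out (?s1\<lparr>mem := (mem ?s1)(a := c + regs s eC), used := max (used ?s1) (Suc a)\<rparr>) = out s \<and>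
        (\<forall>r. r \<notin> {rW, rG, rX} \<longrightarrow>
          regs (?s1\<lparr>mem := (mem ?s1)(a := c + regs s eC), used := max (used ?s1) (Suc a)\<rparr>) r = regs s r)"
        using wr U unfolding ga by (auto simp: writer_def gs)
    qed
  next
    assume ne: "regs s rG \<noteq> regs s eG"
    have ga: "emit gs (regs s eA) (regs s eG) (regs s eC) = gs @ [(regs s eA, regs s eG, regs s eC)]"
      using ne wr by (auto simp: emit_def writer_def)
    define a where "a = 6 * length gs + (3 - p)"
    have ad: "exp_val w (regs s) (write_addr 0) = a" "exp_val w (regs s) (write_addr 1) = a + 1"
      "exp_val w (regs s) (write_addr 2) = a + 2"
      unfolding a_def using write_addr_val[OF wr word] by auto
    let ?M = "(mem s)(a := regs s eA, a + 1 := regs s eG, a + 2 := regs s eC)"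
    have "holds ?M p A"
      using A p
      by (intro holds_update_other[where a = "a + 2" and e = 2 and u = "length gs"]
            holds_update_other[where a = "a + 1" and e = 1 and u = "length gs"]
            holds_update_other[where a = a and e = 0 and u = "length gs"])
        (simp_all add: a_def)
    moreover have "holds ?M (3 - p) (gs @ [(regs s eA, regs s eG, regs s eC)])"
      using wr by (intro holds_snoc) (auto simp: writer_def a_def)
    moreover have "Suc (a + 2) \<le> U" using U p unfolding ga a_def by auto
    moreover have "exp_val w (regs s) (Bin Add (Reg rW) (Lit 1)) = Suc (length gs)"
      using wr word by (simp del: exp_val.simps add: exp_eval writer_def)
    ultimately show "trm w T (Store (write_addr 0) (Reg eA) ;; Store (write_addr 1) (Reg eG) ;;
      Store (write_addr 2) (Reg eC) ;; Assign rW (Bin Add (Reg rW) (Lit 1)) ;; Assign rG (Reg eG)) s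
      (\<lambda>k s'. Suc k \<le> 12 \<and>
    writer s' p (emit gs (regs s eA) (regs s eG) (regs s eC)) \<and> holds (mem s') p A \<and>
    used s' \<le> U \<and> out s' = out s \<and> (\<forall>r. r \<notin> {rW, rG, rX} \<longrightarrow> regs s' r = regs s r))"
      using wr U(1) unfolding ga
      by (intro trm_Seq trm_Store[OF refl] trm_Assign)
        (simp del: exp_val.simps add: ad ad(2)[unfolded One_nat_def] writer_def exp_Reg)
  qed
qed

lemma trm_SeqI:
  assumes "trm w T c1 s Q1" "\<And>k1 s1. Q1 k1 s1 \<Longrightarrow> trm w T c2 s1 (\<lambda>k2. Q (Suc (k1 + k2)))"
  shows "trm w T (c1 ;; c2) s Q"
  using trm_mono[OF assms] by (rule trm_Seq)

lemma writer_cong: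
  assumes "writer s p gs" "\<And>r. r \<in> {rP, rW, rG} \<Longrightarrow> regs s' r = regs s r" "mem s' = mem s"
  shows "writer s' p gs"
  using assms unfolding writer_def by simp

text \<open>This keeps the sum of counts that is formed when groups are merged within a
  word.\<close>

lemma count_enc_le: "g \<in> set (enc xs) \<Longrightarrow> snd (snd g) \<le> length xs"
proof (induction xs arbitrary: g rule: rev_induct)
  case (snoc x xs)
  consider "g \<in> set (enc xs)" | "snd (snd g) = 1"
    | "enc xs \<noteq> []" "snd (snd g) = Suc (snd (snd (last (enc xs))))"
    using snoc.prems by (auto simp: enc_snoc emit_def split: if_splits dest: in_set_butlastD)
  then show ?case
  proof cases
    case 3
    then show ?thesis using snoc.IH[OF last_in_set] by simp
  qed (use snoc.IH[of g] in auto)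
qed simp

text \<open>The comparison yields \<open>0\<close> or \<open>1\<close>, so the product computes
  \<open>gap\<close> without a branch, including the value \<open>0\<close> for a missing
  predecessor.\<close>

definition emit_next_com :: com where
  "emit_next_com = Assign eC (Lit 1) ;;
     Assign eG (Bin Mul (Bin Lt (Lit 0) (Reg rL)) (Bin Sub (Reg eA) (Reg rL))) ;;
     emit_com ;; Assign rL (Reg eA)"

definition writing :: "state \<Rightarrow> nat \<Rightarrow> nat list \<Rightarrow> group list \<Rightarrow> nat \<Rightarrow> bool" where
  "writing s p xs A U \<longleftrightarrow> writer s p (enc xs) \<and> regs s rL = lst xs \<and> holds (mem s) p A \<and>
     used s \<le> U"

lemma trm_emit_next:
  assumes wr: "writing s p xs A U" and le: "lst xs \<le> regs s eA"
    and word: "6 * length xs + regs s eA + 20 < 2 ^ w"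
    and U: "6 * length (enc (xs @ [regs s eA])) \<le> U"
  shows "trm w T emit_next_com s (\<lambda>k s'. k \<le> 18 \<and> writing s' p (xs @ [regs s eA]) A U \<and>
     out s' = out s \<and> (\<forall>r. r \<notin> {rW, rG, rX, eC, eG, rL} \<longrightarrow> regs s' r = regs s r))"
  unfolding emit_next_com_def
proof (rule trm_Seq, rule trm_Assign, rule trm_Seq, rule trm_Assign, rule trm_SeqI)
  have len: "length (enc xs) \<le> length xs" by (rule length_enc_le)
  let ?x = "regs s eA"
  let ?s1 = "s\<lparr>regs := (regs s)(eC := exp_val w (regs s) (Lit 1))\<rparr>"
  let ?s2 = "?s1\<lparr>regs := (regs ?s1)(eG := exp_val w (regs ?s1)
     (Bin Mul (Bin Lt (Lit 0) (Reg rL)) (Bin Sub (Reg eA) (Reg rL))))\<rparr>"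
  have one: "(1::nat) < 2 ^ w" using word by linarith
  have L: "regs s rL = lst xs" using wr by (simp add: writing_def)
  have c: "regs ?s2 eC = 1" using one by (simp del: exp_val.simps add: exp_Lit)
  have a: "regs ?s2 eA = ?x" by simp
  have g: "regs ?s2 eG = gap (lst xs) ?x"
    using one word L le
    by (simp del: exp_val.simps add: exp_eval gap_def)
  have wr2: "writer ?s2 p (enc xs)" and A2: "holds (mem ?s2) p A" and U2: "used ?s2 \<le> U"
    using wr by (auto simp: writing_def intro: writer_cong[of s])
  have cnt: "snd (snd (last (enc xs))) + 1 < 2 ^ w" if "enc xs \<noteq> []"
    using count_enc_le[OF last_in_set[OF that]] word by linarith
  have first: "gap (lst xs) ?x \<noteq> 1" if "enc xs = []" using that by (simp add: lst_def gap_def)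
  have word2: "6 * length (enc xs) + 20 < 2 ^ w" using word len by linarith
  show "trm w T emit_com ?s2 (\<lambda>k s'. k \<le> 12 \<and>
    writer s' p (emit (enc xs) ?x (gap (lst xs) ?x) 1) \<and> holds (mem s') p A \<and>
    used s' \<le> U \<and> out s' = out ?s2 \<and> (\<forall>r. r \<notin> {rW, rG, rX} \<longrightarrow> regs s' r = regs ?s2 r))"
    using trm_emit[of ?s2 p "enc xs" A w U T, unfolded c a g,
        OF wr2 A2 first word2 cnt U2 U[unfolded enc_snoc]] .
  fix k1 :: nat and s1 :: state
  assume 1: "k1 \<le> 12 \<and>
    writer s1 p (emit (enc xs) ?x (gap (lst xs) ?x) 1) \<and> holds (mem s1) p A \<and>
    used s1 \<le> U \<and> out s1 = out ?s2 \<and> (\<forall>r. r \<notin> {rW, rG, rX} \<longrightarrow> regs s1 r = regs ?s2 r)"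
  have e: "regs s1 eA = ?x" using 1 by simp
  let ?s3 = "s1\<lparr>regs := (regs s1)(rL := exp_val w (regs s1) (Reg eA))\<rparr>"
  have "writer ?s3 p (enc (xs @ [?x]))"
    by (rule writer_cong[of s1]) (use 1 in \<open>auto simp: enc_snoc\<close>)
  then have w3: "writing ?s3 p (xs @ [?x]) A U" using 1 e by (simp add: writing_def)
  have r3: "\<forall>r. r \<notin> {rW, rG, rX, eC, eG, rL} \<longrightarrow> regs ?s3 r = regs s r"
    using 1 by auto
  show "trm w T (Assign rL (Reg eA)) s1 (\<lambda>k2 s'. Suc (1 + Suc (1 + Suc (k1 + k2))) \<le> 18 \<and>
      writing s' p (xs @ [?x]) A U \<and>
     out s' = out s \<and> (\<forall>r. r \<notin> {rW, rG, rX, eC, eG, rL} \<longrightarrow> regs s' r = regs s r))"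
    by (rule trm_Assign) (use 1 w3 r3 in auto)
qed

definition emit_rest_com :: com where
  "emit_rest_com = Assign eA (Bin Add (Reg rL) (Reg rD)) ;; Assign eG (Reg rD) ;;
     Assign eC (Bin Sub (Reg rK) (Lit 1)) ;; emit_com ;;
     Assign rL (Bin Add (Reg rL) (Bin Mul (Reg rD) (Bin Sub (Reg rK) (Lit 1))))"

lemma trm_emit_rest:
  fixes xs s
  defines "d \<equiv> regs s rD" and "k \<equiv> regs s rK"
  defines "ys \<equiv> xs @ map (\<lambda>m. lst xs + d + m * d) [0..<k - 1]"
  assumes wr: "writing s p xs A U" and xs: "xs \<noteq> []" "0 < lst xs" and d: "0 < d" and k: "1 < k"
    and word: "6 * length xs + k + lst xs + d + (k - 1) * d + 20 < 2 ^ w"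
    and U: "6 * length (enc ys) \<le> U"
  shows "trm w T emit_rest_com s (\<lambda>k s'. k \<le> 21 \<and> writing s' p ys A U \<and>
     out s' = out s \<and> (\<forall>r. r \<notin> {rW, rG, rX, eA, eC, eG, rL} \<longrightarrow> regs s' r = regs s r))"
  unfolding emit_rest_com_def
proof (rule trm_Seq, rule trm_Assign, rule trm_Seq, rule trm_Assign,
    rule trm_Seq, rule trm_Assign, rule trm_SeqI)
  have len: "length (enc xs) \<le> length xs" by (rule length_enc_le)
  have L: "regs s rL = lst xs" using wr by (simp add: writing_def)
  have one: "(1::nat) < 2 ^ w" using word by linarith
  let ?s1 = "s\<lparr>regs := (regs s)(eA := exp_val w (regs s) (Bin Add (Reg rL) (Reg rD)))\<rparr>"
  let ?s2 = "?s1\<lparr>regs := (regs ?s1)(eG := exp_val w (regs ?s1) (Reg rD))\<rparr>"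
  let ?s3 = "?s2\<lparr>regs := (regs ?s2)(eC := exp_val w (regs ?s2) (Bin Sub (Reg rK) (Lit 1)))\<rparr>"
  have a: "regs ?s3 eA = lst xs + d" using word L
    by (simp del: exp_val.simps add: exp_eval d_def)
  have g: "regs ?s3 eG = d" by (simp add: d_def)
  have c: "regs ?s3 eC = k - 1" using word k unfolding k_def
    by (simp del: exp_val.simps One_nat_def add: exp_eval)
  have ys: "emit (enc xs) (lst xs + d) d (k - 1) = enc ys"
    unfolding ys_def using xs d k by (subst enc_append_progression) auto
  have wr2: "writer ?s3 p (enc xs)" and A2: "holds (mem ?s3) p A" and U2: "used ?s3 \<le> U"
    using wr by (auto simp: writing_def intro: writer_cong[of s])
  have cnt: "snd (snd (last (enc xs))) + (k - 1) < 2 ^ w" if "enc xs \<noteq> []"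
    using count_enc_le[OF last_in_set[OF that]] word by linarith
  have first: "d \<noteq> 1" if "enc xs = []" using that xs by simp
  have word2: "6 * length (enc xs) + 20 < 2 ^ w" using word len by linarith
  show "trm w T emit_com ?s3 (\<lambda>k s'. k \<le> 12 \<and>
    writer s' p (enc ys) \<and> holds (mem s') p A \<and>
    used s' \<le> U \<and> out s' = out ?s3 \<and> (\<forall>r. r \<notin> {rW, rG, rX} \<longrightarrow> regs s' r = regs ?s3 r))"
    using trm_emit[of ?s3 p "enc xs" A w U T, unfolded c a g ys,
        OF wr2 A2 first word2 cnt U2 U] .
  fix k1 :: nat and s1 :: state
  assume 1: "k1 \<le> 12 \<and>
    writer s1 p (enc ys) \<and> holds (mem s1) p A \<and>
    used s1 \<le> U \<and> out s1 = out ?s3 \<and> (\<forall>r. r \<notin> {rW, rG, rX} \<longrightarrow> regs s1 r = regs ?s3 r)"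
  have e: "regs s1 rD = d" "regs s1 rK = k" "regs s1 rL = lst xs" using 1 L d_def k_def by auto
  have ly: "lst ys = lst xs + d * (k - 1)"
    unfolding ys_def using k by (cases "k - 1") (auto simp: lst_def)
  have v: "exp_val w (regs s1) (Bin Add (Reg rL) (Bin Mul (Reg rD) (Bin Sub (Reg rK) (Lit 1)))) = lst ys"
    using word k one unfolding ly
    by (simp del: exp_val.simps One_nat_def add: exp_eval e mult.commute)
  let ?s4 = "s1\<lparr>regs := (regs s1)(rL := exp_val w (regs s1)
    (Bin Add (Reg rL) (Bin Mul (Reg rD) (Bin Sub (Reg rK) (Lit 1)))))\<rparr>"
  have "writer ?s4 p (enc ys)"
    by (rule writer_cong[of s1]) (use 1 in auto)
  then have w3: "writing ?s4 p ys A U" using 1 v by (simp add: writing_def del: exp_val.simps)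
  have r3: "\<forall>r. r \<notin> {rW, rG, rX, eA, eC, eG, rL} \<longrightarrow> regs ?s4 r = regs s r"
    using 1 by auto
  show "trm w T (Assign rL (Bin Add (Reg rL) (Bin Mul (Reg rD) (Bin Sub (Reg rK) (Lit 1))))) s1
    (\<lambda>k2 s'. Suc (1 + Suc (1 + Suc (1 + Suc (k1 + k2)))) \<le> 21 \<and>
      writing s' p ys A U \<and>
     out s' = out s \<and> (\<forall>r. r \<notin> {rW, rG, rX, eA, eC, eG, rL} \<longrightarrow> regs s' r = regs s r))"
    by (rule trm_Assign) (use 1 w3 r3 in \<open>auto simp del: exp_val.simps\<close>)
qed

lemma progression_Cons:
  fixes a d :: nat
  shows "map (\<lambda>m. a + m * d) [0..<Suc k] = a # map (\<lambda>m. a + d + m * d) [0..<k]"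
  by (induction k) auto

text \<open>Two emissions are necessary: the distance of the first member to the last position
  written may differ from \<open>d\<close>, as positions between them may have been dropped. The
  remaining members have distance \<open>d\<close> to their predecessors, so they form one
  piece.\<close>

definition keep_com :: com where
  "keep_com = Assign eA (Bin Sub (Reg rI) (Lit 1)) ;; emit_next_com ;;
     If (Bin Lt (Lit 1) (Reg rK)) emit_rest_com Skip"

lemma trm_keep:
  fixes xs s
  defines "i \<equiv> regs s rI" and "d \<equiv> regs s rD" and "k \<equiv> regs s rK"
  defines "ys \<equiv> xs @ map (\<lambda>m. i - 1 + m * d) [0..<k]"
  assumes wr: "writing s p xs A U" and i: "1 < i" "lst xs \<le> i - 1"
    and d: "1 < k \<Longrightarrow> 0 < d" and k: "0 < k"
    and word: "6 * length xs + k + i + d + (k - 1) * d + 30 < 2 ^ w"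
    and U: "6 * length (enc ys) \<le> U"
  shows "trm w T keep_com s (\<lambda>t s'. t \<le> 45 \<and> writing s' p ys A U \<and>
     out s' = out s \<and> (\<forall>r. r \<notin> {rW, rG, rX, eA, eC, eG, rL} \<longrightarrow> regs s' r = regs s r))"
  unfolding keep_com_def
proof (rule trm_Seq, rule trm_Assign, rule trm_SeqI)
  let ?s1 = "s\<lparr>regs := (regs s)(eA := exp_val w (regs s) (Bin Sub (Reg rI) (Lit 1)))\<rparr>"
  have a: "regs ?s1 eA = i - 1"
    using word i by (simp del: exp_val.simps One_nat_def add: exp_eval i_def)
  have one: "(1::nat) < 2 ^ w" using word by linarith
  have ys: "ys = (xs @ [i - 1]) @ map (\<lambda>m. i - 1 + d + m * d) [0..<k - 1]"
  proof -
    obtain k' where k': "k = Suc k'" using k by (cases k) auto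
    show ?thesis unfolding ys_def k' progression_Cons by simp
  qed
  have U1: "6 * length (enc (xs @ [i - 1])) \<le> U"
    using U length_enc_mono[of "xs @ [i - 1]"] unfolding ys by (meson mult_le_mono2 order.trans)
  have "writer ?s1 p (enc xs)"
    by (rule writer_cong[of s]) (use wr in \<open>auto simp: writing_def\<close>)
  then have "writing ?s1 p xs A U" using wr by (simp add: writing_def)
  then show "trm w T emit_next_com ?s1 (\<lambda>k s'. k \<le> 18 \<and> writing s' p (xs @ [i - 1]) A U \<and>
     out s' = out ?s1 \<and> (\<forall>r. r \<notin> {rW, rG, rX, eC, eG, rL} \<longrightarrow> regs s' r = regs ?s1 r))"
    using trm_emit_next[of ?s1 p xs A U w T, unfolded a] i word U1 by simp
  fix k1 :: nat and s1 :: state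
  assume 1: "k1 \<le> 18 \<and> writing s1 p (xs @ [i - 1]) A U \<and>
     out s1 = out ?s1 \<and> (\<forall>r. r \<notin> {rW, rG, rX, eC, eG, rL} \<longrightarrow> regs s1 r = regs ?s1 r)"
  have e: "regs s1 rD = d" "regs s1 rK = k" using 1 d_def k_def by auto
  have cond: "exp_val w (regs s1) (Bin Lt (Lit 1) (Reg rK)) = of_bool (1 < k)"
    using one by (simp del: exp_val.simps One_nat_def add: exp_eval e)
  show "trm w T (If (Bin Lt (Lit 1) (Reg rK)) emit_rest_com Skip) s1
      (\<lambda>k2 s'. Suc (1 + Suc (k1 + k2)) \<le> 45 \<and> writing s' p ys A U \<and>
     out s' = out s \<and> (\<forall>r. r \<notin> {rW, rG, rX, eA, eC, eG, rL} \<longrightarrow> regs s' r = regs s r))"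
  proof (rule trm_If; unfold cond of_bool_eq_0_iff not_not)
    assume k1: "1 < k"
    have "trm w T emit_rest_com s1 (\<lambda>k s'. k \<le> 21 \<and> writing s' p ys A U \<and>
     out s' = out s1 \<and> (\<forall>r. r \<notin> {rW, rG, rX, eA, eC, eG, rL} \<longrightarrow> regs s' r = regs s1 r))"
      using trm_emit_rest[of s1 p "xs @ [i - 1]" A U w T, unfolded e] 1 k1 d i word U
      unfolding ys by simp
    then show "trm w T emit_rest_com s1
      (\<lambda>k s'. Suc (1 + Suc (k1 + Suc k)) \<le> 45 \<and> writing s' p ys A U \<and>
     out s' = out s \<and> (\<forall>r. r \<notin> {rW, rG, rX, eA, eC, eG, rL} \<longrightarrow> regs s' r = regs s r))"
      by (rule trm_mono) (use 1 in auto)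
  next
    assume "\<not> 1 < k"
    then have "ys = xs @ [i - 1]" unfolding ys by simp
    then show "trm w T Skip s1
      (\<lambda>k s'. Suc (1 + Suc (k1 + Suc k)) \<le> 45 \<and> writing s' p ys A U \<and>
     out s' = out s \<and> (\<forall>r. r \<notin> {rW, rG, rX, eA, eC, eG, rL} \<longrightarrow> regs s' r = regs s r))"
      by (intro trm_Skip) (use 1 in auto)
  qed
qed

text \<open>The guard excludes the empty suffix, which starts at \<open>rJ + 1\<close> and is not a
  palindrome in the sense of \<open>palindrome_at\<close>.\<close>

definition report_com :: com where
  "report_com = While (Reg rK)
     (If (Bin Lt (Reg rI) (Bin Add (Reg rJ) (Lit 1))) (Report (Reg rI) (Reg rJ)) Skip ;;
      Assign rI (Bin Add (Reg rI) (Reg rD)) ;; Assign rK (Bin Sub (Reg rK) (Lit 1)))"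

lemma trm_report:
  fixes s
  defines "i \<equiv> regs s rI" and "d \<equiv> regs s rD" and "k \<equiv> regs s rK" and "j \<equiv> regs s rJ"
  assumes word: "i + k * d + k + j + 2 < 2 ^ w"
  shows "trm w T report_com s (\<lambda>t s'. t \<le> 10 * k + 1 \<and>
     set (out s') = set (out s) \<union> {(x, j) |x. x \<in> set (expand (i, d, k)) \<and> x \<le> j} \<and>
     mem s' = mem s \<and> used s' = used s \<and> (\<forall>r. r \<notin> {rI, rK} \<longrightarrow> regs s' r = regs s r))"
  unfolding report_com_def
proof (rule trm_While[where \<mu> = "\<lambda>s. regs s rK" and ?k0.0 = 0 and
    I = "\<lambda>t s'. \<exists>m \<le> k. regs s' rK = k - m \<and> regs s' rI = i + m * d \<and> t \<le> 10 * m \<and>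
     set (out s') = set (out s) \<union> {(x, j) |x. x \<in> set (expand (i, d, m)) \<and> x \<le> j} \<and>
     mem s' = mem s \<and> used s' = used s \<and> (\<forall>r. r \<notin> {rI, rK} \<longrightarrow> regs s' r = regs s r)"])
  show "\<exists>m \<le> k. regs s rK = k - m \<and> regs s rI = i + m * d \<and> 0 \<le> 10 * m \<and>
     set (out s) = set (out s) \<union> {(x, j) |x. x \<in> set (expand (i, d, m)) \<and> x \<le> j} \<and>
     mem s = mem s \<and> used s = used s \<and> (\<forall>r. r \<notin> {rI, rK} \<longrightarrow> regs s r = regs s r)"
    by (rule exI[of _ 0]) (simp add: expand_def k_def i_def)
next
  fix t and s1 :: state
  assume "\<exists>m \<le> k. regs s1 rK = k - m \<and> regs s1 rI = i + m * d \<and> t \<le> 10 * m \<and>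
     set (out s1) = set (out s) \<union> {(x, j) |x. x \<in> set (expand (i, d, m)) \<and> x \<le> j} \<and>
     mem s1 = mem s \<and> used s1 = used s \<and> (\<forall>r. r \<notin> {rI, rK} \<longrightarrow> regs s1 r = regs s r)"
    and nz: "exp_val w (regs s1) (Reg rK) \<noteq> 0"
  then obtain m where m: "m < k" "regs s1 rK = k - m" "regs s1 rI = i + m * d" "t \<le> 10 * m"
     "set (out s1) = set (out s) \<union> {(x, j) |x. x \<in> set (expand (i, d, m)) \<and> x \<le> j}"
     "mem s1 = mem s" "used s1 = used s" "\<forall>r. r \<notin> {rI, rK} \<longrightarrow> regs s1 r = regs s r"
    by auto
  have rD: "regs s1 rD = d" "regs s1 rJ = j" using m(8) by (auto simp: d_def j_def)
  have "Suc m * d \<le> k * d" using m(1) by (intro mult_le_mono1) simp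
  then have bd: "i + m * d + d + j + 2 + k < 2 ^ w" using word by simp
  have ex: "set (expand (i, d, Suc m)) = insert (i + m * d) (set (expand (i, d, m)))"
    by (auto simp: expand_def less_Suc_eq)
  define I where "I = (\<lambda>t (s' :: state). \<exists>m \<le> k. regs s' rK = k - m \<and> regs s' rI = i + m * d \<and> t \<le> 10 * m \<and>
     set (out s') = set (out s) \<union> {(x, j) |x. x \<in> set (expand (i, d, m)) \<and> x \<le> j} \<and>
     mem s' = mem s \<and> used s' = used s \<and> (\<forall>r. r \<notin> {rI, rK} \<longrightarrow> regs s' r = regs s r))"
  let ?A = "if i + m * d \<le> j then {(i + m * d, j)} else {}"
  have c: "exp_val w (regs s1) (Bin Lt (Reg rI) (Bin Add (Reg rJ) (Lit 1))) = of_bool (i + m * d \<le> j)"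
    using bd by (simp del: exp_val.simps One_nat_def add: exp_eval rD m less_Suc_eq_le)
  have "trm w T
     (If (Bin Lt (Reg rI) (Bin Add (Reg rJ) (Lit 1))) (Report (Reg rI) (Reg rJ)) Skip ;;
      Assign rI (Bin Add (Reg rI) (Reg rD)) ;; Assign rK (Bin Sub (Reg rK) (Lit 1))) s1
      (\<lambda>t' s'. I (t + t' + 2) s' \<and> regs s' rK < regs s1 rK)"
  proof (rule trm_SeqI)
    show "trm w T (If (Bin Lt (Reg rI) (Bin Add (Reg rJ) (Lit 1))) (Report (Reg rI) (Reg rJ)) Skip) s1
      (\<lambda>t' s'. t' \<le> 2 \<and> set (out s') = set (out s1) \<union> ?A \<and> mem s' = mem s1 \<and> used s' = used s1 \<and>
         regs s' = regs s1)"
      by (rule trm_If; unfold c of_bool_eq_0_iff not_not; intro trm_Report trm_Skip)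
        (auto simp: m rD)
  next
    fix t2 :: nat and s2 :: state
    assume 2: "t2 \<le> 2 \<and> set (out s2) = set (out s1) \<union> ?A \<and> mem s2 = mem s1 \<and> used s2 = used s1 \<and>
         regs s2 = regs s1"
    have v: "exp_val w (regs s2) (Bin Add (Reg rI) (Reg rD)) = i + Suc m * d"
      using bd 2 by (simp del: exp_val.simps add: exp_eval rD m)
    let ?s3 = "s2\<lparr>regs := (regs s2)(rI := i + Suc m * d)\<rparr>"
    have v3: "exp_val w (regs ?s3) (Bin Sub (Reg rK) (Lit 1)) = k - Suc m"
    proof -
      have "1 \<le> k - m" "k - m < 2 ^ w" "(1::nat) < 2 ^ w" "k - m - 1 = k - Suc m"
        using bd m(1) by linarith+
      then show ?thesis using 2 by (simp del: exp_val.simps One_nat_def add: exp_eval m(2))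
    qed
    show "trm w T (Assign rI (Bin Add (Reg rI) (Reg rD)) ;; Assign rK (Bin Sub (Reg rK) (Lit 1))) s2
      (\<lambda>t' s'. I (t + Suc (t2 + t') + 2) s' \<and> regs s' rK < regs s1 rK)"
      apply (rule trm_Seq, rule trm_Assign, rule trm_Assign)
      unfolding v v3 I_def
      using m(1,4-) 2 by (intro conjI exI[of _ "Suc m"]) (auto simp: ex m(2))
  qed
  then show "trm w T
     (If (Bin Lt (Reg rI) (Bin Add (Reg rJ) (Lit 1))) (Report (Reg rI) (Reg rJ)) Skip ;;
      Assign rI (Bin Add (Reg rI) (Reg rD)) ;; Assign rK (Bin Sub (Reg rK) (Lit 1))) s1
      (\<lambda>t' s'. (\<exists>m \<le> k. regs s' rK = k - m \<and> regs s' rI = i + m * d \<and> t + t' + 2 \<le> 10 * m \<and>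
     set (out s') = set (out s) \<union> {(x, j) |x. x \<in> set (expand (i, d, m)) \<and> x \<le> j} \<and>
     mem s' = mem s \<and> used s' = used s \<and> (\<forall>r. r \<notin> {rI, rK} \<longrightarrow> regs s' r = regs s r)) \<and>
     regs s' rK < regs s1 rK)"
    unfolding I_def .
next
  fix t and s' :: state
  assume "\<exists>m \<le> k. regs s' rK = k - m \<and> regs s' rI = i + m * d \<and> 0 + t \<le> 10 * m \<and>
     set (out s') = set (out s) \<union> {(x, j) |x. x \<in> set (expand (i, d, m)) \<and> x \<le> j} \<and>
     mem s' = mem s \<and> used s' = used s \<and> (\<forall>r. r \<notin> {rI, rK} \<longrightarrow> regs s' r = regs s r)"
    and "exp_val w (regs s') (Reg rK) = 0"
  then show "Suc t \<le> 10 * k + 1 \<and>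
     set (out s') = set (out s) \<union> {(x, j) |x. x \<in> set (expand (i, d, k)) \<and> x \<le> j} \<and>
     mem s' = mem s \<and> used s' = used s \<and> (\<forall>r. r \<notin> {rI, rK} \<longrightarrow> regs s' r = regs s r)"
    by auto
qed

subsection \<open>Maximal palindromes and sentinels\<close>

text \<open>The out-of-range positions carry two distinct sentinels, so that a maximal palindrome is
  exactly one whose two neighbouring letters differ.\<close>

definition letter :: "nat list \<Rightarrow> nat \<Rightarrow> int" where
  "letter T q = (if q = 0 then -1 else if q \<le> length T then int (T ! (q - 1)) else -2)"

lemma letter_inside: "1 \<le> q \<Longrightarrow> q \<le> length T \<Longrightarrow> letter T q = int (T ! (q - 1))"
  by (simp add: letter_def)

lemma letter_0_neq: "1 \<le> q \<Longrightarrow> letter T q \<noteq> letter T 0"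
  by (simp add: letter_def)

lemma letter_neighbours_eq_iff:
  assumes "1 \<le> i" "i \<le> Suc j" "j \<le> length T"
  shows "letter T (i - 1) = letter T (Suc j) \<longleftrightarrow> 1 < i \<and> j < length T \<and> T ! (i - 2) = T ! j"
  using assms by (auto simp: letter_def numeral_2_eq_2)

lemma palindrome_at_iff:
  "palindrome_at T i j \<longleftrightarrow> 1 \<le> i \<and> i \<le> j \<and> j \<le> length T \<and> pal (letter T) i j"
proof (cases "1 \<le> i \<and> i \<le> j \<and> j \<le> length T")
  case True
  define xs where "xs = substring T i j"
  have len: "length xs = Suc j - i" using True by (auto simp: xs_def substring_def)
  have nth: "xs ! m = T ! (i - 1 + m)" if "m < Suc j - i" for m
    using that True unfolding xs_def substring_def by (subst nth_take, simp, subst nth_drop) auto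
  have "xs = rev xs \<longleftrightarrow> (\<forall>m < Suc j - i. xs ! m = xs ! (Suc j - i - Suc m))"
    by (auto simp: list_eq_iff_nth_eq len rev_nth)
  also have "\<dots> \<longleftrightarrow> (\<forall>m < Suc j - i. T ! (i - 1 + m) = T ! (i - 1 + (Suc j - i - Suc m)))"
    using nth by simp
  also have "\<dots> \<longleftrightarrow> pal (letter T) i j"
  proof
    assume L: "\<forall>m < Suc j - i. T ! (i - 1 + m) = T ! (i - 1 + (Suc j - i - Suc m))"
    show "pal (letter T) i j" unfolding pal_def
    proof (intro allI impI)
      fix q assume q: "i \<le> q \<and> q \<le> j"
      have "i - 1 + (q - i) = q - 1" "i - 1 + (Suc j - i - Suc (q - i)) = i + j - q - 1"
        using q True by auto
      moreover have "q - i < Suc j - i" using q by auto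
      ultimately have "T ! (q - 1) = T ! (i + j - q - 1)" using L by metis
      moreover have "1 \<le> q" "q \<le> length T" "1 \<le> i + j - q" "i + j - q \<le> length T"
        using q True by auto
      ultimately show "letter T q = letter T (i + j - q)" by (simp only: letter_inside)
    qed
  next
    assume R: "pal (letter T) i j"
    show "\<forall>m < Suc j - i. T ! (i - 1 + m) = T ! (i - 1 + (Suc j - i - Suc m))"
    proof (intro allI impI)
      fix m assume m: "m < Suc j - i"
      have "letter T (i + m) = letter T (j - m)" using m by (intro palD[OF R]) auto
      moreover have "i - 1 + m = i + m - 1" "i - 1 + (Suc j - i - Suc m) = j - m - 1"
        "1 \<le> i + m" "i + m \<le> length T" "1 \<le> j - m" "j - m \<le> length T"
        using m True by auto
      ultimately show "T ! (i - 1 + m) = T ! (i - 1 + (Suc j - i - Suc m))"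
        by (metis letter_inside of_nat_eq_iff)
    qed
  qed
  finally show ?thesis using True by (simp add: palindrome_at_def xs_def)
qed (auto simp: palindrome_at_def)

text \<open>If the palindrome touches an end of the text, one neighbour is a sentinel and differs
  from the other neighbour, which agrees with the range conditions of \<open>palindrome_at\<close>.
  Otherwise \<open>pal_extend\<close> decides.\<close>

lemma maximal_palindromes_iff:
  "(i, j) \<in> maximal_palindromes T \<longleftrightarrow>
     1 \<le> i \<and> i \<le> j \<and> j \<le> length T \<and> pal (letter T) i j \<and> letter T (i - 1) \<noteq> letter T (Suc j)"
proof (cases "1 \<le> i \<and> i \<le> j \<and> j \<le> length T \<and> pal (letter T) i j")
  case True
  show ?thesis
  proof (cases "i = 1 \<or> j = length T")
    case True2: True
    then have "letter T (i - 1) \<noteq> letter T (Suc j)"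
      using True letter_neighbours_eq_iff[of i j T] by auto
    then show ?thesis using True True2
      by (auto simp: maximal_palindromes_def palindrome_at_iff)
  next
    case False
    then have "palindrome_at T (i - 1) (Suc j) \<longleftrightarrow> letter T (i - 1) = letter T (Suc j)"
      using True pal_extend[of i j "letter T"] by (auto simp: palindrome_at_iff)
    then show ?thesis using True by (auto simp: maximal_palindromes_def palindrome_at_iff)
  qed
qed (auto simp: maximal_palindromes_def palindrome_at_iff)

section \<open>Testing one group against the next letter\<close>

lemma length_pals: "length (pals f j) \<le> Suc j"
  unfolding pals_def using length_filter_le[of "\<lambda>i. pal f i j" "[1..<j + 2]"]
  by (simp del: upt_Suc)

definition group_addr :: exp where
  "group_addr = Bin Add (Bin Mul (Lit 6) (Reg rR)) (Reg rP)"

text \<open>A read outside the text yields \<open>0\<close>, which may also be a letter. The two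
  range tests restore the sentinels; all factors are \<open>0\<close> or \<open>1\<close>, so the
  product is a conjunction.\<close>

definition extends_exp :: exp where
  "extends_exp = Bin Mul (Bin Lt (Lit 1) (Reg rI))
     (Bin Mul (Bin Lt (Reg rJ) (Reg rN)) (Bin Eq (Reg rX) (Reg rY)))"

definition fetch_com :: com where
  "fetch_com = Load rI group_addr ;; Load rD (Bin Add group_addr (Lit 1)) ;;
     Load rK (Bin Add group_addr (Lit 2)) ;;
     Read rX (Bin Sub (Reg rI) (Lit 1)) ;; Read rY (Bin Add (Reg rJ) (Lit 1))"

definition group_com :: com where
  "group_com = fetch_com ;; If extends_exp keep_com report_com ;;
     Assign rR (Bin Add (Reg rR) (Lit 1))"

text \<open>\<open>G\<close> bounds the number of groups. It is required up to
  \<open>Suc (length T)\<close> because the last round, whose next letter is the right sentinel,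
  still writes the list for the next length. The first assumption leaves room for the buffer
  addresses and for the sums of positions that occur.\<close>

locale word_instance =
  fixes w :: nat and T :: "nat list" and G :: nat
  assumes word: "64 * (length T + 2) \<le> 2 ^ w"
    and G: "\<And>j. j \<le> Suc (length T) \<Longrightarrow> length (enc (pals (letter T) j)) \<le> G"
begin

abbreviation n where "n \<equiv> length T"
abbreviation f where "f \<equiv> letter T"

definition surv :: "nat \<Rightarrow> nat list \<Rightarrow> nat list" where
  "surv j xs = map (\<lambda>i. i - 1) (filter (\<lambda>i. f (i - 1) = f (Suc j)) xs)"

definition seen :: "nat \<Rightarrow> nat \<Rightarrow> nat list" where
  "seen j r = concat (map expand (take r (enc (pals f j))))"

lemma pals_step: "pals f (Suc j) = surv j (pals f j) @ [Suc j, Suc (Suc j)]"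
  unfolding surv_def by (rule pals_Suc) (rule letter_0_neq)

lemma good_pals: "good (pals f j) (enc (pals f j))"
  by (intro good_enc sorted_pals) (auto simp: set_pals)

lemma seen_append: "pals f j = seen j r @ concat (map expand (drop r (enc (pals f j))))"
proof -
  have "concat (map expand (enc (pals f j))) = pals f j" using good_pals unfolding good_def by blast
  then show ?thesis unfolding seen_def
    by (metis append_take_drop_id concat_append map_append)
qed

lemma seen_all: "seen j (length (enc (pals f j))) = pals f j"
  using seen_append[of j "length (enc (pals f j))"] by simp

lemma seen_Suc:
  "r < length (enc (pals f j)) \<Longrightarrow> seen j (Suc r) = seen j r @ expand (enc (pals f j) ! r)"
  unfolding seen_def by (simp add: take_Suc_conv_app_nth)

lemma surv_append: "surv j (xs @ ys) = surv j xs @ surv j ys"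
  by (simp add: surv_def)

lemma length_surv_seen: "length (surv j (seen j r)) \<le> length (pals f j)"
proof -
  have "length (surv j (seen j r)) \<le> length (seen j r)" by (simp add: surv_def)
  then show ?thesis using arg_cong[OF seen_append[of j r], of length] by simp
qed

text \<open>What has been written after \<open>r\<close> groups encodes a prefix of
  \<open>pals f (Suc j)\<close>.\<close>

lemma enc_surv_seen_le:
  assumes "j \<le> n" shows "length (enc (surv j (seen j r))) \<le> G"
proof -
  have "pals f (Suc j) = surv j (seen j r) @ surv j (concat (map expand (drop r (enc (pals f j))))) @
      [Suc j, Suc (Suc j)]"
    unfolding pals_step using surv_append seen_append[of j r] by (metis append_assoc)
  then have "length (enc (surv j (seen j r))) \<le> length (enc (pals f (Suc j)))"
    by (metis length_enc_mono)
  then show ?thesis using G[of "Suc j"] assms by simp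
qed

lemma surv_expand:
  assumes "r < length (enc (pals f j))" "enc (pals f j) ! r = (i, d, k)" "1 \<le> i"
  shows "surv j (expand (i, d, k)) =
    (if f (i - 1) = f (Suc j) then map (\<lambda>m. i - 1 + m * d) [0..<k] else [])"
proof -
  have mem: "(i, d, k) \<in> set (enc (pals f j))" using assms by (metis nth_mem)
  have "f (i + m * d - 1) = f (i - 1)" if "m < k" for m
    using group_extends_uniformly[OF mem that] .
  then have "filter (\<lambda>i. f (i - 1) = f (Suc j)) (expand (i, d, k)) =
    (if f (i - 1) = f (Suc j) then expand (i, d, k) else [])"
    by (auto simp: expand_def intro!: filter_True filter_False)
  then show ?thesis using assms(3) by (auto simp: surv_def expand_def)
qed

text \<open>These bounds discharge the overflow conditions. The last one holds because the list is
  increasing and survivors move left by one just as \<open>i\<close> does; it makes the subtraction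
  in the next emission a true gap.\<close>

lemma groupD:
  assumes "r < length (enc (pals f j))" "enc (pals f j) ! r = (i, d, k)"
  shows "1 \<le> i" "1 \<le> k" "1 < k \<Longrightarrow> 0 < d" "i + (k - 1) * d \<le> Suc j" "d \<le> Suc j" "k \<le> Suc j"
    "lst (surv j (seen j r)) \<le> i - 1"
proof -
  have mem: "(i, d, k) \<in> set (enc (pals f j))" using assms by (metis nth_mem)
  have g: "1 \<le> k" "d = 0 \<longrightarrow> k = 1" "0 < d \<longrightarrow> d < i \<and> i - d \<in> set (pals f j)"
    using good_pals[of j] mem unfolding good_def by auto
  show "1 \<le> k" "1 < k \<Longrightarrow> 0 < d" using g by auto
  have "snd (snd (i, d, k)) \<le> length (pals f j)" by (rule count_enc_le[OF mem])
  then show "k \<le> Suc j" using length_pals[of f j] by simp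
  have app: "pals f j = seen j r @ expand (i, d, k) @ concat (map expand (drop (Suc r) (enc (pals f j))))"
    using seen_append[of j "Suc r"] seen_Suc[OF assms(1)] assms(2) by simp
  have "i + m * d \<in> set (expand (i, d, k))" if "m < k" for m
    using that by (auto simp: expand_def)
  then have "i + m * d \<in> set (pals f j)" if "m < k" for m
    using app that by (metis Un_iff set_append)
  from this[of 0] this[of "k - 1"] show i: "1 \<le> i" "i + (k - 1) * d \<le> Suc j"
    using g(1) by (auto simp: set_pals)
  show "d \<le> Suc j" using g(3) i by (cases "d = 0") auto
  have "x < i" if "x \<in> set (seen j r)" for x
  proof -
    have "i \<in> set (expand (i, d, k))" using g(1) by (force simp: expand_def)
    moreover have "sorted_wrt (<)
        (seen j r @ expand (i, d, k) @ concat (map expand (drop (Suc r) (enc (pals f j)))))"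
      using sorted_pals[of f j] by (subst app[symmetric])
    ultimately show ?thesis using that by (auto simp: sorted_wrt_append)
  qed
  then have "y \<le> i - 1" if "y \<in> set (surv j (seen j r))" for y
    using that unfolding surv_def by fastforce
  then show "lst (surv j (seen j r)) \<le> i - 1" unfolding lst_def by simp
qed

lemma trm_fetch:
  assumes wr: "writing s p xs (enc (pals f j)) U" and j: "j \<le> n" and U: "6 * G \<le> U"
    and r: "r < length (enc (pals f j))" "enc (pals f j) ! r = (i, d, k)"
    and s: "regs s rN = n" "regs s rJ = j" "regs s rR = r"
  shows "trm w T fetch_com s (\<lambda>t s'. t \<le> 9 \<and> writing s' p xs (enc (pals f j)) U \<and>
     regs s' rI = i \<and> regs s' rD = d \<and> regs s' rK = k \<and>
     (exp_val w (regs s') extends_exp \<noteq> 0 \<longleftrightarrow> f (i - 1) = f (Suc j)) \<and>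
     out s' = out s \<and> (\<forall>q. q \<notin> {rI, rD, rK, rX, rY} \<longrightarrow> regs s' q = regs s q))"
proof -
  let ?A = "enc (pals f j)"
  have p: "p = 0 \<or> p = 3" "regs s rP = p" using wr by (auto simp: writing_def writer_def)
  have rG: "r < G" using G[of j] j r(1) by simp
  have rn: "r \<le> n" using r(1) length_enc_le[of "pals f j"] length_pals[of f j] j by simp
  define a where "a = 6 * r + p"
  have M: "mem s a = i" "mem s (a + 1) = d" "mem s (a + 2) = k"
    using wr r unfolding writing_def holds_def a_def by auto
  have aU: "a + 3 \<le> U" using rG U p(1) unfolding a_def by auto
  have b: "a + 20 < 2 ^ w" "n + 20 < 2 ^ w" "i < 2 ^ w" "(1::nat) < 2 ^ w"
    using word rn p(1) groupD(4)[OF r] j unfolding a_def by auto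
  note gd = groupD[OF r]
  let ?x = "if 1 \<le> i - 1 \<and> i - 1 \<le> n then T ! (i - 1 - 1) else 0"
  let ?y = "if 1 \<le> Suc j \<and> Suc j \<le> n then T ! (Suc j - 1) else 0"
  let ?s' = "s\<lparr>regs := (regs s)(rI := i, rD := d, rK := k, rX := ?x, rY := ?y),
     used := max (max (max (used s) (Suc a)) (Suc (a + 1))) (Suc (a + 2))\<rparr>"
  have ga: "exp_val w \<rho> group_addr = a" if "\<rho> rR = r" "\<rho> rP = p" for \<rho>
    unfolding group_addr_def using b(1) that p unfolding a_def
    by (simp del: exp_val.simps add: exp_eval)
  have v: "exp_val w \<rho> (Bin Add group_addr (Lit c)) = a + c" if "\<rho> rR = r" "\<rho> rP = p" "c < 3" for \<rho> c
    using b that ga[of \<rho>] by (simp del: exp_val.simps add: exp_eval)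
  have "f (i - 1) = f (Suc j) \<longleftrightarrow> 1 < i \<and> j < n \<and> T ! (i - 2) = T ! j"
    using gd j by (intro letter_neighbours_eq_iff) auto
  also have "\<dots> \<longleftrightarrow> 1 < i \<and> j < n \<and> ?x = ?y"
    using gd j by (auto simp: numeral_2_eq_2)
  also have "\<dots> \<longleftrightarrow> exp_val w (regs ?s') extends_exp \<noteq> 0"
    unfolding extends_exp_def using b s
    by (simp del: exp_val.simps One_nat_def add: exp_eval)
  finally have cond: "exp_val w (regs ?s') extends_exp \<noteq> 0 \<longleftrightarrow> f (i - 1) = f (Suc j)" by blast
  have "writer ?s' p (enc xs)"
    by (rule writer_cong[of s]) (use wr in \<open>auto simp: writing_def\<close>)
  then have wr': "writing ?s' p xs ?A U" using wr aU by (simp add: writing_def)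
  have "trm w T fetch_com s (\<lambda>t s'. t \<le> 9 \<and> s' = ?s')"
    unfolding fetch_com_def
    apply (rule trm_Seq, rule trm_Load, rule ga, simp add: s, simp add: p)
    apply (rule trm_Seq, rule trm_Load, rule v, simp add: s, simp add: p, simp)
    apply (rule trm_Seq, rule trm_Load, rule v, simp add: s, simp add: p, simp)
    apply (rule trm_Seq, rule trm_Read[where i = "i - 1"])
     apply (use b gd M in \<open>simp del: exp_val.simps One_nat_def add: exp_eval\<close>)
    apply (rule trm_Read[where i = "Suc j"])
     apply (use b gd s j in \<open>simp del: exp_val.simps One_nat_def add: exp_eval\<close>)
    using M by (simp add: fun_upd_def)
  then show ?thesis
    by (rule trm_mono) (use wr' cond in \<open>auto simp del: exp_val.simps\<close>)
qed

end

subsection \<open>The scan\<close>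

text \<open>The loop leaves the survivors in the target buffer. The positions \<open>rJ + 1\<close>
  and \<open>rJ + 2\<close> are the one-letter and the empty suffix of the longer prefix, and
  \<open>3 - rP\<close> exchanges the buffers.\<close>

definition round_com :: com where
  "round_com = Assign rR (Lit 0) ;; Assign rW (Lit 0) ;; Assign rG (Lit 1) ;; Assign rL (Lit 0) ;;
     While (Bin Lt (Reg rR) (Reg rM)) group_com ;;
     Assign eA (Bin Add (Reg rJ) (Lit 1)) ;; emit_next_com ;;
     Assign eA (Bin Add (Reg rJ) (Lit 2)) ;; emit_next_com ;;
     Assign rM (Reg rW) ;; Assign rP (Bin Sub (Lit 3) (Reg rP)) ;;
     Assign rJ (Bin Add (Reg rJ) (Lit 1))"

text \<open>The three stores write the group \<open>(1, 0, 1)\<close>, the empty suffix of the empty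
  prefix. The loop also runs for \<open>rJ = rN\<close>: there the right sentinel matches no letter,
  so all remaining nonempty suffixes are reported.\<close>

definition groups_com :: com where
  "groups_com = Store (Lit 0) (Lit 1) ;; Store (Lit 1) (Lit 0) ;; Store (Lit 2) (Lit 1) ;;
     Assign rM (Lit 1) ;; Assign rJ (Lit 0) ;; Assign rP (Lit 0) ;;
     While (Bin Lt (Reg rJ) (Bin Add (Reg rN) (Lit 1))) round_com"

context word_instance
begin

definition reported :: "nat \<Rightarrow> nat list \<Rightarrow> (nat \<times> nat) set" where
  "reported j xs = {(x, j) |x. x \<in> set xs \<and> f (x - 1) \<noteq> f (Suc j) \<and> x \<le> j}"

text \<open>Amortization, written without subtraction: the charge is \<open>60\<close> plus
  \<open>10\<close> for each position that does not survive. An accepted group of size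
  \<open>k\<close> enlarges both \<open>seen\<close> and \<open>surv\<close> by \<open>k\<close> and
  takes constant time; a rejected one enlarges only \<open>seen\<close>, which pays for reporting
  its members.\<close>

lemma trm_group:
  assumes wr: "writing s p (surv j (seen j r)) (enc (pals f j)) (6 * G)" and j: "j \<le> n"
    and r: "r < length (enc (pals f j))"
    and s: "regs s rN = n" "regs s rJ = j" "regs s rR = r"
  shows "trm w T group_com s (\<lambda>t s'.
     t + 10 * length (surv j (seen j (Suc r))) + 10 * length (seen j r) \<le>
       60 + 10 * length (seen j (Suc r)) + 10 * length (surv j (seen j r)) \<and>
     writing s' p (surv j (seen j (Suc r))) (enc (pals f j)) (6 * G) \<and>
     set (out s') = set (out s) \<union> reported j (expand (enc (pals f j) ! r)) \<and>
     regs s' rN = n \<and> regs s' rJ = j \<and> regs s' rM = regs s rM \<and> regs s' rR = Suc r)"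
proof -
  let ?A = "enc (pals f j)"
  let ?xs = "surv j (seen j r)"
  obtain i d k where g: "?A ! r = (i, d, k)" by (cases "?A ! r") auto
  note gd = groupD[OF r g]
  have lx: "length ?xs \<le> Suc n"
    using length_surv_seen[of j r] length_pals[of f j] j by simp
  have rn: "r \<le> n" using r length_enc_le[of "pals f j"] length_pals[of f j] j by simp
  have sn: "seen j (Suc r) = seen j r @ expand (i, d, k)" using seen_Suc[OF r] g by simp
  have sv: "surv j (seen j (Suc r)) = ?xs @ (if f (i - 1) = f (Suc j) then
      map (\<lambda>m. i - 1 + m * d) [0..<k] else [])"
    unfolding sn surv_append surv_expand[OF r g gd(1)] ..
  have ls: "length (seen j (Suc r)) = length (seen j r) + k" unfolding sn by (simp add: expand_def)
  have same: "f (x - 1) = f (i - 1)" if "x \<in> set (expand (i, d, k))" for x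
    using that group_extends_uniformly[of i d k f j] nth_mem[OF r] g by (auto simp: expand_def)
  \<comment> \<open>The reporting loop advances \<open>rI\<close> once beyond the last member, so
    \<open>i + k * d\<close> must fit into a word as well.\<close>
  have "k * d = (k - 1) * d + d" using gd(2) by (cases k) auto
  then have "i + k * d = i + (k - 1) * d + d" by simp
  also have "\<dots> \<le> Suc j + Suc j" by (intro add_mono gd)
  finally have kd: "i + k * d \<le> 2 * n + 2" using j by simp
  have kd1: "(k - 1) * d \<le> Suc n" using gd(4) j by simp
  have W: "64 * n + 128 \<le> 2 ^ w" using word by simp
  show ?thesis unfolding group_com_def
  proof (rule trm_SeqI[OF trm_fetch[OF wr j order.refl r g s]])
    fix t1 :: nat and s1 :: state
    assume 1: "t1 \<le> 9 \<and> writing s1 p ?xs ?A (6 * G) \<and>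
      regs s1 rI = i \<and> regs s1 rD = d \<and> regs s1 rK = k \<and>
      (exp_val w (regs s1) extends_exp \<noteq> 0 \<longleftrightarrow> f (i - 1) = f (Suc j)) \<and>
      out s1 = out s \<and> (\<forall>q. q \<notin> {rI, rD, rK, rX, rY} \<longrightarrow> regs s1 q = regs s q)"
    then have c: "exp_val w (regs s1) extends_exp \<noteq> 0 \<longleftrightarrow> f (i - 1) = f (Suc j)" by blast
    have regs1: "regs s1 rI = i" "regs s1 rD = d" "regs s1 rK = k" "regs s1 rJ = j"
      using 1 s by auto
    let ?Q = "\<lambda>t s'. t + 10 * length (surv j (seen j (Suc r))) + 10 * length (seen j r) \<le>
         47 + 10 * length (seen j (Suc r)) + 10 * length ?xs \<and>
       writing s' p (surv j (seen j (Suc r))) ?A (6 * G) \<and>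
       set (out s') = set (out s) \<union> reported j (expand (?A ! r)) \<and>
       regs s' rN = n \<and> regs s' rJ = j \<and> regs s' rM = regs s rM \<and> regs s' rR = r"
    have "trm w T (If extends_exp keep_com report_com) s1 ?Q"
    proof (rule trm_If)
      assume "exp_val w (regs s1) extends_exp \<noteq> 0"
      then have ext: "f (i - 1) = f (Suc j)" using c by simp
      \<comment> \<open>A match excludes the sentinel at \<open>0\<close>, so the shifted start
        \<open>i - 1\<close> is a position of the text.\<close>
      then have i: "1 < i" using letter_neighbours_eq_iff[of i j T] gd j by auto
      have sv': "surv j (seen j (Suc r)) = ?xs @ map (\<lambda>m. i - 1 + m * d) [0..<k]"
        using sv ext by simp
      have "6 * length (enc (?xs @ map (\<lambda>m. i - 1 + m * d) [0..<k])) \<le> 6 * G"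
        using enc_surv_seen_le[OF j, of "Suc r"] unfolding sv' by simp
      moreover have "6 * length ?xs + k + i + d + (k - 1) * d + 30 < 2 ^ w"
        using lx gd j W kd1 by linarith
      ultimately have "trm w T keep_com s1 (\<lambda>t s'. t \<le> 45 \<and>
          writing s' p (?xs @ map (\<lambda>m. i - 1 + m * d) [0..<k]) ?A (6 * G) \<and>
          out s' = out s1 \<and> (\<forall>r. r \<notin> {rW, rG, rX, eA, eC, eG, rL} \<longrightarrow> regs s' r = regs s1 r))"
        using trm_keep[of s1 p ?xs ?A "6 * G" w T, unfolded regs1] 1 i gd by simp
      moreover have "reported j (expand (?A ! r)) = {}"
        unfolding reported_def g using same ext by auto
      ultimately show "trm w T keep_com s1 (\<lambda>t. ?Q (Suc t))"
        unfolding sv' ls by (elim trm_mono) (use 1 s in simp)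
    next
      assume "exp_val w (regs s1) extends_exp = 0"
      then have ext: "f (i - 1) \<noteq> f (Suc j)" using c by simp
      have sv': "surv j (seen j (Suc r)) = ?xs" using sv ext by simp
      have "i + k * d + k + j + 2 < 2 ^ w" using gd(6) j W kd by linarith
      then have "trm w T report_com s1 (\<lambda>t s'. t \<le> 10 * k + 1 \<and>
         set (out s') = set (out s1) \<union> {(x, j) |x. x \<in> set (expand (i, d, k)) \<and> x \<le> j} \<and>
         mem s' = mem s1 \<and> used s' = used s1 \<and> (\<forall>r. r \<notin> {rI, rK} \<longrightarrow> regs s' r = regs s1 r))"
        using trm_report[of s1 w T, unfolded regs1] by simp
      moreover have "reported j (expand (?A ! r)) = {(x, j) |x. x \<in> set (expand (i, d, k)) \<and> x \<le> j}"
        unfolding reported_def g using same ext by auto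
      ultimately show "trm w T report_com s1 (\<lambda>t. ?Q (Suc t))"
      proof (elim trm_mono)
        fix t :: nat and s' :: state
        assume rep: "reported j (expand (?A ! r)) = {(x, j) |x. x \<in> set (expand (i, d, k)) \<and> x \<le> j}"
          and 2: "t \<le> 10 * k + 1 \<and>
         set (out s') = set (out s1) \<union> {(x, j) |x. x \<in> set (expand (i, d, k)) \<and> x \<le> j} \<and>
         mem s' = mem s1 \<and> used s' = used s1 \<and> (\<forall>r. r \<notin> {rI, rK} \<longrightarrow> regs s' r = regs s1 r)"
        have "writer s' p (enc ?xs)"
          by (rule writer_cong[of s1]) (use 1 2 in \<open>auto simp: writing_def\<close>)
        then have "writing s' p ?xs ?A (6 * G)" using 1 2 by (simp add: writing_def)
        then show "?Q (Suc t) s'" unfolding sv' ls rep using 1 2 s by simp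
      qed
    qed
    then show "trm w T (If extends_exp keep_com report_com ;; Assign rR (Bin Add (Reg rR) (Lit 1))) s1
      (\<lambda>t2 s'. Suc (t1 + t2) + 10 * length (surv j (seen j (Suc r))) + 10 * length (seen j r) \<le>
       60 + 10 * length (seen j (Suc r)) + 10 * length (surv j (seen j r)) \<and>
     writing s' p (surv j (seen j (Suc r))) (enc (pals f j)) (6 * G) \<and>
     set (out s') = set (out s) \<union> reported j (expand (enc (pals f j) ! r)) \<and>
     regs s' rN = n \<and> regs s' rJ = j \<and> regs s' rM = regs s rM \<and> regs s' rR = Suc r)"
    proof (rule trm_SeqI)
      fix t2 :: nat and s2 :: state assume 2: "?Q t2 s2"
      have v: "exp_val w (regs s2) (Bin Add (Reg rR) (Lit 1)) = Suc r"
        using 2 W rn by (simp del: exp_val.simps One_nat_def add: exp_eval)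
      let ?s3 = "s2\<lparr>regs := (regs s2)(rR := Suc r)\<rparr>"
      have "writer ?s3 p (enc (surv j (seen j (Suc r))))"
        by (rule writer_cong[of s2]) (use 2 in \<open>auto simp: writing_def\<close>)
      then have "writing ?s3 p (surv j (seen j (Suc r))) ?A (6 * G)"
        using 2 by (simp add: writing_def)
      then show "trm w T (Assign rR (Bin Add (Reg rR) (Lit 1))) s2
        (\<lambda>t3 s'. Suc (t1 + Suc (t2 + t3)) + 10 * length (surv j (seen j (Suc r))) + 10 * length (seen j r) \<le>
       60 + 10 * length (seen j (Suc r)) + 10 * length (surv j (seen j r)) \<and>
     writing s' p (surv j (seen j (Suc r))) (enc (pals f j)) (6 * G) \<and>
     set (out s') = set (out s) \<union> reported j (expand (enc (pals f j) ! r)) \<and>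
     regs s' rN = n \<and> regs s' rJ = j \<and> regs s' rM = regs s rM \<and> regs s' rR = Suc r)"
        using 1 2 by (intro trm_Assign) (unfold v, auto)
    qed
  qed
qed

text \<open>The amortized costs of the groups telescope; \<open>62\<close> is the \<open>60\<close>
  of one group plus the two steps of a loop iteration.\<close>

lemma trm_group_loop:
  assumes wr: "writing s p [] (enc (pals f j)) (6 * G)" and j: "j \<le> n"
    and s: "regs s rN = n" "regs s rJ = j" "regs s rR = 0" "regs s rM = length (enc (pals f j))"
  shows "trm w T (While (Bin Lt (Reg rR) (Reg rM)) group_com) s (\<lambda>t s'.
     t + 10 * length (surv j (pals f j)) \<le> 62 * G + 1 + 10 * length (pals f j) \<and>
     writing s' p (surv j (pals f j)) (enc (pals f j)) (6 * G) \<and>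
     set (out s') = set (out s) \<union> reported j (pals f j) \<and>
     regs s' rN = n \<and> regs s' rJ = j)"
proof -
  let ?A = "enc (pals f j)"
  define I where "I = (\<lambda>t s'. \<exists>r \<le> length ?A.
     t + 10 * length (surv j (seen j r)) \<le> 62 * r + 10 * length (seen j r) \<and>
     writing s' p (surv j (seen j r)) ?A (6 * G) \<and>
     set (out s') = set (out s) \<union> reported j (seen j r) \<and>
     regs s' rN = n \<and> regs s' rJ = j \<and> regs s' rM = length ?A \<and> regs s' rR = r)"
  have W: "64 * n + 128 \<le> 2 ^ w" using word by simp
  have cond: "exp_val w \<rho> (Bin Lt (Reg rR) (Reg rM)) = of_bool (\<rho> rR < \<rho> rM)" for \<rho>
    by (subst exp_Lt) (use W in auto)
  show ?thesis
  proof (rule trm_While[where I = I and ?k0.0 = 0 and \<mu> = "\<lambda>s. regs s rM - regs s rR"])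
    have [simp]: "seen j 0 = []" by (simp add: seen_def)
    show "I 0 s" unfolding I_def
      by (rule exI[of _ 0]) (use wr s in \<open>auto simp: surv_def reported_def\<close>)
  next
    fix t and s1 :: state
    assume "I t s1" and nz: "exp_val w (regs s1) (Bin Lt (Reg rR) (Reg rM)) \<noteq> 0"
    then obtain r where r: "r < length ?A"
      "t + 10 * length (surv j (seen j r)) \<le> 62 * r + 10 * length (seen j r)"
      "writing s1 p (surv j (seen j r)) ?A (6 * G)"
      "set (out s1) = set (out s) \<union> reported j (seen j r)"
      "regs s1 rN = n" "regs s1 rJ = j" "regs s1 rM = length ?A" "regs s1 rR = r"
      unfolding I_def cond by auto
    have rep: "reported j (seen j (Suc r)) = reported j (seen j r) \<union> reported j (expand (?A ! r))"
      unfolding seen_Suc[OF r(1)] reported_def by auto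
    show "trm w T group_com s1 (\<lambda>t' s'. I (t + t' + 2) s' \<and>
        regs s' rM - regs s' rR < regs s1 rM - regs s1 rR)"
    proof (rule trm_mono[OF trm_group[OF r(3) j r(1) r(5,6,8)]], intro conjI)
      fix t' and s' :: state
      assume 2: "t' + 10 * length (surv j (seen j (Suc r))) + 10 * length (seen j r) \<le>
         60 + 10 * length (seen j (Suc r)) + 10 * length (surv j (seen j r)) \<and>
       writing s' p (surv j (seen j (Suc r))) ?A (6 * G) \<and>
       set (out s') = set (out s1) \<union> reported j (expand (?A ! r)) \<and>
       regs s' rN = n \<and> regs s' rJ = j \<and> regs s' rM = regs s1 rM \<and> regs s' rR = Suc r"
      have "t + t' + 2 + 10 * length (surv j (seen j (Suc r))) \<le>
          62 * Suc r + 10 * length (seen j (Suc r))"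
        using conjunct1[OF 2] r(2) by simp
      then show "I (t + t' + 2) s'" unfolding I_def
        by (intro exI[of _ "Suc r"]) (use 2 r rep in auto)
      show "regs s' rM - regs s' rR < regs s1 rM - regs s1 rR" using 2 r by simp
    qed
  next
    fix t and s1 :: state
    assume "I (0 + t) s1" and nz: "exp_val w (regs s1) (Bin Lt (Reg rR) (Reg rM)) = 0"
    then obtain r where r: "r = length ?A"
      "t + 10 * length (surv j (seen j r)) \<le> 62 * r + 10 * length (seen j r)"
      "writing s1 p (surv j (seen j r)) ?A (6 * G)"
      "set (out s1) = set (out s) \<union> reported j (seen j r)"
      "regs s1 rN = n" "regs s1 rJ = j"
      unfolding I_def cond by auto
    have "length ?A \<le> G" using G[of j] j by simp
    then show "Suc t + 10 * length (surv j (pals f j)) \<le> 62 * G + 1 + 10 * length (pals f j) \<and>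
     writing s1 p (surv j (pals f j)) (enc (pals f j)) (6 * G) \<and>
     set (out s1) = set (out s) \<union> reported j (pals f j) \<and>
     regs s1 rN = n \<and> regs s1 rJ = j"
      using r unfolding r(1) seen_all by auto
  qed
qed

end

context word_instance
begin

definition ready :: "state \<Rightarrow> nat \<Rightarrow> bool" where
  "ready s j \<longleftrightarrow> (regs s rP = 0 \<or> regs s rP = 3) \<and> regs s rJ = j \<and> regs s rN = n \<and>
     regs s rM = length (enc (pals f j)) \<and> holds (mem s) (regs s rP) (enc (pals f j)) \<and>
     used s \<le> 6 * G"

text \<open>\<open>10 * length (pals f j)\<close> acts as a potential. The group loop releases
  \<open>10\<close> for each dropped position; the two new suffixes cost \<open>20\<close>, which is
  part of the \<open>100\<close>.\<close>

lemma trm_round: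
  assumes rd: "ready s j" and j: "j \<le> n"
  shows "trm w T round_com s (\<lambda>t s'. ready s' (Suc j) \<and>
    set (out s') = set (out s) \<union> reported j (pals f j) \<and>
    t + 10 * length (pals f (Suc j)) \<le> 62 * G + 100 + 10 * length (pals f j))"
proof -
  let ?A = "enc (pals f j)"
  let ?B = "surv j (pals f j)"
  let ?p = "regs s rP"
  have W: "64 * n + 128 \<le> 2 ^ w" using word by simp
  have W': "(1::nat) < 2 ^ w" "(2::nat) < 2 ^ w" "(3::nat) < 2 ^ w" using W by linarith+
  have p: "?p = 0 \<or> ?p = 3" using rd by (simp add: ready_def)
  have lB: "length ?B \<le> Suc n"
  proof -
    have "length ?B \<le> length (pals f j)" by (simp add: surv_def)
    then show ?thesis using length_pals[of f j] j by linarith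
  qed
  have B1: "length (enc (?B @ [Suc j])) \<le> G" and B2: "length (enc (?B @ [Suc j] @ [Suc (Suc j)])) \<le> G"
    using G[of "Suc j"] j length_enc_mono[of "?B @ [Suc j]" "[Suc (Suc j)]"] by (auto simp: pals_step)
  have lst: "lst ?B \<le> Suc j"
  proof -
    have "x \<le> Suc j" if "x \<in> set ?B" for x using that by (auto simp: surv_def set_pals)
    then show ?thesis by (simp add: lst_def)
  qed
  let ?s4 = "s\<lparr>regs := (regs s)(rR := 0, rW := 0, rG := 1, rL := 0)\<rparr>"
  have wr4: "writing ?s4 ?p [] ?A (6 * G)"
    using rd by (simp add: writing_def writer_def ready_def holds_def lst_def)
  let ?Q = "\<lambda>t s'. ready s' (Suc j) \<and>
    set (out s') = set (out s) \<union> reported j (pals f j) \<and>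
    t + 10 * length (pals f (Suc j)) \<le> 62 * G + 100 + 10 * length (pals f j)"
  have step5: "trm w T (While (Bin Lt (Reg rR) (Reg rM)) group_com ;;
     Assign eA (Bin Add (Reg rJ) (Lit 1)) ;; emit_next_com ;;
     Assign eA (Bin Add (Reg rJ) (Lit 2)) ;; emit_next_com ;;
     Assign rM (Reg rW) ;; Assign rP (Bin Sub (Lit 3) (Reg rP)) ;;
     Assign rJ (Bin Add (Reg rJ) (Lit 1))) ?s4 (\<lambda>t. ?Q (8 + t))"
  proof (rule trm_SeqI[OF trm_group_loop[OF wr4 j]])
    fix t5 :: nat and s5 :: state
    assume 5: "t5 + 10 * length ?B \<le> 62 * G + 1 + 10 * length (pals f j) \<and>
     writing s5 ?p ?B ?A (6 * G) \<and> set (out s5) = set (out ?s4) \<union> reported j (pals f j) \<and>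
     regs s5 rN = n \<and> regs s5 rJ = j"
    let ?s6 = "s5\<lparr>regs := (regs s5)(eA := Suc j)\<rparr>"
    have v6: "exp_val w (regs s5) (Bin Add (Reg rJ) (Lit 1)) = Suc j"
      using 5 W W' j by (simp del: exp_val.simps One_nat_def add: exp_eval)
    have "writer ?s6 ?p (enc ?B)"
      by (rule writer_cong[of s5]) (use 5 in \<open>auto simp: writing_def\<close>)
    then have wr6: "writing ?s6 ?p ?B ?A (6 * G)" using 5 by (simp add: writing_def)
    have e6: "regs ?s6 eA = Suc j" by simp
    have t6: "trm w T emit_next_com ?s6 (\<lambda>k s'. k \<le> 18 \<and> writing s' ?p (?B @ [Suc j]) ?A (6 * G) \<and>
       out s' = out ?s6 \<and> (\<forall>r. r \<notin> {rW, rG, rX, eC, eG, rL} \<longrightarrow> regs s' r = regs ?s6 r))"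
      using trm_emit_next[OF wr6, unfolded e6, of w T] lst B1 lB W j by simp
    show "trm w T (Assign eA (Bin Add (Reg rJ) (Lit 1)) ;; emit_next_com ;;
       Assign eA (Bin Add (Reg rJ) (Lit 2)) ;; emit_next_com ;;
       Assign rM (Reg rW) ;; Assign rP (Bin Sub (Lit 3) (Reg rP)) ;;
       Assign rJ (Bin Add (Reg rJ) (Lit 1))) s5 (\<lambda>t. ?Q (8 + Suc (t5 + t)))"
    proof (rule trm_Seq, rule trm_Assign, unfold v6, rule trm_SeqI[OF t6])
      fix t7 :: nat and s7 :: state
      assume 7: "t7 \<le> 18 \<and> writing s7 ?p (?B @ [Suc j]) ?A (6 * G) \<and>
       out s7 = out ?s6 \<and> (\<forall>r. r \<notin> {rW, rG, rX, eC, eG, rL} \<longrightarrow> regs s7 r = regs ?s6 r)"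
      let ?s8 = "s7\<lparr>regs := (regs s7)(eA := Suc (Suc j))\<rparr>"
      have v8: "exp_val w (regs s7) (Bin Add (Reg rJ) (Lit 2)) = Suc (Suc j)"
        using 5 7 W W' j by (simp del: exp_val.simps One_nat_def add: exp_eval)
      have "writer ?s8 ?p (enc (?B @ [Suc j]))"
        by (rule writer_cong[of s7]) (use 7 in \<open>auto simp: writing_def\<close>)
      then have wr8: "writing ?s8 ?p (?B @ [Suc j]) ?A (6 * G)" using 7 by (simp add: writing_def)
      have e8: "regs ?s8 eA = Suc (Suc j)" by simp
      have t8: "trm w T emit_next_com ?s8 (\<lambda>k s'. k \<le> 18 \<and>
         writing s' ?p (pals f (Suc j)) ?A (6 * G) \<and>
         out s' = out ?s8 \<and> (\<forall>r. r \<notin> {rW, rG, rX, eC, eG, rL} \<longrightarrow> regs s' r = regs ?s8 r))"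
        using trm_emit_next[OF wr8, unfolded e8, of w T] B2 lB W j by (simp add: pals_step)
      show "trm w T (Assign eA (Bin Add (Reg rJ) (Lit 2)) ;; emit_next_com ;;
         Assign rM (Reg rW) ;; Assign rP (Bin Sub (Lit 3) (Reg rP)) ;;
         Assign rJ (Bin Add (Reg rJ) (Lit 1))) s7
         (\<lambda>t. ?Q (8 + Suc (t5 + Suc (1 + Suc (t7 + t)))))"
      proof (rule trm_Seq, rule trm_Assign, unfold v8, rule trm_SeqI[OF t8])
        fix t9 :: nat and s9 :: state
        assume 9: "t9 \<le> 18 \<and> writing s9 ?p (pals f (Suc j)) ?A (6 * G) \<and>
           out s9 = out ?s8 \<and> (\<forall>r. r \<notin> {rW, rG, rX, eC, eG, rL} \<longrightarrow> regs s9 r = regs ?s8 r)"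
        let ?s10 = "s9\<lparr>regs := (regs s9)(rM := length (enc (pals f (Suc j))))\<rparr>"
        let ?s11 = "?s10\<lparr>regs := (regs ?s10)(rP := 3 - ?p)\<rparr>"
        let ?s12 = "?s11\<lparr>regs := (regs ?s11)(rJ := Suc j)\<rparr>"
        have wr9: "regs s9 rW = length (enc (pals f (Suc j)))" "regs s9 rP = ?p"
          "holds (mem s9) (3 - ?p) (enc (pals f (Suc j)))" "used s9 \<le> 6 * G"
          using 9 by (auto simp: writing_def writer_def)
        have r9: "regs s9 rN = n" "regs s9 rJ = j" using 5 7 9 by auto
        have v10: "exp_val w (regs s9) (Reg rW) = length (enc (pals f (Suc j)))" using wr9 by simp
        have v11: "exp_val w (regs ?s10) (Bin Sub (Lit 3) (Reg rP)) = 3 - ?p"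
          using wr9(2) p W' by (auto simp del: exp_val.simps simp: exp_eval)
        have v12: "exp_val w (regs ?s11) (Bin Add (Reg rJ) (Lit 1)) = Suc j"
          using r9 W W' j by (simp del: exp_val.simps One_nat_def add: exp_eval)
        have "ready ?s12 (Suc j)"
          unfolding ready_def using wr9 r9 p by auto
        moreover have "set (out ?s12) = set (out s) \<union> reported j (pals f j)"
          using 5 7 9 by simp
        moreover have "length (pals f (Suc j)) = length ?B + 2" by (simp add: pals_step)
        ultimately show "trm w T (Assign rM (Reg rW) ;; Assign rP (Bin Sub (Lit 3) (Reg rP)) ;;
           Assign rJ (Bin Add (Reg rJ) (Lit 1))) s9
           (\<lambda>t. ?Q (8 + Suc (t5 + Suc (1 + Suc (t7 + Suc (1 + Suc (t9 + t)))))))"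
          apply (rule_tac trm_Seq, rule_tac trm_Assign)
          apply (unfold v10)
          apply (rule_tac trm_Seq, rule_tac trm_Assign)
          apply (unfold v11)
          apply (rule_tac trm_Assign)
          apply (unfold v12)
          using 5 7 9 by (intro conjI) (assumption, assumption, simp)
      qed
    qed
  qed (use rd in \<open>auto simp: ready_def\<close>)
  show ?thesis unfolding round_com_def
    apply (rule trm_Seq, rule trm_Assign, rule trm_Seq, rule trm_Assign,
        rule trm_Seq, rule trm_Assign, rule trm_Seq, rule trm_Assign)
    using step5 W' by (simp del: exp_val.simps One_nat_def add: exp_Lit)
qed

lemma reported_pals:
  assumes "j \<le> n"
  shows "reported j (pals f j) = {(x, y) \<in> maximal_palindromes T. y = j}"
  using assms by (auto simp: reported_def set_pals maximal_palindromes_iff)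

lemma trm_groups:
  assumes s: "regs s rN = n" "used s \<le> 6 * G" "out s = []" and G1: "1 \<le> G"
  shows "trm w T groups_com s (\<lambda>t s'. set (out s') = maximal_palindromes T \<and>
    used s' \<le> 6 * G \<and> t \<le> (62 * G + 102) * (n + 1) + 30)"
proof -
  have W: "64 * n + 128 \<le> 2 ^ w" using word by simp
  have W': "(0::nat) < 2 ^ w" "(1::nat) < 2 ^ w" "(2::nat) < 2 ^ w" using W by linarith+
  \<comment> \<open>\<open>102\<close> is the \<open>100\<close> of one round plus the two steps of
    a loop iteration, and the final \<open>10\<close> is the potential of the one-element list
    \<open>pals f 0\<close>.\<close>
  define I where "I = (\<lambda>t s. \<exists>j \<le> Suc n. ready s j \<and>
     set (out s) = {(x, y) \<in> maximal_palindromes T. y < j} \<and>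
     t + 10 * length (pals f j) \<le> (62 * G + 102) * j + 10)"
  let ?s6 = "s\<lparr>regs := (regs s)(rM := 1, rJ := 0, rP := 0), mem := (mem s)(0 := 1, 1 := 0, 2 := 1),
     used := max (max (max (used s) 1) 2) 3\<rparr>"
  have enc1: "enc [1] = [(1, 0, 1)]"
    using enc_snoc[of "[]" 1] by (simp add: emit_def gap_def lst_def)
  have "ready ?s6 0"
    unfolding ready_def pals_0 enc1 using s G1 by (auto simp: holds_def)
  then have I0: "I 0 ?s6"
    unfolding I_def using s by (intro exI[of _ 0]) (auto simp: pals_0)
  have v: "exp_val w (regs s1) (Bin Lt (Reg rJ) (Bin Add (Reg rN) (Lit 1))) = of_bool (j \<le> n)"
    if "ready s1 j" for s1 j
    using that W W' by (simp del: exp_val.simps One_nat_def add: exp_eval ready_def less_Suc_eq_le)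
  have loop: "trm w T (While (Bin Lt (Reg rJ) (Bin Add (Reg rN) (Lit 1))) round_com) ?s6
    (\<lambda>t s'. set (out s') = maximal_palindromes T \<and> used s' \<le> 6 * G \<and>
       t \<le> (62 * G + 102) * (n + 1) + 11)"
  proof (rule trm_While[where I = I and ?k0.0 = 0 and \<mu> = "\<lambda>s. Suc n - regs s rJ", OF I0])
    fix t and s1 :: state
    assume "I t s1" and nz: "exp_val w (regs s1) (Bin Lt (Reg rJ) (Bin Add (Reg rN) (Lit 1))) \<noteq> 0"
    then obtain j where j: "ready s1 j" "j \<le> n"
      "set (out s1) = {(x, y) \<in> maximal_palindromes T. y < j}"
      "t + 10 * length (pals f j) \<le> (62 * G + 102) * j + 10"
      unfolding I_def using v by auto
    show "trm w T round_com s1 (\<lambda>t' s'. I (t + t' + 2) s' \<and> Suc n - regs s' rJ < Suc n - regs s1 rJ)"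
    proof (rule trm_mono[OF trm_round[OF j(1,2)]])
      fix t' s'
      assume 2: "ready s' (Suc j) \<and> set (out s') = set (out s1) \<union> reported j (pals f j) \<and>
        t' + 10 * length (pals f (Suc j)) \<le> 62 * G + 100 + 10 * length (pals f j)"
      have "set (out s') = {(x, y) \<in> maximal_palindromes T. y < Suc j}"
        using 2 j(3) reported_pals[OF j(2)] by auto
      moreover have "t + t' + 2 + 10 * length (pals f (Suc j)) \<le> (62 * G + 102) * Suc j + 10"
        using 2 j(4) by simp
      ultimately have "I (t + t' + 2) s'" unfolding I_def using 2 j(2) by blast
      moreover have "Suc n - regs s' rJ < Suc n - regs s1 rJ" using 2 j by (simp add: ready_def)
      ultimately show "I (t + t' + 2) s' \<and> Suc n - regs s' rJ < Suc n - regs s1 rJ" by blast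
    qed
  next
    fix t and s1 :: state
    assume "I (0 + t) s1" and nz: "exp_val w (regs s1) (Bin Lt (Reg rJ) (Bin Add (Reg rN) (Lit 1))) = 0"
    then obtain j where j: "ready s1 j" "j \<le> Suc n"
      "set (out s1) = {(x, y) \<in> maximal_palindromes T. y < j}"
      "t + 10 * length (pals f j) \<le> (62 * G + 102) * j + 10"
      unfolding I_def by auto
    have "\<not> j \<le> n" using v[OF j(1)] nz by (cases "j \<le> n") (simp_all del: exp_val.simps)
    then have jn: "j = Suc n" using j(2) by simp
    have "set (out s1) = maximal_palindromes T"
      unfolding j(3) jn by (auto simp: maximal_palindromes_iff less_Suc_eq_le)
    moreover have "used s1 \<le> 6 * G" using j(1) by (simp add: ready_def)
    moreover have "Suc t \<le> (62 * G + 102) * (n + 1) + 11" using j(4) unfolding jn by simp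
    ultimately show "set (out s1) = maximal_palindromes T \<and> used s1 \<le> 6 * G \<and>
       Suc t \<le> (62 * G + 102) * (n + 1) + 11" by blast
  qed
  show ?thesis unfolding groups_com_def
    apply (rule trm_Seq, rule trm_Store[where a = 0], use W' in \<open>simp del: exp_val.simps add: exp_Lit\<close>)
    apply (rule trm_Seq, rule trm_Store[where a = 1],
        use W' in \<open>simp del: exp_val.simps One_nat_def add: exp_Lit\<close>)
    apply (rule trm_Seq, rule trm_Store[where a = 2], use W' in \<open>simp del: exp_val.simps add: exp_Lit\<close>)
    apply (rule trm_Seq, rule trm_Assign, rule trm_Seq, rule trm_Assign, rule trm_Seq, rule trm_Assign)
    apply (rule trm_mono)
     apply (rule back_subst[where P = "\<lambda>s. trm w T _ s _", OF loop])
     apply (use W' in \<open>simp del: exp_val.simps One_nat_def add: exp_Lit\<close>)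
     apply (simp add: max_def)
    done
qed

end

subsection \<open>Naive expansion of centres\<close>

definition scan_com :: com where
  "scan_com = Read rX (Reg rI) ;; Read rY (Reg rD)"

definition grow_com :: com where
  "grow_com = Assign rI (Bin Sub (Reg rI) (Lit 1)) ;; Assign rD (Bin Add (Reg rD) (Lit 1)) ;; scan_com"

definition match_exp :: exp where
  "match_exp = Bin Mul (Bin Lt (Lit 0) (Reg rI))
     (Bin Mul (Bin Lt (Reg rD) (Bin Add (Reg rN) (Lit 1))) (Bin Eq (Reg rX) (Reg rY)))"

text \<open>\<open>rI\<close> and \<open>rD\<close> are the positions just outside the current
  palindrome, and their sum is \<open>rJ\<close>. For even \<open>rJ\<close> they start out equal,
  and the trivial match yields the one-letter palindrome; for odd \<open>rJ\<close> they start as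
  neighbours around the empty one. The final test drops an empty result.\<close>

definition centre_com :: com where
  "centre_com = Assign rI (Bin Div (Reg rJ) (Lit 2)) ;; Assign rD (Bin Sub (Reg rJ) (Reg rI)) ;;
     scan_com ;; While match_exp grow_com ;;
     If (Bin Lt (Bin Add (Reg rI) (Lit 1)) (Reg rD))
       (Report (Bin Add (Reg rI) (Lit 1)) (Bin Sub (Reg rD) (Lit 1))) Skip ;;
     Assign rJ (Bin Add (Reg rJ) (Lit 1))"

definition naive_com :: com where
  "naive_com = Assign rJ (Lit 2) ;;
     While (Bin Lt (Reg rJ) (Bin Add (Bin Mul (Lit 2) (Reg rN)) (Lit 1))) centre_com"

text \<open>The bit length of \<open>n\<close>, found by repeated halving, replaces the logarithm,
  which is not a word operation.\<close>

definition bits_com :: com where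
  "bits_com = Assign rX (Reg rN) ;; Assign rY (Lit 0) ;;
     While (Reg rX) (Assign rX (Bin Div (Reg rX) (Lit 2)) ;; Assign rY (Bin Add (Reg rY) (Lit 1)))"

definition choose_com :: com where
  "choose_com = bits_com ;;
     If (Bin Lt (Reg rN) (Bin Mul (Reg rY) (Reg 1))) naive_com groups_com"

lemma letter_eq_iff:
  assumes "i \<le> e" "1 \<le> e" "i \<le> length T" "e \<le> Suc (length T)"
  shows "letter T i = letter T e \<longleftrightarrow> 0 < i \<and> e \<le> length T \<and> T ! (i - 1) = T ! (e - 1)"
  using assms by (auto simp: letter_def)

text \<open>Palindromes with the same centre are nested. A longer one contains \<open>i\<close> and
  \<open>e\<close> as mirror images and would make their letters equal; a shorter one has its two
  neighbours inside the given palindrome, where they agree, so it is not maximal.\<close>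

lemma maximal_palindrome_at_centre:
  assumes "pal (letter T) (Suc i) (e - 1)" "letter T i \<noteq> letter T e" "i < e" "e \<le> Suc (length T)"
  shows "{(x, y) \<in> maximal_palindromes T. x + y = i + e} = (if Suc i < e then {(Suc i, e - 1)} else {})"
proof -
  have xy: "x = Suc i \<and> y = e - 1" if xy: "(x, y) \<in> maximal_palindromes T" "x + y = i + e" for x y
  proof -
    have m: "1 \<le> x" "x \<le> y" "y \<le> length T" "pal (letter T) x y" "letter T (x - 1) \<noteq> letter T (Suc y)"
      using xy by (auto simp: maximal_palindromes_iff)
    have "\<not> Suc i < x"
    proof
      assume "Suc i < x"
      then have "letter T (x - 1) = letter T (Suc y)"
        using m xy(2) by (intro palD[OF assms(1)]) auto
      then show False using m(5) by simp
    qed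
    moreover have "\<not> x \<le> i"
    proof
      assume "x \<le> i"
      then have "letter T i = letter T e" using xy(2) assms(3) by (intro palD[OF m(4)]) auto
      then show False using assms(2) by simp
    qed
    ultimately show ?thesis using xy(2) by simp
  qed
  let ?C = "{(x, y) \<in> maximal_palindromes T. x + y = i + e}"
  have sub: "p = (Suc i, e - 1)" if "p \<in> ?C" for p using that xy[of "fst p" "snd p"] by (cases p) simp
  have mem: "(Suc i, e - 1) \<in> ?C \<longleftrightarrow> (Suc i, e - 1) \<in> maximal_palindromes T" using assms(3) by simp
  have "?C = (if (Suc i, e - 1) \<in> maximal_palindromes T then {(Suc i, e - 1)} else {})"
  proof (cases "(Suc i, e - 1) \<in> maximal_palindromes T")
    case True
    then have "?C = {(Suc i, e - 1)}" using sub mem by blast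
    then show ?thesis using True by simp
  next
    case False
    then have "?C = {}" using sub mem by blast
    then show ?thesis using False by simp
  qed
  also have "(Suc i, e - 1) \<in> maximal_palindromes T \<longleftrightarrow> Suc i < e"
    using assms by (auto simp: maximal_palindromes_iff)
  finally show ?thesis .
qed

context word_instance
begin

definition window :: "state \<Rightarrow> nat \<Rightarrow> nat \<Rightarrow> bool" where
  "window s i e \<longleftrightarrow> regs s rN = n \<and> regs s rI = i \<and> regs s rD = e \<and>
     (exp_val w (regs s) match_exp \<noteq> 0 \<longleftrightarrow> f i = f e)"

lemma trm_scan:
  assumes s: "regs s rN = n" "regs s rI = i" "regs s rD = e"
    and ie: "i \<le> e" "1 \<le> e" "i \<le> n" "e \<le> Suc n"
  shows "trm w T scan_com s (\<lambda>t s'. t = 3 \<and> window s' i e \<and> regs s' rJ = regs s rJ \<and>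
    out s' = out s \<and> used s' = used s)"
proof -
  let ?x = "if 1 \<le> i \<and> i \<le> n then T ! (i - 1) else 0"
  let ?y = "if 1 \<le> e \<and> e \<le> n then T ! (e - 1) else 0"
  let ?s' = "s\<lparr>regs := (regs s)(rX := ?x, rY := ?y)\<rparr>"
  have W: "64 * n + 128 \<le> 2 ^ w" using word by simp
  have W': "(0::nat) < 2 ^ w" "(1::nat) < 2 ^ w" "n + 1 < 2 ^ w" using W by linarith+
  have "f i = f e \<longleftrightarrow> 0 < i \<and> e \<le> n \<and> ?x = ?y"
    using letter_eq_iff[OF ie] ie by auto
  also have "\<dots> \<longleftrightarrow> exp_val w (regs ?s') match_exp \<noteq> 0"
    unfolding match_exp_def using W' s
    by (simp del: exp_val.simps One_nat_def add: exp_eval less_Suc_eq_le)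
  finally have win: "window ?s' i e" unfolding window_def using s by simp
  show ?thesis unfolding scan_com_def
    apply (rule trm_Seq, rule trm_Read[where i = i], simp add: s)
    apply (rule trm_Read[where i = e], simp add: s)
    using win by (simp add: fun_upd_def)
qed

text \<open>Every growth step lowers \<open>rI\<close> by one. It serves as the termination measure
  and, with weight \<open>12\<close>, as the time potential.\<close>

lemma trm_centre:
  assumes s: "regs s rN = n" "regs s rJ = c" and c: "2 \<le> c" "c \<le> 2 * n"
  shows "trm w T centre_com s (\<lambda>t s'. t \<le> 12 * n + 30 \<and> regs s' rN = n \<and> regs s' rJ = Suc c \<and>
    set (out s') = set (out s) \<union> {(x, y) \<in> maximal_palindromes T. x + y = c} \<and> used s' = used s)"
proof -
  have W: "64 * n + 128 \<le> 2 ^ w" using word by simp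
  have W': "(0::nat) < 2 ^ w" "(1::nat) < 2 ^ w" "(2::nat) < 2 ^ w" "c + 1 < 2 ^ w"
    using W c by linarith+
  define i0 where "i0 = c div 2"
  define e0 where "e0 = c - i0"
  have ie: "1 \<le> i0" "i0 \<le> e0" "e0 \<le> Suc i0" "i0 \<le> n" "e0 \<le> n" "i0 + e0 = c"
    using c unfolding i0_def e0_def by auto
  let ?s1 = "s\<lparr>regs := (regs s)(rI := i0)\<rparr>"
  let ?s2 = "?s1\<lparr>regs := (regs ?s1)(rD := e0)\<rparr>"
  have v1: "exp_val w (regs s) (Bin Div (Reg rJ) (Lit 2)) = i0"
    using s W' by (simp del: exp_val.simps add: exp_eval i0_def)
  have v2: "exp_val w (regs ?s1) (Bin Sub (Reg rJ) (Reg rI)) = e0"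
    using s W' ie by (simp del: exp_val.simps add: exp_eval e0_def)
  define I where "I = (\<lambda>t (s' :: state). \<exists>i e. window s' i e \<and> i \<le> e \<and> i + e = c \<and> i \<le> i0 \<and> e \<le> Suc n \<and>
     pal f (Suc i) (e - 1) \<and> t + 12 * i \<le> 12 * i0 \<and> regs s' rJ = c \<and>
     out s' = out s \<and> used s' = used s)"
  have loop: "trm w T (While match_exp grow_com) s3 (\<lambda>t s'. t \<le> 12 * n + 1 \<and> regs s' rN = n \<and>
      regs s' rJ = c \<and> out s' = out s \<and> used s' = used s \<and>
      (\<exists>i e. regs s' rI = i \<and> regs s' rD = e \<and> i < e \<and> i + e = c \<and> e \<le> Suc n \<and>
        pal f (Suc i) (e - 1) \<and> f i \<noteq> f e))"
    if s3: "window s3 i0 e0" "regs s3 rJ = c" "out s3 = out s" "used s3 = used s" for s3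
  proof (rule trm_While[where I = I and ?k0.0 = 0 and \<mu> = "\<lambda>s. regs s rI"])
    have "pal f (Suc i0) (e0 - 1)" using ie by (auto simp: pal_def)
    then show "I 0 s3" unfolding I_def using s3 ie
      by (intro exI[of _ i0] exI[of _ e0]) simp
  next
    fix t and s4 :: state
    assume "I t s4" and nz: "exp_val w (regs s4) match_exp \<noteq> 0"
    then obtain i e where 4: "window s4 i e" "i \<le> e" "i + e = c" "i \<le> i0" "e \<le> Suc n"
     "pal f (Suc i) (e - 1)" "t + 12 * i \<le> 12 * i0" "regs s4 rJ = c" "out s4 = out s" "used s4 = used s"
      unfolding I_def by blast
    have fe: "f i = f e" using 4(1) nz by (simp add: window_def)
    \<comment> \<open>The left sentinel differs from every letter to its right, and the right one
      from every letter to its left, so equality puts both positions inside the text.\<close>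
    then have i: "0 < i" "e \<le> n" "1 \<le> e" using letter_eq_iff[of i e T] 4 ie c by auto
    have pal: "pal f i e"
    proof (cases "i = e")
      case True
      then show ?thesis by (auto simp: pal_def)
    next
      case False
      then show ?thesis using pal_extend[of "Suc i" "e - 1" f] 4 i fe by simp
    qed
    let ?s5 = "s4\<lparr>regs := (regs s4)(rI := i - 1)\<rparr>"
    let ?s6 = "?s5\<lparr>regs := (regs ?s5)(rD := Suc e)\<rparr>"
    have v5: "exp_val w (regs s4) (Bin Sub (Reg rI) (Lit 1)) = i - 1"
      using 4(1) i W' 4(2,3)
      by (simp del: exp_val.simps One_nat_def add: exp_eval window_def)
    have v6: "exp_val w (regs ?s5) (Bin Add (Reg rD) (Lit 1)) = Suc e"
      using 4(1) i W' 4(2,3)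
      by (simp del: exp_val.simps One_nat_def add: exp_eval window_def)
    have sc: "trm w T scan_com ?s6 (\<lambda>t s'. t = 3 \<and> window s' (i - 1) (Suc e) \<and>
      regs s' rJ = regs ?s6 rJ \<and> out s' = out ?s6 \<and> used s' = used ?s6)"
      using 4 i ie by (intro trm_scan) (auto simp: window_def)
    show "trm w T grow_com s4 (\<lambda>t' s'. I (t + t' + 2) s' \<and> regs s' rI < regs s4 rI)"
      unfolding grow_com_def
    proof (rule trm_Seq, rule trm_Assign, unfold v5, rule trm_Seq, rule trm_Assign, unfold v6,
        rule trm_mono[OF sc])
      fix t' :: nat and s' :: state
      assume 7: "t' = 3 \<and> window s' (i - 1) (Suc e) \<and>
        regs s' rJ = regs ?s6 rJ \<and> out s' = out ?s6 \<and> used s' = used ?s6"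
      have "I (t + Suc (1 + Suc (1 + t')) + 2) s'" unfolding I_def
        using 7 4 i pal by (intro exI[of _ "i - 1"] exI[of _ "Suc e"]) auto
      moreover have "regs s' rI < regs s4 rI" using 7 4(1) i by (simp add: window_def)
      ultimately show "I (t + Suc (1 + Suc (1 + t')) + 2) s' \<and> regs s' rI < regs s4 rI" ..
    qed
  next
    fix t and s4 :: state
    assume "I (0 + t) s4" and z: "exp_val w (regs s4) match_exp = 0"
    then obtain i e where 4: "window s4 i e" "i \<le> e" "i + e = c" "i \<le> i0" "e \<le> Suc n"
     "pal f (Suc i) (e - 1)" "t + 12 * i \<le> 12 * i0" "regs s4 rJ = c" "out s4 = out s" "used s4 = used s"
      unfolding I_def by auto
    have ne: "f i \<noteq> f e" using 4(1) z by (simp add: window_def)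
    then have "i < e" using 4(2) by (cases "i = e") auto
    then show "Suc t \<le> 12 * n + 1 \<and> regs s4 rN = n \<and>
      regs s4 rJ = c \<and> out s4 = out s \<and> used s4 = used s \<and>
      (\<exists>i e. regs s4 rI = i \<and> regs s4 rD = e \<and> i < e \<and> i + e = c \<and> e \<le> Suc n \<and>
        pal f (Suc i) (e - 1) \<and> f i \<noteq> f e)"
      using 4 ne ie by (auto simp: window_def)
  qed
  have sc: "trm w T scan_com ?s2 (\<lambda>t s'. t = 3 \<and> window s' i0 e0 \<and>
      regs s' rJ = regs ?s2 rJ \<and> out s' = out ?s2 \<and> used s' = used ?s2)"
    using s ie by (intro trm_scan) auto
  let ?Q = "\<lambda>t s'. t \<le> 12 * n + 30 \<and> regs s' rN = n \<and> regs s' rJ = Suc c \<and>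
    set (out s') = set (out s) \<union> {(x, y) \<in> maximal_palindromes T. x + y = c} \<and> used s' = used s"
  show ?thesis unfolding centre_com_def
  proof (rule trm_Seq, rule trm_Assign, unfold v1, rule trm_Seq, rule trm_Assign, unfold v2,
      rule trm_SeqI[OF sc])
    fix t3 :: nat and s3 :: state
    assume 3: "t3 = 3 \<and> window s3 i0 e0 \<and>
      regs s3 rJ = regs ?s2 rJ \<and> out s3 = out ?s2 \<and> used s3 = used ?s2"
    have s3: "window s3 i0 e0" "regs s3 rJ = c" "out s3 = out s" "used s3 = used s"
      using 3 s by auto
    show "trm w T (While match_exp grow_com ;;
     If (Bin Lt (Bin Add (Reg rI) (Lit 1)) (Reg rD))
       (Report (Bin Add (Reg rI) (Lit 1)) (Bin Sub (Reg rD) (Lit 1))) Skip ;;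
     Assign rJ (Bin Add (Reg rJ) (Lit 1))) s3 (\<lambda>t. ?Q (Suc (1 + Suc (1 + Suc (t3 + t)))))"
    proof (rule trm_SeqI[OF loop[OF s3]])
      fix t4 :: nat and s4 :: state
      assume "t4 \<le> 12 * n + 1 \<and> regs s4 rN = n \<and>
        regs s4 rJ = c \<and> out s4 = out s \<and> used s4 = used s \<and>
        (\<exists>i e. regs s4 rI = i \<and> regs s4 rD = e \<and> i < e \<and> i + e = c \<and> e \<le> Suc n \<and>
          pal f (Suc i) (e - 1) \<and> f i \<noteq> f e)"
      then obtain i e where 4: "t4 \<le> 12 * n + 1" "regs s4 rN = n" "regs s4 rJ = c"
        "out s4 = out s" "used s4 = used s" "regs s4 rI = i" "regs s4 rD = e" "i < e" "i + e = c"
        "e \<le> Suc n" "pal f (Suc i) (e - 1)" "f i \<noteq> f e" by blast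
      have mx: "{(x, y) \<in> maximal_palindromes T. x + y = c} = (if Suc i < e then {(Suc i, e - 1)} else {})"
        using maximal_palindrome_at_centre[OF 4(11,12,8,10)] 4(9) by simp
      have v: "exp_val w (regs s4) (Bin Add (Reg rI) (Lit 1)) = Suc i"
        "exp_val w (regs s4) (Bin Sub (Reg rD) (Lit 1)) = e - 1"
        "exp_val w (regs s4) (Bin Lt (Bin Add (Reg rI) (Lit 1)) (Reg rD)) = of_bool (Suc i < e)"
        using 4(6-9) W' by (simp_all del: exp_val.simps One_nat_def add: exp_eval)
      have v': "exp_val w (regs s4) (Bin Add (Reg rJ) (Lit 1)) = Suc c"
        using 4(3) W' by (simp del: exp_val.simps One_nat_def add: exp_eval)
      let ?R = "\<lambda>t s'. t \<le> 2 \<and> regs s' = regs s4 \<and> used s' = used s4 \<and>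
        set (out s') = set (out s) \<union> {(x, y) \<in> maximal_palindromes T. x + y = c}"
      have "trm w T (If (Bin Lt (Bin Add (Reg rI) (Lit 1)) (Reg rD))
       (Report (Bin Add (Reg rI) (Lit 1)) (Bin Sub (Reg rD) (Lit 1))) Skip) s4 ?R"
      proof (rule trm_If)
        assume "exp_val w (regs s4) (Bin Lt (Bin Add (Reg rI) (Lit 1)) (Reg rD)) \<noteq> 0"
        then have "Suc i < e" using v(3) by simp
        then show "trm w T (Report (Bin Add (Reg rI) (Lit 1)) (Bin Sub (Reg rD) (Lit 1))) s4
            (\<lambda>t. ?R (Suc t))"
          unfolding mx by (intro trm_Report) (unfold v, simp add: 4(4))
      next
        assume "exp_val w (regs s4) (Bin Lt (Bin Add (Reg rI) (Lit 1)) (Reg rD)) = 0"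
        then have "\<not> Suc i < e" using v(3) by simp
        then show "trm w T Skip s4 (\<lambda>t. ?R (Suc t))"
          unfolding mx by (intro trm_Skip) (simp add: 4(4))
      qed
      then show "trm w T (If (Bin Lt (Bin Add (Reg rI) (Lit 1)) (Reg rD))
       (Report (Bin Add (Reg rI) (Lit 1)) (Bin Sub (Reg rD) (Lit 1))) Skip ;;
       Assign rJ (Bin Add (Reg rJ) (Lit 1))) s4
        (\<lambda>t. ?Q (Suc (1 + Suc (1 + Suc (t3 + Suc (t4 + t))))))"
      proof (rule trm_SeqI)
        fix t5 :: nat and s5 :: state
        assume 5: "?R t5 s5"
        then have r5: "regs s5 = regs s4" by blast
        show "trm w T (Assign rJ (Bin Add (Reg rJ) (Lit 1))) s5
          (\<lambda>t. ?Q (Suc (1 + Suc (1 + Suc (t3 + Suc (t4 + Suc (t5 + t)))))))"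
          by (rule trm_Assign) (unfold r5 v', use 3 4 5 in simp)
      qed
    qed
  qed
qed

lemma trm_naive:
  assumes s: "regs s rN = n" "used s = 0" "out s = []" and n: "1 \<le> n"
  shows "trm w T naive_com s (\<lambda>t s'. set (out s') = maximal_palindromes T \<and> used s' = 0 \<and>
    t \<le> (12 * n + 32) * (2 * n) + 3)"
proof -
  have W: "64 * n + 128 \<le> 2 ^ w" using word by simp
  have W': "(1::nat) < 2 ^ w" "(2::nat) < 2 ^ w" "2 * n + 1 < 2 ^ w" using W by linarith+
  have cond: "exp_val w (regs s1) (Bin Lt (Reg rJ) (Bin Add (Bin Mul (Lit 2) (Reg rN)) (Lit 1))) =
      of_bool (c \<le> 2 * n)" if "regs s1 rN = n" "regs s1 rJ = c" for s1 :: state and c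
    using that W' by (simp del: exp_val.simps One_nat_def add: exp_eval less_Suc_eq_le)
  define I where "I = (\<lambda>t (s' :: state). \<exists>c. regs s' rN = n \<and> regs s' rJ = c \<and> used s' = 0 \<and> 2 \<le> c \<and>
     c \<le> 2 * n + 1 \<and> set (out s') = {(x, y) \<in> maximal_palindromes T. x + y < c} \<and>
     t \<le> (12 * n + 32) * (c - 2))"
  let ?s1 = "s\<lparr>regs := (regs s)(rJ := 2)\<rparr>"
  have "trm w T (While (Bin Lt (Reg rJ) (Bin Add (Bin Mul (Lit 2) (Reg rN)) (Lit 1))) centre_com) ?s1
    (\<lambda>t s'. set (out s') = maximal_palindromes T \<and> used s' = 0 \<and> t \<le> (12 * n + 32) * (2 * n) + 1)"
  proof (rule trm_While[where I = I and ?k0.0 = 0 and \<mu> = "\<lambda>s. 2 * n + 1 - regs s rJ"])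
    show "I 0 ?s1" unfolding I_def using s n by (auto simp: maximal_palindromes_iff)
  next
    fix t and s2 :: state
    assume "I t s2"
      and nz: "exp_val w (regs s2) (Bin Lt (Reg rJ) (Bin Add (Bin Mul (Lit 2) (Reg rN)) (Lit 1))) \<noteq> 0"
    then obtain c where c: "regs s2 rN = n" "regs s2 rJ = c" "used s2 = 0" "2 \<le> c"
      "set (out s2) = {(x, y) \<in> maximal_palindromes T. x + y < c}" "t \<le> (12 * n + 32) * (c - 2)"
      unfolding I_def by blast
    have cn: "c \<le> 2 * n" using nz unfolding cond[OF c(1,2)] by simp
    show "trm w T centre_com s2 (\<lambda>t' s'. I (t + t' + 2) s' \<and>
        2 * n + 1 - regs s' rJ < 2 * n + 1 - regs s2 rJ)"
    proof (rule trm_mono[OF trm_centre[OF c(1,2,4) cn]])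
      fix t' :: nat and s' :: state
      assume 3: "t' \<le> 12 * n + 30 \<and> regs s' rN = n \<and> regs s' rJ = Suc c \<and>
        set (out s') = set (out s2) \<union> {(x, y) \<in> maximal_palindromes T. x + y = c} \<and> used s' = used s2"
      have "set (out s') = {(x, y) \<in> maximal_palindromes T. x + y < Suc c}"
        using 3 c(5) by auto
      moreover have "t + t' + 2 \<le> (12 * n + 32) * (Suc c - 2)"
      proof -
        have "Suc c - 2 = Suc (c - 2)" using c(4) by simp
        then show ?thesis using 3 c(6) by simp
      qed
      ultimately have "I (t + t' + 2) s'" unfolding I_def using 3 c cn by auto
      then show "I (t + t' + 2) s' \<and> 2 * n + 1 - regs s' rJ < 2 * n + 1 - regs s2 rJ"
        using 3 c cn by simp
    qed
  next
    fix t and s2 :: state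
    assume "I (0 + t) s2"
      and z: "exp_val w (regs s2) (Bin Lt (Reg rJ) (Bin Add (Bin Mul (Lit 2) (Reg rN)) (Lit 1))) = 0"
    then obtain c where c: "regs s2 rN = n" "regs s2 rJ = c" "used s2 = 0" "c \<le> 2 * n + 1"
      "set (out s2) = {(x, y) \<in> maximal_palindromes T. x + y < c}" "t \<le> (12 * n + 32) * (c - 2)"
      unfolding I_def by auto
    have "c = 2 * n + 1" using z c(4) unfolding cond[OF c(1,2)] by simp
    then have "set (out s2) = maximal_palindromes T"
      unfolding c(5) by (auto simp: maximal_palindromes_iff)
    moreover have "(12 * n + 32) * (c - 2) \<le> (12 * n + 32) * (2 * n)"
      using \<open>c = 2 * n + 1\<close> by (intro mult_le_mono2) simp
    then have "Suc t \<le> (12 * n + 32) * (2 * n) + 1" using c(6) by linarith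
    ultimately show "set (out s2) = maximal_palindromes T \<and> used s2 = 0 \<and>
        Suc t \<le> (12 * n + 32) * (2 * n) + 1"
      using c(3) by blast
  qed
  then show ?thesis unfolding naive_com_def
    apply (rule_tac trm_Seq, rule_tac trm_Assign)
    apply (rule trm_mono)
    using W' by (simp_all del: exp_val.simps add: exp_Lit)
qed

section \<open>Choosing the program by the bit length\<close>

lemma trm_bits:
  assumes s: "regs s rN = n"
  shows "\<exists>L. n < 2 ^ L \<and> (L = 0 \<or> 2 ^ (L - 1) \<le> n) \<and>
    trm w T bits_com s (\<lambda>t s'. t \<le> 5 * L + 5 \<and> regs s' rY = L \<and> regs s' rN = n \<and>
      regs s' 1 = regs s 1 \<and> out s' = out s \<and> used s' = used s)"
proof -
  define L where "L = (LEAST L. n < 2 ^ L)"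
  have ex: "n < 2 ^ n" by (rule less_exp)
  have L1: "n < 2 ^ L" unfolding L_def using ex by (rule LeastI)
  have L2: "2 ^ m \<le> n" if "m < L" for m using not_less_Least[of m "\<lambda>L. n < 2 ^ L"] that
    unfolding L_def by simp
  have Ln: "L \<le> n" unfolding L_def using ex by (rule Least_le)
  have W: "64 * n + 128 \<le> 2 ^ w" using word by simp
  have W': "(0::nat) < 2 ^ w" "(1::nat) < 2 ^ w" "(2::nat) < 2 ^ w" "n + 1 < 2 ^ w"
    using W by linarith+
  define I where "I = (\<lambda>t (s' :: state). \<exists>m \<le> L. regs s' rX = n div 2 ^ m \<and> regs s' rY = m \<and> t \<le> 5 * m \<and>
     regs s' rN = n \<and> regs s' 1 = regs s 1 \<and> out s' = out s \<and> used s' = used s)"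
  let ?s2 = "s\<lparr>regs := (regs s)(rX := n, rY := 0)\<rparr>"
  have "trm w T (While (Reg rX) (Assign rX (Bin Div (Reg rX) (Lit 2)) ;;
      Assign rY (Bin Add (Reg rY) (Lit 1)))) ?s2
    (\<lambda>t s'. t \<le> 5 * L + 1 \<and> regs s' rY = L \<and> regs s' rN = n \<and>
      regs s' 1 = regs s 1 \<and> out s' = out s \<and> used s' = used s)"
  proof (rule trm_While[where I = I and ?k0.0 = 0 and \<mu> = "\<lambda>s. regs s rX"])
    show "I 0 ?s2" unfolding I_def using s by (intro exI[of _ 0]) simp
  next
    fix t and s3 :: state
    assume "I t s3" and nz: "exp_val w (regs s3) (Reg rX) \<noteq> 0"
    then obtain m where m: "m \<le> L" "regs s3 rX = n div 2 ^ m" "regs s3 rY = m" "t \<le> 5 * m"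
      "regs s3 rN = n" "regs s3 1 = regs s 1" "out s3 = out s" "used s3 = used s"
      unfolding I_def by blast
    have pos: "0 < n div 2 ^ m" using nz m(2) by simp
    then have "m \<noteq> L" using L1 by (auto simp: div_less)
    then have mL: "Suc m \<le> L" using m(1) by simp
    let ?s4 = "s3\<lparr>regs := (regs s3)(rX := n div 2 ^ Suc m)\<rparr>"
    have half: "n div 2 ^ Suc m = n div 2 ^ m div 2" by (simp only: power_Suc2 div_mult2_eq)
    have v3: "exp_val w (regs s3) (Bin Div (Reg rX) (Lit 2)) = n div 2 ^ Suc m"
      unfolding half using m(2) W' by (simp del: exp_val.simps add: exp_eval)
    have v4: "exp_val w (regs ?s4) (Bin Add (Reg rY) (Lit 1)) = Suc m"
      using m(1,3) W' Ln by (simp del: exp_val.simps One_nat_def add: exp_eval)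
    have dec: "n div 2 ^ Suc m < n div 2 ^ m"
      unfolding half using pos by simp
    show "trm w T (Assign rX (Bin Div (Reg rX) (Lit 2)) ;; Assign rY (Bin Add (Reg rY) (Lit 1))) s3
      (\<lambda>t' s'. I (t + t' + 2) s' \<and> regs s' rX < regs s3 rX)"
      apply (rule trm_Seq, rule trm_Assign)
      apply (unfold v3)
      apply (rule trm_Assign)
      apply (unfold v4 I_def)
      using mL m dec by (intro conjI exI[of _ "Suc m"]) simp_all
  next
    fix t and s3 :: state
    assume "I (0 + t) s3" and z: "exp_val w (regs s3) (Reg rX) = 0"
    then obtain m where m: "m \<le> L" "regs s3 rX = n div 2 ^ m" "regs s3 rY = m" "t \<le> 5 * m"
      "regs s3 rN = n" "regs s3 1 = regs s 1" "out s3 = out s" "used s3 = used s"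
      unfolding I_def by auto
    have "n < 2 ^ m" using z m(2) by (simp add: div_eq_0_iff)
    then have "m = L" using L2[of m] m(1) by (cases "m = L") auto
    then show "Suc t \<le> 5 * L + 1 \<and> regs s3 rY = L \<and> regs s3 rN = n \<and>
      regs s3 1 = regs s 1 \<and> out s3 = out s \<and> used s3 = used s"
      using m by simp
  qed
  then have "trm w T bits_com s (\<lambda>t s'. t \<le> 5 * L + 5 \<and> regs s' rY = L \<and> regs s' rN = n \<and>
      regs s' 1 = regs s 1 \<and> out s' = out s \<and> used s' = used s)"
    unfolding bits_com_def
    apply (rule_tac trm_Seq, rule_tac trm_Assign, rule_tac trm_Seq, rule_tac trm_Assign)
    apply (rule trm_mono)
    using W' s by (simp_all del: exp_val.simps add: exp_Lit exp_Reg)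
  then show ?thesis using L1 L2[of "L - 1"] by (cases "L = 0") auto
qed

text \<open>In each branch the outcome of the test supplies the missing bound:
  \<open>n < L * \<tau>\<close> turns quadratic time into \<open>n * \<tau> * L\<close>, and
  \<open>L * \<tau> \<le> n\<close> turns the space \<open>6 * G \<le> 48 * L\<close> into
  \<open>48 * n div \<tau>\<close>.\<close>

lemma trm_choose:
  assumes s: "regs s rN = n" "regs s 1 = \<tau>" "used s = 0" "out s = []"
    and \<tau>: "1 \<le> \<tau>" "\<tau> \<le> n" and G1: "1 \<le> G" and nn: "n * (n + 1) < 2 ^ w"
    and GL: "\<And>L. n < 2 ^ L \<Longrightarrow> G \<le> 2 * L + 6"
  shows "\<exists>L. 2 ^ (L - 1) \<le> n \<and> trm w T choose_com s (\<lambda>t s'. set (out s') = maximal_palindromes T \<and>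
    used s' \<le> 48 * n div \<tau> \<and> t \<le> 1500 * (n * \<tau> * L))"
proof -
  obtain L where L: "n < 2 ^ L" "L = 0 \<or> 2 ^ (L - 1) \<le> n" and tb:
    "trm w T bits_com s (\<lambda>t s'. t \<le> 5 * L + 5 \<and> regs s' rY = L \<and> regs s' rN = n \<and>
      regs s' 1 = regs s 1 \<and> out s' = out s \<and> used s' = used s)"
    using trm_bits[OF s(1)] by blast
  have L0: "L \<noteq> 0" using L(1) \<tau> by (cases L) auto
  then have L2: "2 ^ (L - 1) \<le> n" and L1: "1 \<le> L" using L by auto
  have "L - 1 < 2 ^ (L - 1)" by (rule less_exp)
  then have Ln: "L \<le> n" using L2 by linarith
  \<comment> \<open>The product in the test must not wrap around.\<close>
  have "L * \<tau> \<le> n * n" using Ln \<tau> by (intro mult_le_mono) auto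
  then have W': "L * \<tau> < 2 ^ w" "(1::nat) < 2 ^ w" using nn word by auto
  have GL': "G \<le> 8 * L" using GL[OF L(1)] L1 by simp
  have nL: "1 \<le> n * L" "n \<le> n * L" "L \<le> n * L" using L1 \<tau> by auto
  have nTL: "n * L \<le> n * \<tau> * L" using \<tau> by simp
  let ?Q = "\<lambda>t s'. set (out s') = maximal_palindromes T \<and>
    used s' \<le> 48 * n div \<tau> \<and> t \<le> 1500 * (n * \<tau> * L)"
  have "trm w T choose_com s ?Q" unfolding choose_com_def
  proof (rule trm_SeqI[OF tb])
    fix t1 :: nat and s1 :: state
    assume 1: "t1 \<le> 5 * L + 5 \<and> regs s1 rY = L \<and> regs s1 rN = n \<and>
      regs s1 1 = regs s 1 \<and> out s1 = out s \<and> used s1 = used s"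
    have t1: "t1 \<le> 5 * L + 5" using 1 by blast
    have c: "exp_val w (regs s1) (Bin Lt (Reg rN) (Bin Mul (Reg rY) (Reg 1))) = of_bool (n < L * \<tau>)"
      using 1 s W' by (simp del: exp_val.simps One_nat_def add: exp_eval)
    show "trm w T (If (Bin Lt (Reg rN) (Bin Mul (Reg rY) (Reg 1))) naive_com groups_com) s1
      (\<lambda>t. ?Q (Suc (t1 + t)))"
    proof (rule trm_If; unfold c of_bool_eq_0_iff not_not)
      assume big: "n < L * \<tau>"
      have "n * n \<le> n * (L * \<tau>)" using big by (intro mult_le_mono2) simp
      then have nn: "n * n \<le> n * \<tau> * L" by (simp add: mult_ac)
      have "(12 * n + 32) * (2 * n) = 24 * (n * n) + 64 * n" by (simp add: algebra_simps)
      then have T: "Suc (Suc (5 * L + 5 + ((12 * n + 32) * (2 * n) + 3))) \<le> 1500 * (n * \<tau> * L)"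
        using nn nL nTL by linarith
      have "trm w T naive_com s1 (\<lambda>t s'. set (out s') = maximal_palindromes T \<and> used s' = 0 \<and>
        t \<le> (12 * n + 32) * (2 * n) + 3)"
        using 1 s \<tau> by (intro trm_naive) auto
      then show "trm w T naive_com s1 (\<lambda>t. ?Q (Suc (t1 + Suc t)))"
        by (rule trm_mono) (use t1 T in auto)
    next
      assume small: "\<not> n < L * \<tau>"
      have "6 * G * \<tau> \<le> 48 * (L * \<tau>)" using GL' by (simp add: mult_le_mono1)
      also have "\<dots> \<le> 48 * n" using small by simp
      finally have U: "6 * G \<le> 48 * n div \<tau>" using \<tau> by (simp add: less_eq_div_iff_mult_less_eq)
      \<comment> \<open>\<open>598 = 62 * 8 + 102\<close>, by \<open>G \<le> 8 * L\<close> and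
        \<open>1 \<le> L\<close>.\<close>
      have "(62 * G + 102) * (n + 1) \<le> (598 * L) * (2 * n)"
        using GL' L1 \<tau> by (intro mult_le_mono) auto
      also have "\<dots> = 1196 * (n * L)" by simp
      finally have T: "Suc (Suc (5 * L + 5 + ((62 * G + 102) * (n + 1) + 30))) \<le> 1500 * (n * \<tau> * L)"
        using nL nTL by linarith
      have "trm w T groups_com s1 (\<lambda>t s'. set (out s') = maximal_palindromes T \<and>
        used s' \<le> 6 * G \<and> t \<le> (62 * G + 102) * (n + 1) + 30)"
        using 1 s G1 by (intro trm_groups) auto
      then show "trm w T groups_com s1 (\<lambda>t. ?Q (Suc (t1 + Suc t)))"
        by (rule trm_mono) (use t1 T U in auto)
    qed
  qed
  then show ?thesis using L2 by blast
qed

end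

section \<open>Word size and asymptotic bounds\<close>

lemma deterministic_groups: "deterministic groups_com"
  by (simp add: groups_com_def round_com_def group_com_def fetch_com_def keep_com_def
      report_com_def emit_next_com_def emit_rest_com_def emit_com_def)

lemma deterministic_choose: "deterministic choose_com"
  by (simp add: choose_com_def deterministic_groups bits_com_def naive_com_def centre_com_def
      grow_com_def scan_com_def)

lemma valid_instance_word:
  assumes "valid_instance K w T \<tau>"
  shows "(length T + 1) ^ K \<le> 2 ^ w"
proof -
  let ?m = "real (length T) + 1"
  have "log 2 (?m ^ K) \<le> real w"
    using assms by (simp add: valid_instance_def log_nat_power)
  then have "?m ^ K \<le> 2 powr real w" by (subst (asm) log_le_iff) auto
  then have "real ((length T + 1) ^ K) \<le> real (2 ^ w)" by (simp add: powr_realpow add.commute)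
  then show ?thesis by (simp only: of_nat_le_iff)
qed

text \<open>This is the origin of \<open>K = 8\<close>: six of the eight factors
  \<open>n + 1 \<ge> 2\<close> provide the constant \<open>64\<close>, and the other two keep
  \<open>n * (n + 1)\<close> within a word. For \<open>G\<close>, the estimate
  \<open>j + 2 \<le> n + 3 \<le> 4 * n\<close> is inserted into
  \<open>length_enc_pals\<close>.\<close>

lemma word_instance_exists:
  assumes "valid_instance 8 w T \<tau>"
  shows "\<exists>G. word_instance w T G \<and> 1 \<le> G \<and> 2 ^ G \<le> 64 * (length T)\<^sup>2 \<and>
    length T * (length T + 1) < 2 ^ w"
proof -
  let ?n = "length T"
  have n: "1 \<le> ?n" using assms by (simp add: valid_instance_def)
  define G where "G = Max ((\<lambda>j. length (enc (pals (letter T) j))) ` {..Suc ?n})"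
  have G: "length (enc (pals (letter T) j)) \<le> G" if "j \<le> Suc ?n" for j
    unfolding G_def using that by (intro Max_ge) auto
  have "G \<in> (\<lambda>j. length (enc (pals (letter T) j))) ` {..Suc ?n}" unfolding G_def by (rule Max_in) auto
  then obtain j where j: "j \<le> Suc ?n" "G = length (enc (pals (letter T) j))" by auto
  have "2 ^ G \<le> 4 * (j + 2)\<^sup>2" unfolding j(2) by (rule length_enc_pals)
  also have "\<dots> \<le> 4 * (4 * ?n)\<^sup>2" using j(1) n by (intro mult_le_mono2 power_mono) auto
  also have "\<dots> = 64 * ?n\<^sup>2" by (simp add: power_mult_distrib)
  finally have G2: "2 ^ G \<le> 64 * ?n\<^sup>2" .
  have "0 < length (enc (pals (letter T) 0))"
    unfolding length_greater_0_conv enc_eq_Nil_iff pals_0 by simp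
  then have G1: "1 \<le> G" using G[of 0] by linarith
  have "(2::nat) ^ 6 \<le> (?n + 1) ^ 6" using n by (intro power_mono) auto
  then have p6: "64 \<le> (?n + 1) ^ 6" by simp
  have e8: "m ^ 8 = m ^ 6 * (m * m)" for m :: nat by (simp add: eval_nat_numeral mult_ac)
  have "64 * ((?n + 1) * (?n + 1)) \<le> (?n + 1) ^ 6 * ((?n + 1) * (?n + 1))"
    using p6 by (rule mult_le_mono1)
  also have "\<dots> = (?n + 1) ^ 8" by (rule e8[symmetric])
  also have "\<dots> \<le> 2 ^ w" using valid_instance_word[OF assms] .
  finally have W: "64 * ((?n + 1) * (?n + 1)) \<le> 2 ^ w" .
  have "?n + 2 \<le> (?n + 1) * (?n + 1)" using n by simp
  then have W1: "64 * (?n + 2) \<le> 2 ^ w" by (rule order.trans[OF mult_le_mono2 W])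
  have "?n * (?n + 1) < 64 * ((?n + 1) * (?n + 1))" by simp
  then have "?n * (?n + 1) < 2 ^ w" using W by (rule less_le_trans)
  then show ?thesis using G G1 G2 W1 by (intro exI[of _ G]) (auto intro!: word_instance.intro)
qed

text \<open>From \<open>ln (sqrt x) \<le> sqrt x\<close> and \<open>ln 2 \<ge> 1 / 2\<close>. It
  brings the logarithmic number of groups under the bounds of part (i).\<close>

lemma log2_le_sqrt: "1 \<le> x \<Longrightarrow> log 2 x \<le> 4 * sqrt x"
proof -
  assume x: "1 \<le> x"
  have l2: "1 / 2 \<le> ln (2::real)" using ln2_ge_two_thirds by simp
  have "ln (sqrt x) \<le> sqrt x" using x by (intro ln_bound) auto
  then have "ln x \<le> 2 * sqrt x" using x by (simp add: ln_sqrt)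
  also have "\<dots> \<le> 4 * sqrt x * ln 2" using l2 x mult_left_mono[OF l2, of "4 * sqrt x"] by simp
  finally show ?thesis using l2 by (simp add: log_def field_simps)
qed

theorem theorem3:
  "(\<exists>P K C. deterministic P \<and>
      (\<forall>w T \<tau> n. valid_instance K w T \<tau> \<and> n = real (length T) \<longrightarrow>
         solves_palindromes P w T \<tau> \<and>
         space_within P w T \<tau> (C * (n / sqrt (real \<tau>))) \<and>
         halt_prob P w T \<tau> (C * (n\<^sup>2 / sqrt (real \<tau>) + n * real \<tau>)) = 1)) \<and>
   (\<exists>P K C.
      (\<forall>w T \<tau> n. valid_instance K w T \<tau> \<and> n = real (length T) \<longrightarrow>
         solves_palindromes P w T \<tau> \<and>
         space_within P w T \<tau> (C * (n / real \<tau>))) \<and>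
      (\<forall>c > 0. \<exists>C'. \<forall>w T \<tau> n. valid_instance K w T \<tau> \<and> n = real (length T) \<longrightarrow>
         halt_prob P w T \<tau> (C' * (n * real \<tau> * log 2 n)) \<ge> 1 - 1 / n powr c))"
proof (rule conjI)
  define r1 r2 where "r1 = real (card (com_regs groups_com))" and "r2 = real (card (com_regs choose_com))"
  have r: "0 \<le> r1" "0 \<le> r2" by (auto simp: r1_def r2_def)
  have part1: "solves_palindromes groups_com w T \<tau> \<and>
         space_within groups_com w T \<tau> ((r1 + 2000) * (n / sqrt (real \<tau>))) \<and>
         halt_prob groups_com w T \<tau> ((r1 + 2000) * (n\<^sup>2 / sqrt (real \<tau>) + n * real \<tau>)) = 1"
    if v: "valid_instance 8 w T \<tau>" and n_def: "n = real (length T)" for w T \<tau> n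
  proof -
    have \<tau>: "1 \<le> \<tau>" "\<tau> \<le> length T" using v by (auto simp: valid_instance_def)
    then have n: "1 \<le> n" "real \<tau> \<le> n" by (auto simp: n_def)
    obtain G where wi: "word_instance w T G" and G: "1 \<le> G" "2 ^ G \<le> 64 * (length T)\<^sup>2"
      using word_instance_exists[OF v] by blast
    have "trm w T groups_com (init_state T \<tau>) (\<lambda>t s'. set (out s') = maximal_palindromes T \<and>
        used s' \<le> 6 * G \<and> t \<le> (62 * G + 102) * (length T + 1) + 30)"
      using G by (intro word_instance.trm_groups[OF wi]) (auto simp: init_state_def)
    note sol = trm_solves[OF deterministic_groups this]
    define S where "S = n / sqrt (real \<tau>)"
    \<comment> \<open>Here \<tau> \<le> n enters: it makes \<open>S\<close> at least
      \<open>sqrt n\<close>.\<close>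
    have "sqrt n * sqrt (real \<tau>) \<le> sqrt n * sqrt n" using n by (intro mult_left_mono) auto
    then have S: "sqrt n \<le> S" using n \<tau> unfolding S_def by (simp add: field_simps)
    have S1: "1 \<le> S" using S n real_sqrt_ge_one[of n] by linarith
    \<comment> \<open>\<open>14 = 6 + 8\<close>: the \<open>6\<close> is the binary logarithm of
      \<open>64\<close>, and the \<open>8\<close> comes from \<open>log2_le_sqrt\<close>, applied to
      the square.\<close>
    have "real G \<le> 14 * sqrt n"
    proof -
      have "real (2 ^ G) \<le> real (64 * (length T)\<^sup>2)" using G(2) by (simp only: of_nat_le_iff)
      then have "(2::real) ^ G \<le> 2 ^ 6 * n\<^sup>2" by (simp add: n_def)
      then have "log 2 (2 ^ G) \<le> log 2 (2 ^ 6 * n\<^sup>2)" using n by (subst log_le_cancel_iff) auto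
      also have "\<dots> = log 2 (2 ^ 6) + 2 * log 2 n"
        using n by (simp add: log_mult log_nat_power del: power_numeral)
      also have "\<dots> = 6 + 2 * log 2 n" by (subst log_nat_power) auto
      also have "\<dots> \<le> 6 + 8 * sqrt n" using log2_le_sqrt[OF n(1)] n by auto
      also have "\<dots> \<le> 14 * sqrt n" using n by simp
      finally show ?thesis by (simp add: log_nat_power)
    qed
    then have GS: "real G \<le> 14 * S" using S by simp
    have "real (card (com_regs groups_com) + 6 * G) \<le> r1 + 84 * S" using GS by (simp add: r1_def)
    also have "\<dots> \<le> (r1 + 2000) * S" using S1 r mult_left_mono[of 1 S r1] by (simp add: algebra_simps)
    finally have sp: "space_within groups_com w T \<tau> ((r1 + 2000) * S)" by (rule sol(2))
    have nS: "1 \<le> n * S" "n \<le> n * S" using n S1 mult_mono[of 1 n 1 S] by auto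
    have "real ((62 * G + 102) * (length T + 1) + 30) = (62 * real G + 102) * (n + 1) + 30"
      by (simp add: n_def algebra_simps)
    \<comment> \<open>\<open>970 = 62 * 14 + 102\<close>, by \<open>G \<le> 14 * S\<close> and
      \<open>1 \<le> S\<close>.\<close>
    also have "\<dots> \<le> (970 * S) * (2 * n) + 30 * (n * S)"
    proof (rule add_mono)
      show "(62 * real G + 102) * (n + 1) \<le> (970 * S) * (2 * n)"
        using GS S1 n by (intro mult_mono) auto
      show "30 \<le> 30 * (n * S)" using nS(1) by linarith
    qed
    also have "\<dots> = 1970 * (n * S)" by (simp add: algebra_simps)
    also have "\<dots> \<le> (r1 + 2000) * (n * S)" using nS r by (intro mult_right_mono) auto
    also have "\<dots> \<le> (r1 + 2000) * (n * S + n * real \<tau>)" using r n by (intro mult_left_mono) auto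
    also have "n * S = n\<^sup>2 / sqrt (real \<tau>)" by (simp add: S_def power2_eq_square)
    finally have "halt_prob groups_com w T \<tau> ((r1 + 2000) * (n\<^sup>2 / sqrt (real \<tau>) + n * real \<tau>)) = 1"
      by (rule sol(3))
    then show ?thesis using sol(1) sp unfolding S_def by blast
  qed
  show "\<exists>P K C. deterministic P \<and>
      (\<forall>w T \<tau> n. valid_instance K w T \<tau> \<and> n = real (length T) \<longrightarrow>
         solves_palindromes P w T \<tau> \<and>
         space_within P w T \<tau> (C * (n / sqrt (real \<tau>))) \<and>
         halt_prob P w T \<tau> (C * (n\<^sup>2 / sqrt (real \<tau>) + n * real \<tau>)) = 1)"
    by (rule exI[of _ groups_com], rule exI[of _ 8], rule exI[of _ "r1 + 2000"],
        rule conjI[OF deterministic_groups], intro allI impI, elim conjE, rule part1)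
  have part2: "solves_palindromes choose_com w T \<tau> \<and>
         space_within choose_com w T \<tau> ((r2 + 48) * (n / real \<tau>)) \<and>
         (2 \<le> n \<longrightarrow> halt_prob choose_com w T \<tau> (3000 * (n * real \<tau> * log 2 n)) = 1)"
    if v: "valid_instance 8 w T \<tau>" and n_def: "n = real (length T)" for w T \<tau> n
  proof -
    have \<tau>: "1 \<le> \<tau>" "\<tau> \<le> length T" using v by (auto simp: valid_instance_def)
    then have n: "1 \<le> n" "real \<tau> \<le> n" by (auto simp: n_def)
    obtain G where wi: "word_instance w T G" and G: "1 \<le> G" "2 ^ G \<le> 64 * (length T)\<^sup>2"
      and nn: "length T * (length T + 1) < 2 ^ w"
      using word_instance_exists[OF v] by blast
    \<comment> \<open>The \<open>6\<close> is the exponent of \<open>64 = 2 ^ 6\<close>, and the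
      square of \<open>n < 2 ^ L\<close> contributes \<open>2 * L\<close>.\<close>
    have GL: "G \<le> 2 * L + 6" if "length T < 2 ^ L" for L
    proof -
      have "(length T)\<^sup>2 \<le> (2 ^ L)\<^sup>2" using that by (intro power_mono) auto
      then have "2 ^ G \<le> 64 * ((2::nat) ^ L)\<^sup>2" using G(2) by linarith
      also have "\<dots> = (2::nat) ^ (2 * L + 6)" by (simp add: power_add power_even_eq)
      finally show ?thesis by (simp add: power_increasing_iff)
    qed
    obtain L where L: "2 ^ (L - 1) \<le> length T" and "trm w T choose_com (init_state T \<tau>)
      (\<lambda>t s'. set (out s') = maximal_palindromes T \<and>
      used s' \<le> 48 * length T div \<tau> \<and> t \<le> 1500 * (length T * \<tau> * L))"
      using word_instance.trm_choose[OF wi, of "init_state T \<tau>" \<tau>] G nn GL \<tau>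
      by (auto simp: init_state_def)
    note sol = trm_solves[OF deterministic_choose this(2)]
    have "real (48 * length T div \<tau>) \<le> real (48 * length T) / real \<tau>" by (rule of_nat_div_le_of_nat)
    then have "real (card (com_regs choose_com) + 48 * length T div \<tau>) \<le> r2 + 48 * (n / real \<tau>)"
      by (simp add: r2_def n_def)
    also have "\<dots> \<le> (r2 + 48) * (n / real \<tau>)"
    proof -
      have "1 \<le> n / real \<tau>" using n \<tau> by simp
      then have "r2 * 1 \<le> r2 * (n / real \<tau>)" using r by (intro mult_left_mono)
      then show ?thesis by (simp add: algebra_simps)
    qed
    finally have sp: "space_within choose_com w T \<tau> ((r2 + 48) * (n / real \<tau>))" by (rule sol(2))
    have "halt_prob choose_com w T \<tau> (3000 * (n * real \<tau> * log 2 n)) = 1" if n2: "2 \<le> n"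
    proof (rule sol(3))
      have "real (2 ^ (L - 1)) \<le> real (length T)" using L by (simp only: of_nat_le_iff)
      then have "(2::real) ^ (L - 1) \<le> n" by (simp add: n_def)
      then have "log 2 (2 ^ (L - 1)) \<le> log 2 n" using n by (subst log_le_cancel_iff) auto
      then have "real (L - 1) \<le> log 2 n" by (simp add: log_nat_power)
      \<comment> \<open>For \<open>n \<ge> 2\<close> the logarithm absorbs the rounding:
        \<open>L \<le> log 2 n + 1 \<le> 2 * log 2 n\<close>. This doubles \<open>1500\<close> to
        \<open>3000\<close>.\<close>
      moreover have "1 \<le> log 2 n" using n2 by simp
      ultimately have "real L \<le> 2 * log 2 n" by linarith
      then have "n * real \<tau> * real L \<le> n * real \<tau> * (2 * log 2 n)" using n by (intro mult_left_mono) auto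
      then show "real (1500 * (length T * \<tau> * L)) \<le> 3000 * (n * real \<tau> * log 2 n)"
        by (simp add: n_def mult_ac)
    qed
    then show ?thesis using sol(1) sp by blast
  qed
  have part2': "1 - 1 / n powr c \<le> halt_prob choose_com w T \<tau> (3000 * (n * real \<tau> * log 2 n))"
    if v: "valid_instance 8 w T \<tau>" and n_def: "n = real (length T)" for w T \<tau> n and c :: real
  proof (cases "2 \<le> n")
    case True
    then show ?thesis using part2[OF v n_def] by simp
  next
    \<comment> \<open>For \<open>n = 1\<close> the time bound is zero, since
      \<open>log 2 1 = 0\<close>, but the required probability \<open>1 - 1 / n powr c\<close> is
      zero as well.\<close>
    case False
    then have "length T = 1" using v n_def by (simp add: valid_instance_def)
    then show ?thesis by (simp add: n_def halt_prob_def)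
  qed
  show "\<exists>P K C.
      (\<forall>w T \<tau> n. valid_instance K w T \<tau> \<and> n = real (length T) \<longrightarrow>
         solves_palindromes P w T \<tau> \<and>
         space_within P w T \<tau> (C * (n / real \<tau>))) \<and>
      (\<forall>c > 0. \<exists>C'. \<forall>w T \<tau> n. valid_instance K w T \<tau> \<and> n = real (length T) \<longrightarrow>
         halt_prob P w T \<tau> (C' * (n * real \<tau> * log 2 n)) \<ge> 1 - 1 / n powr c)"
  proof (rule exI[of _ choose_com], rule exI[of _ 8], rule exI[of _ "r2 + 48"],
      intro conjI[OF allI[OF allI[OF allI[OF allI]]]] impI)
    show "solves_palindromes choose_com w T \<tau> \<and>
        space_within choose_com w T \<tau> ((r2 + 48) * (n / real \<tau>))"
      if "valid_instance 8 w T \<tau> \<and> n = real (length T)" for w T \<tau> n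
      using part2[of w T \<tau> n] that by simp
    show "\<forall>c > 0. \<exists>C'. \<forall>w T \<tau> n. valid_instance 8 w T \<tau> \<and> n = real (length T) \<longrightarrow>
         halt_prob choose_com w T \<tau> (C' * (n * real \<tau> * log 2 n)) \<ge> 1 - 1 / n powr c"
      \<comment> \<open>One constant serves every \<open>c\<close>, as the halting probability is
        \<open>1\<close> for all \<open>n \<ge> 2\<close>.\<close>
      by (intro allI impI exI[of _ 3000], elim conjE, rule part2')
  qed
qed

end
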